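(* Let $M$ be a finite monoid of Lie type with Weyl group $(W,S)$, Renner monoid $R$ and cross-section lattice $\Lambda$, and let $e\in\Lambda$. Let $\theta\le\sigma$ in $WeW$ (Bruhat-Chevalley order). Then the Möbius function of $(WeW,\le)$ satisfies $$\mu_{\theta,\sigma}=\begin{cases}(-1)^{\ell(\sigma)-\ell(\theta)} & \text{if every length } 2 \text{ interval contained in } [\theta,\sigma] \text{ has exactly } 4 \text{ elements},\\ 0 & \text{otherwise.}\end{cases}$$
   Context: Monoid setting. A finite monoid of Lie type (Putcha) is a finite regular monoid $M$ whose unit group $G$ is a finite group of Lie type, generated by $G$ and its idempotent set $E(M)$, such that for every $e\in E(M)$ the sets $P(e)=\{x\in G: xe=exe\}$ and $P^-(e)=\{x\in G: ex=exe\}$ are opposite parabolic subgroups with $R_u(P(e))e=\{e\}=eR_u(P^-(e))$ ($R_u$ = unipotent radical), and any two $\mathcal J$-equivalent idempotents are $G$-conjugate. Fix a Borel subgroup $B\subseteq G$ with opposite $B^-$ and maximal torus $T=B\cap B^-$; let $W$ be the (finite) Weyl group of $T$, $S$ its set of simple reflections determined by $B$, and $\ell$, $\le$ the length function and Bruhat order of $(W,S)$. The cross-section lattice is $\Lambda=\{e\in E(M): B\subseteq P(e),\ B^-\subseteq P^-(e)\}$. The Renner monoid $R$ is the finite inverse monoid with unit group $W$, consisting of the classes modulo $T$ of the products of representatives of elements of $W$ with $W$-conjugates of elements of $\Lambda$; one has $R=\bigsqcup_{e\in\Lambda}WeW$. Orbit combinatorics. For $e\in\Lambda$ put $W(e)=\{x\in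 W: xe=ex\}$ and $W_e=\{x\in W: xe=e\}$; these are standard parabolic subgroups of $W$ and $W_e$ is normal in $W(e)$. In $WeW$, $aeb^{-1}=a'eb'^{-1}$ iff there is $w\in W(e)$ with $a'\in awW_e$ and $b'\in bwW_e$. Let $D(e)$ (resp. $D_e$) be the set of minimal length representatives of the cosets $xW(e)$ (resp. $xW_e$). Every $\sigma\in WeW$ has a unique standard form $\sigma=xey^{-1}$ with $x\in D_e$, $y\in D(e)$. Set $\ell(e)=\ell(w_0)-\ell(v_0)$, with $w_0,v_0$ the longest elements of $W$, $W(e)$, and $\ell(\sigma)=\ell(x)+\ell(e)-\ell(y)$; on $WeW$ this is the rank function. The Bruhat-Chevalley order on $WeW$ is: for standard forms $\theta=uev^{-1}$, $\sigma=xey^{-1}$, $\theta\le\sigma$ iff there is $w\in W(e)$ with $u\le xw$ and $yw\le v$ in $W$. An interval $[\alpha,\beta]=\{\tau\in WeW:\alpha\le\tau\le\beta\}$ has length $\ell(\beta)-\ell(\alpha)$. Möbius function: $\mu_{\theta,\sigma}=0$ if $\theta\not\le\sigma$, $\mu_{\theta,\theta}=1$, and $\mu_{\theta,\sigma}=-\sum_{\theta\le\tau<\sigma}\mu_{\theta,\tau}$ if $\theta<\sigma$. *)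

theory Defs
  imports
    "HOL-Algebra.Generated_Groups"
    "HOL-Computational_Algebra.Primes"
begin

section \<open>Coxeter combinatorics of a group with a distinguished generating set\<close>

definition word_length :: "('a, 'b) monoid_scheme \<Rightarrow> 'a set \<Rightarrow> 'a \<Rightarrow> nat" where
  "word_length W S w =
     (LEAST n. \<exists>ws. length ws = n \<and> set ws \<subseteq> S \<and> foldr (\<otimes>\<^bsub>W\<^esub>) ws \<one>\<^bsub>W\<^esub> = w)"

definition reflections :: "('a, 'b) monoid_scheme \<Rightarrow> 'a set \<Rightarrow> 'a set" where
  "reflections W S = {w \<otimes>\<^bsub>W\<^esub> s \<otimes>\<^bsub>W\<^esub> inv\<^bsub>W\<^esub> w | w s. w \<in> carrier W \<and> s \<in> S}"

definition bruhat_le :: "('a, 'b) monoid_scheme \<Rightarrow> 'a set \<Rightarrow> 'a \<Rightarrow> 'a \<Rightarrow> bool" where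
  "bruhat_le W S u v \<longleftrightarrow>
     (u, v) \<in> {(x, x \<otimes>\<^bsub>W\<^esub> t) | x t. x \<in> carrier W \<and> t \<in> reflections W S \<and>
                  word_length W S x < word_length W S (x \<otimes>\<^bsub>W\<^esub> t)}\<^sup>*"

definition standard_parabolic :: "('a, 'b) monoid_scheme \<Rightarrow> 'a set \<Rightarrow> 'a set \<Rightarrow> bool" where
  "standard_parabolic W S H \<longleftrightarrow> (\<exists>I\<subseteq>S. H = generate W I)"

text \<open>Meaningful when \<open>H\<close> has a unique element of maximal length, as finite standard
  parabolic subgroups do.\<close>

definition longest :: "('a, 'b) monoid_scheme \<Rightarrow> 'a set \<Rightarrow> 'a set \<Rightarrow> 'a" where
  "longest W S H = (ARG_MAX (word_length W S) w. w \<in> H)"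

definition min_coset_reps :: "('a, 'b) monoid_scheme \<Rightarrow> 'a set \<Rightarrow> 'a set \<Rightarrow> 'a set" where
  "min_coset_reps W S H =
     {x \<in> carrier W. \<forall>h\<in>H. word_length W S x \<le> word_length W S (x \<otimes>\<^bsub>W\<^esub> h)}"


section \<open>Groups with a BN-pair and finite groups of Lie type\<close>

text \<open>The elements of \<open>W = N / T\<close>, with \<open>T = B \<inter> N\<close>, are literally the cosets of \<open>T\<close> in
  \<open>N\<close>; hence \<open>B w B\<close> is the product of subsets of \<open>G\<close>, and \<open>\<Union>I\<close> is the set of all
  representatives of elements of \<open>I \<subseteq> W\<close>.\<close>

definition weyl_group :: "('a, 'b) monoid_scheme \<Rightarrow> 'a set \<Rightarrow> 'a set \<Rightarrow> 'a set monoid" where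
  "weyl_group G B N = (G\<lparr>carrier := N\<rparr>) Mod (B \<inter> N)"

locale BN_pair = group G for G (structure) and B N :: "'a set" and S :: "'a set set" +
  assumes B_subgroup: "subgroup B G"
    and N_subgroup: "subgroup N G"
    and generated: "generate G (B \<union> N) = carrier G"
    and T_normal: "(B \<inter> N) \<lhd> (G\<lparr>carrier := N\<rparr>)"
    and S_subset: "S \<subseteq> carrier (weyl_group G B N)"
    and S_generates: "generate (weyl_group G B N) S = carrier (weyl_group G B N)"
    and S_order_2: "s \<in> S \<Longrightarrow> s \<noteq> B \<inter> N \<and> s <#> s = B \<inter> N"
    and double_cosets: "\<lbrakk>s \<in> S; w \<in> carrier (weyl_group G B N)\<rbrakk> \<Longrightarrow>
        s <#> B <#> w \<subseteq> (B <#> w <#> B) \<union> (B <#> (s <#> w) <#> B)"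
    and not_normalizing: "s \<in> S \<Longrightarrow> \<not> s <#> B <#> s \<subseteq> B"

text \<open>In a finite group of Lie type in characteristic \<open>p\<close> the unipotent elements are the
  \<open>p\<close>-elements, so the unipotent radical of a subgroup is its largest normal \<open>p\<close>-subgroup.\<close>

definition unipotent_radical :: "('a, 'b) monoid_scheme \<Rightarrow> nat \<Rightarrow> 'a set \<Rightarrow> 'a set" where
  "unipotent_radical G p H =
     generate G (\<Union>{K. K \<lhd> (G\<lparr>carrier := H\<rparr>) \<and> (\<exists>k. card K = p ^ k)})"

text \<open>Finite groups of Lie type are given by the usual axioms of a finite group with a strongly
  split BN-pair of characteristic \<open>p\<close>. The last axiom is the consequence
  \<open>U \<inter> U\<^sup>w \<lhd> U\<close> (\<open>w\<close> longest in \<open>W\<^sub>I\<close>) of the Chevalley commutator relations, from which the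
  Levi decompositions of the parabolic subgroups follow.\<close>

locale finite_group_of_Lie_type = BN_pair G B N S
  for G (structure) and p :: nat and B N S +
  assumes finite_carrier: "finite (carrier G)"
    and prime_p: "prime p"
    and T_commutative: "\<lbrakk>s \<in> B \<inter> N; t \<in> B \<inter> N\<rbrakk> \<Longrightarrow> s \<otimes> t = t \<otimes> s"
    and T_order: "\<not> p dvd card (B \<inter> N)"
    and B_split: "B = unipotent_radical G p B <#> (B \<inter> N)"
    and saturated: "(\<Inter>n\<in>N. n <# B #> inv n) = B \<inter> N"
    and strongly_split:
      "\<lbrakk>I \<subseteq> S; n \<in> longest (weyl_group G B N) S (generate (weyl_group G B N) I)\<rbrakk> \<Longrightarrow>
        (unipotent_radical G p B \<inter> (n <# unipotent_radical G p B #> inv n))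
          \<lhd> (G\<lparr>carrier := unipotent_radical G p B\<rparr>)"

text \<open>The opposite \<open>B\<^sup>- = w\<^sub>0 B w\<^sub>0\<^sup>-\<^sup>1\<close>; by the axioms above \<open>B \<inter> B\<^sup>- = B \<inter> N\<close>.\<close>

definition opposite_borel ::
    "('a, 'b) monoid_scheme \<Rightarrow> 'a set \<Rightarrow> 'a set \<Rightarrow> 'a set set \<Rightarrow> 'a set" where
  "opposite_borel G B N S =
     (let W = weyl_group G B N; w0 = longest W S (carrier W)
      in w0 <#>\<^bsub>G\<^esub> B <#>\<^bsub>G\<^esub> inv\<^bsub>W\<^esub> w0)"

definition opposite_parabolics ::
    "('a, 'b) monoid_scheme \<Rightarrow> 'a set \<Rightarrow> 'a set \<Rightarrow> 'a set set \<Rightarrow> 'a set \<Rightarrow> 'a set \<Rightarrow> bool" where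
  "opposite_parabolics G B N S P Q \<longleftrightarrow>
     (\<exists>g\<in>carrier G. \<exists>I\<subseteq>S.
        P = g <#\<^bsub>G\<^esub> generate G (B \<union> \<Union>I) #>\<^bsub>G\<^esub> inv\<^bsub>G\<^esub> g \<and>
        Q = g <#\<^bsub>G\<^esub> generate G (opposite_borel G B N S \<union> \<Union>I) #>\<^bsub>G\<^esub> inv\<^bsub>G\<^esub> g)"


section \<open>Finite monoids of Lie type\<close>

definition idempotents :: "('a, 'b) monoid_scheme \<Rightarrow> 'a set" where
  "idempotents M = {e \<in> carrier M. e \<otimes>\<^bsub>M\<^esub> e = e}"

definition J_equivalent :: "('a, 'b) monoid_scheme \<Rightarrow> 'a \<Rightarrow> 'a \<Rightarrow> bool" where
  "J_equivalent M a b \<longleftrightarrow>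
     {x \<otimes>\<^bsub>M\<^esub> a \<otimes>\<^bsub>M\<^esub> y | x y. x \<in> carrier M \<and> y \<in> carrier M} =
     {x \<otimes>\<^bsub>M\<^esub> b \<otimes>\<^bsub>M\<^esub> y | x y. x \<in> carrier M \<and> y \<in> carrier M}"

definition P_plus :: "('a, 'b) monoid_scheme \<Rightarrow> 'a \<Rightarrow> 'a set" where
  "P_plus M e = {x \<in> Units M. x \<otimes>\<^bsub>M\<^esub> e = e \<otimes>\<^bsub>M\<^esub> x \<otimes>\<^bsub>M\<^esub> e}"

definition P_minus :: "('a, 'b) monoid_scheme \<Rightarrow> 'a \<Rightarrow> 'a set" where
  "P_minus M e = {x \<in> Units M. e \<otimes>\<^bsub>M\<^esub> x = e \<otimes>\<^bsub>M\<^esub> x \<otimes>\<^bsub>M\<^esub> e}"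

locale finite_monoid_of_Lie_type = monoid M
  for M (structure) and p :: nat and B N :: "'a set" and S :: "'a set set" +
  assumes finite_monoid: "finite (carrier M)"
    and regular: "a \<in> carrier M \<Longrightarrow> \<exists>x\<in>carrier M. a \<otimes> x \<otimes> a = a"
    and unit_group: "finite_group_of_Lie_type (units_of M) p B N S"
    and generated_by_units_idempotents:
      "\<lbrakk>submonoid H M; Units M \<subseteq> H; idempotents M \<subseteq> H\<rbrakk> \<Longrightarrow> H = carrier M"
    and opposite_parabolic: "e \<in> idempotents M \<Longrightarrow>
      opposite_parabolics (units_of M) B N S (P_plus M e) (P_minus M e)"
    and radical_left: "e \<in> idempotents M \<Longrightarrow>
      unipotent_radical (units_of M) p (P_plus M e) #> e = {e}"
    and radical_right: "e \<in> idempotents M \<Longrightarrow>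
      e <# unipotent_radical (units_of M) p (P_minus M e) = {e}"
    and J_equivalent_conjugate:
      "\<lbrakk>e \<in> idempotents M; f \<in> idempotents M; J_equivalent M e f\<rbrakk> \<Longrightarrow>
        \<exists>g\<in>Units M. f = g \<otimes> e \<otimes> inv g"


section \<open>The Renner monoid and the orbits \<open>WeW\<close>\<close>

context
  fixes M :: "('a, 'b) monoid_scheme" (structure) and B N :: "'a set" and S :: "'a set set"
begin

definition cross_section_lattice :: "'a set" where
  "cross_section_lattice =
     {e \<in> idempotents M. B \<subseteq> P_plus M e \<and> opposite_borel (units_of M) B N S \<subseteq> P_minus M e}"

definition Weyl :: "'a set monoid" where
  "Weyl = weyl_group (units_of M) B N"

text \<open>Elements of the Renner monoid are classes \<open>T a\<close>, multiplied as subsets of \<open>M\<close>;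
  the elements of \<open>W\<close> are among them.\<close>

definition renner_monoid :: "'a set monoid" where
  "renner_monoid =
     \<lparr>carrier = {(B \<inter> N) #> (n \<otimes> (m \<otimes> e \<otimes> inv m)) | n m e.
                   n \<in> N \<and> m \<in> N \<and> e \<in> cross_section_lattice},
      monoid.mult = set_mult M,
      one = B \<inter> N\<rparr>"

abbreviation len :: "'a set \<Rightarrow> nat" where
  "len \<equiv> word_length Weyl S"

context
  fixes e :: 'a
begin

definition idem_class :: "'a set" where
  "idem_class = (B \<inter> N) #> e"

definition W_centralizer :: "'a set set" where
  "W_centralizer =
     {x \<in> carrier Weyl. x \<otimes>\<^bsub>renner_monoid\<^esub> idem_class = idem_class \<otimes>\<^bsub>renner_monoid\<^esub> x}"

text \<open>\<open>W(e)\<close> above is always standard parabolic, but for \<open>W\<^sub>e\<close> this is a genuine standing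
  assumption over tiny fields. In \<open>G = (S\<^sub>3)\<^sup>n\<close>, a group of Lie type with \<open>p = 2\<close> and
  \<open>T = 1\<close>, let \<open>H\<close> be any subgroup containing the commutator subgroup. Then
  \<open>M = G \<union> G/H\<close>, with \<open>e\<close> the identity of \<open>G/H\<close>, is a finite monoid of Lie type in the
  sense above, \<open>W\<close> is a product of \<open>n\<close> groups of order 2, and \<open>W\<^sub>e = W \<inter> H\<close> can be any
  subgroup of \<open>W\<close>.\<close>

definition W_stabilizer :: "'a set set" where
  "W_stabilizer = {x \<in> carrier Weyl. x \<otimes>\<^bsub>renner_monoid\<^esub> idem_class = idem_class}"

definition orbit :: "'a set set" where
  "orbit = {x \<otimes>\<^bsub>renner_monoid\<^esub> idem_class \<otimes>\<^bsub>renner_monoid\<^esub> y | x y.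
              x \<in> carrier Weyl \<and> y \<in> carrier Weyl}"

definition standard_form :: "'a set \<Rightarrow> 'a set \<Rightarrow> 'a set \<Rightarrow> bool" where
  "standard_form \<sigma> x y \<longleftrightarrow>
     x \<in> min_coset_reps Weyl S W_stabilizer \<and>
     y \<in> min_coset_reps Weyl S W_centralizer \<and>
     \<sigma> = x \<otimes>\<^bsub>renner_monoid\<^esub> idem_class \<otimes>\<^bsub>renner_monoid\<^esub> inv\<^bsub>Weyl\<^esub> y"

definition idem_length :: int where
  "idem_length = int (len (longest Weyl S (carrier Weyl))) - int (len (longest Weyl S W_centralizer))"

definition orbit_length :: "'a set \<Rightarrow> int" where
  "orbit_length \<sigma> =
     (THE l. \<exists>x y. standard_form \<sigma> x y \<and> l = int (len x) + idem_length - int (len y))"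

definition orbit_le :: "'a set \<Rightarrow> 'a set \<Rightarrow> bool" where
  "orbit_le \<theta> \<sigma> \<longleftrightarrow>
     (\<exists>u v x y. standard_form \<theta> u v \<and> standard_form \<sigma> x y \<and>
        (\<exists>w\<in>W_centralizer. bruhat_le Weyl S u (x \<otimes>\<^bsub>Weyl\<^esub> w) \<and>
                           bruhat_le Weyl S (y \<otimes>\<^bsub>Weyl\<^esub> w) v))"

definition orbit_interval :: "'a set \<Rightarrow> 'a set \<Rightarrow> 'a set set" where
  "orbit_interval \<alpha> \<beta> = {\<tau> \<in> orbit. orbit_le \<alpha> \<tau> \<and> orbit_le \<tau> \<beta>}"

end

end


section \<open>Moebius function of a finite poset\<close>

text \<open>Recursion in the upper argument; the next lemma gives the defining equations.\<close>

definition mobius :: "'a set \<Rightarrow> ('a \<Rightarrow> 'a \<Rightarrow> bool) \<Rightarrow> 'a \<Rightarrow> 'a \<Rightarrow> int" where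
  "mobius A leq \<theta> = wfrec {(\<tau>, \<sigma>). \<tau> \<in> A \<and> \<sigma> \<in> A \<and> leq \<tau> \<sigma> \<and> \<tau> \<noteq> \<sigma>}
     (\<lambda>\<mu> \<sigma>. if \<theta> \<notin> A \<or> \<sigma> \<notin> A \<or> \<not> leq \<theta> \<sigma> then 0
            else if \<theta> = \<sigma> then 1
            else - (\<Sum>\<tau>\<in>{\<tau> \<in> A. leq \<theta> \<tau> \<and> leq \<tau> \<sigma> \<and> \<tau> \<noteq> \<sigma>}. \<mu> \<tau>))"

lemma mobius_rec:
  assumes fin: "finite A"
    and antisym: "\<And>x y. \<lbrakk>x \<in> A; y \<in> A; leq x y; leq y x\<rbrakk> \<Longrightarrow> x = y"
    and trans: "\<And>x y z. \<lbrakk>x \<in> A; y \<in> A; z \<in> A; leq x y; leq y z\<rbrakk> \<Longrightarrow> leq x z"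
  shows "mobius A leq \<theta> \<sigma> =
     (if \<theta> \<notin> A \<or> \<sigma> \<notin> A \<or> \<not> leq \<theta> \<sigma> then 0
      else if \<theta> = \<sigma> then 1
      else - (\<Sum>\<tau>\<in>{\<tau> \<in> A. leq \<theta> \<tau> \<and> leq \<tau> \<sigma> \<and> \<tau> \<noteq> \<sigma>}. mobius A leq \<theta> \<tau>))"
proof -
  let ?r = "{(\<tau>, \<sigma>). \<tau> \<in> A \<and> \<sigma> \<in> A \<and> leq \<tau> \<sigma> \<and> \<tau> \<noteq> \<sigma>}"
  have "trans ?r"
    by (rule transI) (use antisym trans in blast)
  then have "acyclic ?r"
    by (auto simp: acyclic_def trancl_id)
  moreover have "finite ?r"
    by (rule finite_subset[of _ "A \<times> A"]) (use fin in auto)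
  ultimately have wf: "wf ?r"
    by (rule finite_acyclic_wf[rotated])
  show ?thesis
    unfolding mobius_def
    by (subst wfrec[OF wf]) (auto simp: cut_apply intro!: sum.cong)
qed

end

theory Submission
  imports Defs
begin

text \<open>By uniqueness of the standard form, \<open>WeW\<close> is the set of pairs \<open>(x, y) \<in> D\<^sub>e \<times> D(e)\<close>. Left and
  right multiplication by a simple reflection act on it by involutions which move an element by at
  most one rank and have the lifting property: if \<open>\<theta> \<le> \<sigma>\<close>, then \<open>min(\<theta>, s\<theta>) \<le> min(\<sigma>, s\<sigma>)\<close> and
  \<open>max(\<theta>, s\<theta>) \<le> max(\<sigma>, s\<sigma>)\<close>. Every non-minimal \<open>\<sigma>\<close> has a descent \<open>s\<sigma> < \<sigma>\<close>, and the lifting property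
  gives the recursion \<open>\<mu>(\<theta>, \<sigma>) = 0\<close>, \<open>-\<mu>(\<theta>, s\<sigma>)\<close> or \<open>\<mu>(s\<theta>, s\<sigma>)\<close>
  according to whether \<open>s\<theta> = \<theta>\<close>, \<open>s\<theta> > \<theta>\<close> or \<open>s\<theta> < \<theta>\<close>. The property that all intervals of
  length two have four elements satisfies the same recursion.\<close>

section \<open>Moebius functions of posets with lifting involutions\<close>

lemma obtain_min_rank:
  fixes f :: "'b \<Rightarrow> int"
  assumes "finite D" "D \<noteq> {}"
  obtains v where "v \<in> D" "\<And>z. z \<in> D \<Longrightarrow> f v \<le> f z"
proof (rule that[of "arg_min_on f D"])
  show "arg_min_on f D \<in> D" using assms by (rule arg_min_if_finite(1))
  show "f (arg_min_on f D) \<le> f z" if "z \<in> D" for z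
    using assms that by (rule arg_min_least)
qed

definition raise :: "('p \<Rightarrow> int) \<Rightarrow> ('p \<Rightarrow> 'p) \<Rightarrow> 'p \<Rightarrow> 'p" where
  "raise rk f x = (if rk x < rk (f x) then f x else x)"

definition lower :: "('p \<Rightarrow> int) \<Rightarrow> ('p \<Rightarrow> 'p) \<Rightarrow> 'p \<Rightarrow> 'p" where
  "lower rk f x = (if rk (f x) < rk x then f x else x)"

locale involution_poset =
  fixes A :: "'p set" and le :: "'p \<Rightarrow> 'p \<Rightarrow> bool" (infix "\<preceq>" 50)
    and rk :: "'p \<Rightarrow> int" and I :: "'i set" and act :: "'i \<Rightarrow> 'p \<Rightarrow> 'p"
  assumes finite_poset: "finite A"
    and le_refl: "x \<in> A \<Longrightarrow> x \<preceq> x"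
    and le_trans: "\<lbrakk>x \<in> A; y \<in> A; z \<in> A; x \<preceq> y; y \<preceq> z\<rbrakk> \<Longrightarrow> x \<preceq> z"
    and rk_less: "\<lbrakk>x \<in> A; y \<in> A; x \<preceq> y; x \<noteq> y\<rbrakk> \<Longrightarrow> rk x < rk y"
    and act_closed: "\<lbrakk>i \<in> I; x \<in> A\<rbrakk> \<Longrightarrow> act i x \<in> A"
    and act_act: "\<lbrakk>i \<in> I; x \<in> A\<rbrakk> \<Longrightarrow> act i (act i x) = x"
    and act_up: "\<lbrakk>i \<in> I; x \<in> A; rk x < rk (act i x)\<rbrakk> \<Longrightarrow> x \<preceq> act i x \<and> rk (act i x) = rk x + 1"
    and act_fixed: "\<lbrakk>i \<in> I; x \<in> A; rk (act i x) = rk x\<rbrakk> \<Longrightarrow> act i x = x"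
    and raise_mono: "\<lbrakk>i \<in> I; x \<in> A; y \<in> A; x \<preceq> y\<rbrakk> \<Longrightarrow> raise rk (act i) x \<preceq> raise rk (act i) y"
    and lower_mono: "\<lbrakk>i \<in> I; x \<in> A; y \<in> A; x \<preceq> y\<rbrakk> \<Longrightarrow> lower rk (act i) x \<preceq> lower rk (act i) y"
begin

lemma le_antisym: "\<lbrakk>x \<in> A; y \<in> A; x \<preceq> y; y \<preceq> x\<rbrakk> \<Longrightarrow> x = y"
  by (metis order_less_asym rk_less)

lemma rk_mono: "\<lbrakk>x \<in> A; y \<in> A; x \<preceq> y\<rbrakk> \<Longrightarrow> rk x \<le> rk y"
  by (metis order_le_less rk_less)

lemma interval_length_one:
  assumes "x \<in> A" "y \<in> A" "x \<preceq> y" "rk y = rk x + 1"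
  shows "{z \<in> A. x \<preceq> z \<and> z \<preceq> y} = {x, y}"
proof -
  have "z = x \<or> z = y" if "z \<in> A" "x \<preceq> z" "z \<preceq> y" for z
    using rk_less[of x z] rk_less[of z y] that assms by fastforce
  then show ?thesis using assms le_refl by blast
qed

lemma act_down:
  assumes "i \<in> I" "x \<in> A" "rk (act i x) < rk x"
  shows "act i x \<preceq> x \<and> rk x = rk (act i x) + 1"
  using act_up[of i "act i x"] assms act_act act_closed by auto

lemma raise_le:
  assumes "i \<in> I" "x \<in> A" "y \<in> A" "x \<preceq> y" "rk x < rk (act i x)" "rk (act i y) \<le> rk y"
  shows "act i x \<preceq> y"
  using raise_mono[of i x y] assms by (auto simp: raise_def)

lemma le_lower:
  assumes "i \<in> I" "x \<in> A" "y \<in> A" "x \<preceq> y" "rk x \<le> rk (act i x)" "rk (act i y) < rk y"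
  shows "x \<preceq> act i y"
  using lower_mono[of i x y] assms by (auto simp: lower_def)

lemma lower_lower:
  assumes "i \<in> I" "x \<in> A" "y \<in> A" "x \<preceq> y" "rk (act i x) < rk x" "rk (act i y) < rk y"
  shows "act i x \<preceq> act i y"
  using lower_mono[of i x y] assms by (auto simp: lower_def)

lemma raise_raise:
  assumes "i \<in> I" "x \<in> A" "y \<in> A" "x \<preceq> y" "rk x < rk (act i x)" "rk y < rk (act i y)"
  shows "act i x \<preceq> act i y"
  using raise_mono[of i x y] assms by (auto simp: raise_def)

lemma act_le_of_stable:
  assumes "i \<in> I" "x \<in> A" "y \<in> A" "x \<preceq> y" "rk (act i y) \<le> rk y"
  shows "act i x \<preceq> y"
proof (cases "rk x < rk (act i x)")
  case True
  then show ?thesis using raise_le assms by blast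
next
  case False
  then have "act i x \<preceq> x"
    using act_down[of i x] act_fixed[of i x] assms le_refl[of x] by (cases "rk (act i x) = rk x") auto
  then show ?thesis using le_trans assms act_closed by blast
qed

lemma le_act_of_stable:
  assumes "i \<in> I" "x \<in> A" "y \<in> A" "x \<preceq> y" "rk x \<le> rk (act i x)"
  shows "x \<preceq> act i y"
proof (cases "rk (act i y) < rk y")
  case True
  then show ?thesis using le_lower assms by blast
next
  case False
  then have "y \<preceq> act i y"
    using act_up[of i y] act_fixed[of i y] assms le_refl[of y] by (cases "rk (act i y) = rk y") auto
  then show ?thesis using le_trans assms act_closed by blast
qed

lemma order_dual: "involution_poset A (\<lambda>x y. y \<preceq> x) (\<lambda>x. - rk x) I act"
proof
  fix i x y assume xy: "i \<in> I" "x \<in> A" "y \<in> A" "y \<preceq> x"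
  have "raise (\<lambda>x. - rk x) (act i) = lower rk (act i)" "lower (\<lambda>x. - rk x) (act i) = raise rk (act i)"
    by (auto simp: raise_def lower_def fun_eq_iff)
  then show "raise (\<lambda>x. - rk x) (act i) y \<preceq> raise (\<lambda>x. - rk x) (act i) x"
    and "lower (\<lambda>x. - rk x) (act i) y \<preceq> lower (\<lambda>x. - rk x) (act i) x"
    using xy raise_mono lower_mono by simp_all
next
  fix i x assume "i \<in> I" "x \<in> A" "- rk x < - rk (act i x)"
  then show "act i x \<preceq> x \<and> - rk (act i x) = - rk x + 1"
    using act_down by force
next
  fix x y assume "x \<in> A" "y \<in> A" "y \<preceq> x" "x \<noteq> y"
  then show "- rk x < - rk y" using rk_less[of y x] by simp
next
  fix x y z assume "x \<in> A" "y \<in> A" "z \<in> A" "y \<preceq> x" "z \<preceq> y"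
  then show "z \<preceq> x" using le_trans[of z y x] by simp
next
  fix i x assume "i \<in> I" "x \<in> A" "- rk (act i x) = - rk x"
  then show "act i x = x" using act_fixed by simp
qed (rule finite_poset le_refl act_closed act_act; assumption)+

end

text \<open>Every axiom is self-dual, so each result below also holds for the reversed order with
  rank \<open>-rk\<close>, with \<open>mu\<close> transposed.\<close>

locale mobius_involution_poset = involution_poset +
  fixes mu :: "'a \<Rightarrow> 'a \<Rightarrow> int"
  assumes coatom: "\<lbrakk>x \<in> A; y \<in> A; x \<preceq> y; x \<noteq> y\<rbrakk> \<Longrightarrow> \<exists>z\<in>A. x \<preceq> z \<and> z \<preceq> y \<and> rk z = rk y - 1"
    and atom: "\<lbrakk>x \<in> A; y \<in> A; x \<preceq> y; x \<noteq> y\<rbrakk> \<Longrightarrow> \<exists>z\<in>A. x \<preceq> z \<and> z \<preceq> y \<and> rk z = rk x + 1"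
    and mu_refl: "x \<in> A \<Longrightarrow> mu x x = 1"
    and mu_upper: "\<lbrakk>x \<in> A; y \<in> A; x \<preceq> y; x \<noteq> y\<rbrakk> \<Longrightarrow> (\<Sum>z | z \<in> A \<and> x \<preceq> z \<and> z \<preceq> y. mu x z) = 0"
    and mu_lower: "\<lbrakk>x \<in> A; y \<in> A; x \<preceq> y; x \<noteq> y\<rbrakk> \<Longrightarrow> (\<Sum>z | z \<in> A \<and> x \<preceq> z \<and> z \<preceq> y. mu z y) = 0"
begin

lemma mobius_order_dual:
  "mobius_involution_poset A (\<lambda>x y. y \<preceq> x) (\<lambda>x. - rk x) I act (\<lambda>x y. mu y x)"
proof -
  interpret dual: involution_poset A "\<lambda>x y. y \<preceq> x" "\<lambda>x. - rk x" I act
    by (rule order_dual)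
  show ?thesis
  proof
    fix x y assume xy: "x \<in> A" "y \<in> A" "y \<preceq> x" "x \<noteq> y"
    show "\<exists>z\<in>A. z \<preceq> x \<and> y \<preceq> z \<and> - rk z = - rk y - 1"
      using atom[of y x] xy by force
    show "\<exists>z\<in>A. z \<preceq> x \<and> y \<preceq> z \<and> - rk z = - rk x + 1"
      using coatom[of y x] xy by force
    show "(\<Sum>z | z \<in> A \<and> z \<preceq> x \<and> y \<preceq> z. mu z x) = 0"
      using mu_lower[of y x] xy by (simp add: conj_commute)
    show "(\<Sum>z | z \<in> A \<and> z \<preceq> x \<and> y \<preceq> z. mu y z) = 0"
      using mu_upper[of y x] xy by (simp add: conj_commute)
  qed (rule mu_refl)
qed

definition thin :: "'a \<Rightarrow> 'a \<Rightarrow> bool" where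
  "thin x y \<longleftrightarrow> (\<forall>a\<in>A. \<forall>b\<in>A. x \<preceq> a \<and> a \<preceq> b \<and> b \<preceq> y \<and> rk b - rk a = 2 \<longrightarrow> mu a b \<noteq> 0)"

lemma thin_subinterval:
  assumes "thin x y" "x \<in> A" "y \<in> A" "x' \<in> A" "y' \<in> A" "x \<preceq> x'" "y' \<preceq> y"
  shows "thin x' y'"
  unfolding thin_def
proof (intro ballI impI, elim conjE)
  fix a b assume ab: "a \<in> A" "b \<in> A" "x' \<preceq> a" "a \<preceq> b" "b \<preceq> y'" "rk b - rk a = 2"
  have "x \<preceq> a" using le_trans[of x x' a] assms ab by blast
  moreover have "b \<preceq> y" using le_trans[of b y' y] assms ab by blast
  ultimately show "mu a b \<noteq> 0" using assms(1) ab unfolding thin_def by blast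
qed

lemma mu_fixed_bottom:
  assumes "i \<in> I" "u \<in> A" "w \<in> A" "u \<preceq> w" "act i u = u" "rk (act i w) < rk w"
  shows "mu u w = 0"
  using assms(3,4,6)
proof (induction "nat (rk w - rk u)" arbitrary: w rule: less_induct)
  case less
  let ?w = "act i w"
  let ?X = "{z \<in> A. u \<preceq> z \<and> z \<preceq> ?w}" and ?Y = "{z \<in> A. u \<preceq> z \<and> z \<preceq> w}"
  have w: "?w \<in> A" "?w \<preceq> w" "u \<preceq> ?w" "act i ?w = w"
    using less.prems assms act_closed act_down le_lower[of i u w] act_act by auto
  have "u \<noteq> ?w" using w assms less.prems by auto
  have fin: "finite ?Y" using finite_poset by simp
  have sub: "?X \<subseteq> ?Y" using w less.prems le_trans by blast
  have wX: "w \<notin> ?X" using w le_antisym less.prems by (metis (mono_tags, lifting) less_irrefl mem_Collect_eq)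
  have zero: "mu u z = 0" if "z \<in> ?Y - ?X - {w}" for z
  proof -
    have z: "z \<in> A" "u \<preceq> z" "z \<preceq> w" "\<not> z \<preceq> ?w" "z \<noteq> w" using that by auto
    have d: "rk (act i z) < rk z"
      using le_lower[of i z w] z assms(1) less.prems by linarith
    have "rk z < rk w" "rk u \<le> rk z" using z rk_less less.prems rk_mono assms by auto
    then show ?thesis using less.hyps[of z] z d by auto
  qed
  have "0 = (\<Sum>z\<in>?Y. mu u z)"
    using mu_upper[of u w] less.prems assms w \<open>u \<noteq> ?w\<close> by (metis (no_types, lifting))
  also have "\<dots> = (\<Sum>z\<in>?X. mu u z) + (\<Sum>z\<in>?Y - ?X. mu u z)"
    by (metis (no_types, lifting) add.commute fin sub sum.subset_diff)
  also have "(\<Sum>z\<in>?X. mu u z) = 0"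
    using mu_upper[of u ?w] w assms(2) \<open>u \<noteq> ?w\<close> by blast
  also have "(\<Sum>z\<in>?Y - ?X. mu u z) = mu u w + (\<Sum>z\<in>?Y - ?X - {w}. mu u z)"
    using fin wX less.prems le_refl by (intro sum.remove) auto
  also have "(\<Sum>z\<in>?Y - ?X - {w}. mu u z) = 0"
    using zero by (intro sum.neutral) blast
  finally show ?case by simp
qed

lemma mu_ascending_bottom:
  assumes "i \<in> I" "u \<in> A" "w \<in> A" "u \<preceq> w" "rk u < rk (act i u)" "rk (act i w) \<le> rk w"
  shows "mu u w = (if act i w = w then 0 else - mu u (act i w))"
  using assms(3,4,6)
proof (induction "nat (rk w - rk u)" arbitrary: w rule: less_induct)
  case less
  let ?Y = "{z \<in> A. u \<preceq> z \<and> z \<preceq> w}"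
  let ?X = "?Y - {w, act i w}"
  let ?f = "mu u"
  have fin: "finite ?Y" using finite_poset by simp
  have Y: "act i z \<in> ?Y" if "z \<in> ?Y" for z
    using that act_le_of_stable[of i z w] le_act_of_stable[of i u z] less.prems assms act_closed by auto
  have X: "act i z \<in> ?X" if z: "z \<in> ?X" for z
  proof -
    have "z = act i (act i z)" using act_act assms(1) z by auto
    then have "act i z \<noteq> w" "act i z \<noteq> act i w" using z act_act[of i w] less.prems assms(1) by auto
    then show ?thesis using Y z by blast
  qed
  have IH: "?f z = (if act i z = z then 0 else - ?f (act i z))" if z: "z \<in> ?X" "rk (act i z) \<le> rk z" for z
  proof -
    have "rk z < rk w" "rk u \<le> rk z" using z rk_less rk_mono less.prems assms(2) by auto
    then show ?thesis using less.hyps[of z] z by auto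
  qed
  have cancel: "?f z + ?f (act i z) = 0" if z: "z \<in> ?X" for z
  proof (cases "rk (act i z) \<le> rk z")
    case True
    then show ?thesis using IH[OF z] by auto
  next
    case False
    have zz: "act i (act i z) = z" using act_act assms(1) z by auto
    then show ?thesis using IH[OF X[OF z]] False by auto
  qed
  have "sum ?f ?X = (\<Sum>z\<in>?X. ?f (act i z))"
    using X act_act[OF assms(1)] by (intro sum.reindex_bij_witness[of _ "act i" "act i"]) auto
  then have "2 * sum ?f ?X = (\<Sum>z\<in>?X. ?f z + ?f (act i z))"
    by (simp add: sum.distrib)
  also have "\<dots> = 0" using cancel by (intro sum.neutral) blast
  finally have X0: "sum ?f ?X = 0" by simp
  have neq: "u \<noteq> w" using assms(5) less.prems by auto
  have sub: "{w, act i w} \<subseteq> ?Y" using Y[of w] less.prems le_refl by auto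
  have "0 = sum ?f ?Y" using mu_upper[of u w] neq assms less.prems by simp
  also have "\<dots> = sum ?f ?X + sum ?f {w, act i w}"
    using sum.subset_diff[OF sub fin] by blast
  finally have "sum ?f {w, act i w} = 0" using X0 by simp
  then show ?case by (cases "act i w = w") auto
qed

lemma mu_descending_top:
  assumes "i \<in> I" "u \<in> A" "w \<in> A" "u \<preceq> w" "rk u < rk (act i u)" "rk (act i w) < rk w"
  shows "mu u w = - mu (act i u) w"
proof -
  interpret dual: mobius_involution_poset A "\<lambda>x y. y \<preceq> x" "\<lambda>x. - rk x" I act "\<lambda>x y. mu y x"
    by (rule mobius_order_dual)
  show ?thesis using dual.mu_ascending_bottom[of i w u] assms by auto
qed

lemma not_thin_fixed_bottom:
  assumes "i \<in> I" "u \<in> A" "w \<in> A" "u \<preceq> w" "act i u = u" "rk (act i w) < rk w"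
  shows "\<not> thin u w"
proof -
  let ?D = "{v \<in> A. u \<preceq> v \<and> v \<preceq> w \<and> rk (act i v) < rk v}"
  have "finite ?D" "?D \<noteq> {}" using finite_poset assms le_refl by auto
  then obtain v where v: "v \<in> ?D" and min: "\<And>z. z \<in> ?D \<Longrightarrow> rk v \<le> rk z"
    using obtain_min_rank[of ?D rk] by blast
  let ?v = "act i v"
  have vA: "v \<in> A" "u \<preceq> v" "v \<preceq> w" "rk ?v < rk v" using v by auto
  have v': "?v \<in> A" "?v \<preceq> v" "act i ?v = v" "rk v = rk ?v + 1"
    using act_closed act_down act_act assms(1) vA by blast+
  moreover have "u \<preceq> ?v" using le_lower[of i u v] assms vA by simp
  ultimately have v': "?v \<in> A" "?v \<preceq> v" "u \<preceq> ?v" "act i ?v = v" "rk v = rk ?v + 1"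
    by blast+
  have "u \<noteq> ?v" using assms(5) v' by auto
  then obtain c where c: "c \<in> A" "u \<preceq> c" "c \<preceq> ?v" "rk c = rk ?v - 1"
    using coatom[of u ?v] v' assms by auto
  have cv: "c \<preceq> v" and cw: "c \<preceq> w" using c v' v le_trans assms by blast+
  have "act i c = c"
  proof (rule ccontr)
    assume neq: "act i c \<noteq> c"
    have "\<not> rk (act i c) < rk c" using min[of c] c cw v' by auto
    then have up: "rk c < rk (act i c)" using neq act_fixed[of i c] assms c by force
    then have "act i c \<preceq> v" using raise_le[of i c v] assms c cv v by auto
    then have "act i c \<preceq> w" using le_trans[of "act i c" v w] v assms c act_closed by auto
    moreover have "u \<preceq> act i c"
      using le_trans[of u c "act i c"] act_up[of i c] up c assms act_closed by auto
    ultimately have "act i c \<in> ?D" using up act_act[of i c] c assms act_closed by auto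
    then show False using min[of "act i c"] act_up[of i c] up c v' assms by auto
  qed
  then have "mu c v = 0" using mu_fixed_bottom[of i c v] assms c v cv by auto
  moreover have "rk v - rk c = 2" using v' c by simp
  ultimately show ?thesis using c v cv unfolding thin_def by blast
qed

lemma thin_extend_below:
  assumes "i \<in> I" "u \<in> A" "w \<in> A" "u \<preceq> w" "rk u < rk (act i u)" "rk (act i w) < rk w"
    and thin: "thin (act i u) w"
  shows "thin u w"
  unfolding thin_def
proof (intro ballI impI, elim conjE)
  fix a b assume ab: "a \<in> A" "b \<in> A" "u \<preceq> a" "a \<preceq> b" "b \<preceq> w" "rk b - rk a = 2"
  have u': "act i u \<in> A" "u \<preceq> act i u" using act_closed act_up assms by auto
  have nz: "mu c d \<noteq> 0" if "c \<in> A" "d \<in> A" "act i u \<preceq> c" "c \<preceq> d" "d \<preceq> w" "rk d - rk c = 2" for c d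
    using thin that unfolding thin_def by blast
  consider "rk (act i a) \<le> rk a" | "rk a < rk (act i a)" "rk (act i b) < rk b"
    | "rk a < rk (act i a)" "act i b = b" | "rk a < rk (act i a)" "rk b < rk (act i b)"
    using act_fixed[of i b] assms ab by linarith
  then show "mu a b \<noteq> 0"
  proof cases
    case 1
    then have "act i u \<preceq> a" using raise_le[of i u a] assms ab by auto
    then show ?thesis using nz ab by blast
  next
    case 2
    let ?b = "act i b"
    have b: "?b \<in> A" "rk ?b = rk a + 1" "a \<preceq> ?b"
      using act_closed act_down[of i b] le_lower[of i a b] 2 ab assms by auto
    have "{z \<in> A. a \<preceq> z \<and> z \<preceq> ?b} = {a, ?b}" using interval_length_one b ab by simp
    moreover have "a \<noteq> ?b" using b by auto
    ultimately have "mu a a + mu a ?b = 0" using mu_upper[of a ?b] b ab by simp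
    then have "mu a ?b = -1" using mu_refl[of a] ab by simp
    then show ?thesis using mu_ascending_bottom[of i a b] 2 ab assms by auto
  next
    case 3
    have "\<not> thin b w" using not_thin_fixed_bottom[of i b w] 3 ab assms by blast
    moreover have "act i u \<preceq> b"
      using raise_le[of i u b] 3 assms ab le_trans[of u a b] by auto
    ultimately show ?thesis using thin thin_subinterval u' ab assms le_refl by blast
  next
    case 4
    let ?a = "act i a" and ?b = "act i b"
    have cl: "?a \<in> A" "?b \<in> A" "?b \<preceq> w" "act i u \<preceq> ?a" "?a \<preceq> ?b" "rk ?b - rk ?a = 2"
      using act_closed raise_le[of i b w] raise_raise[of i u a] raise_raise[of i a b]
        act_up[of i a] act_up[of i b] 4 ab assms by auto
    have inv: "act i ?a = a" "act i ?b = b" using act_act ab assms by auto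
    have "a \<preceq> ?b" using le_trans[of a b ?b] act_up[of i b] 4 ab cl assms by blast
    then have "mu a ?b = - mu a b" "mu a ?b = - mu ?a ?b"
      using mu_ascending_bottom[of i a ?b] mu_descending_top[of i a ?b] 4 ab cl inv assms by auto
    then show ?thesis using nz[of ?a ?b] cl by auto
  qed
qed

lemma thin_extend_above:
  assumes "i \<in> I" "u \<in> A" "w \<in> A" "u \<preceq> w" "rk u < rk (act i u)" "rk (act i w) < rk w"
    and "thin u (act i w)"
  shows "thin u w"
proof -
  interpret dual: mobius_involution_poset A "\<lambda>x y. y \<preceq> x" "\<lambda>x. - rk x" I act "\<lambda>x y. mu y x"
    by (rule mobius_order_dual)
  have "dual.thin x y \<longleftrightarrow> thin y x" for x y
    unfolding dual.thin_def thin_def by auto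
  then show ?thesis using dual.thin_extend_below[of i w u] assms by auto
qed

theorem mu_eq:
  assumes desc: "\<And>x y. \<lbrakk>x \<in> A; y \<in> A; x \<preceq> y; x \<noteq> y\<rbrakk> \<Longrightarrow> \<exists>i\<in>I. rk (act i y) < rk y"
    and "u \<in> A" "w \<in> A" "u \<preceq> w"
  shows "mu u w = (if thin u w then (-1) ^ nat (rk w - rk u) else 0)"
  using assms(2-4)
proof (induction "card {z \<in> A. rk z < rk w}" arbitrary: u w rule: less_induct)
  case less
  show ?case
  proof (cases "u = w")
    case True
    have "thin w w"
      unfolding thin_def using less.prems le_antisym le_trans by (metis cancel_comm_monoid_add_class.diff_cancel zero_neq_numeral)
    then show ?thesis using True mu_refl less.prems by simp
  next
    case False
    then obtain i where i: "i \<in> I" "rk (act i w) < rk w" using desc less.prems by blast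
    let ?w = "act i w" and ?u = "act i u"
    have w: "?w \<in> A" "?u \<in> A" "act i ?u = u" "?w \<preceq> w" "rk w = rk ?w + 1"
      using i less.prems act_closed act_down act_act by auto
    have "{z \<in> A. rk z < rk ?w} \<subset> {z \<in> A. rk z < rk w}" using i w by force
    then have card: "card {z \<in> A. rk z < rk ?w} < card {z \<in> A. rk z < rk w}"
      using finite_poset by (intro psubset_card_mono) auto
    consider "?u = u" | "rk u < rk ?u" | "rk ?u < rk u"
      using act_fixed[of i u] i less.prems by linarith
    then show ?thesis
    proof cases
      case 1
      then show ?thesis using mu_fixed_bottom not_thin_fixed_bottom i less.prems by auto
    next
      case 2
      have le: "u \<preceq> ?w" using le_lower[of i u w] 2 i less.prems by auto
      have "thin u w \<longleftrightarrow> thin u ?w"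
        using thin_extend_above[of i u w] thin_subinterval[of u w u ?w] 2 i less.prems w le_refl by blast
      moreover have "nat (rk w - rk u) = Suc (nat (rk ?w - rk u))"
        using w rk_mono[OF _ _ le] less.prems by simp
      moreover have "mu u w = - mu u ?w"
        using mu_ascending_bottom[of i u w] 2 i less.prems by auto
      ultimately show ?thesis using less.hyps[OF card] less.prems w le by auto
    next
      case 3
      have le: "?u \<preceq> ?w" using lower_lower[of i u w] 3 i less.prems by auto
      have u: "?u \<preceq> u" "rk u = rk ?u + 1" using act_down 3 i less.prems by auto
      have uw: "?u \<preceq> w" using le_trans u w less.prems by blast
      have "thin u w \<longleftrightarrow> thin ?u w"
        using thin_extend_below[of i ?u w] thin_subinterval[of ?u w u w] 3 i less.prems w u uw le_refl by auto
      also have "thin ?u w \<longleftrightarrow> thin ?u ?w"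
        using thin_extend_above[of i ?u w] thin_subinterval[of ?u w ?u ?w] 3 i less.prems w uw le_refl by auto
      finally have "thin u w \<longleftrightarrow> thin ?u ?w" .
      have "mu ?u w = - mu u w" "mu ?u w = - mu ?u ?w"
        using mu_descending_top[of i ?u w] mu_ascending_bottom[of i ?u w] 3 i less.prems w uw by (auto split: if_splits)
      then have "mu u w = mu ?u ?w" by simp
      then show ?thesis
        using less.hyps[OF card, of ?u] less.prems w u le \<open>thin u w \<longleftrightarrow> thin ?u ?w\<close> by simp
    qed
  qed
qed

lemma card_length_two_interval:
  assumes "a \<in> A" "b \<in> A" "a \<preceq> b" "rk b - rk a = 2"
  shows "int (card {z \<in> A. a \<preceq> z \<and> z \<preceq> b}) = mu a b + 3"
proof -
  let ?Y = "{z \<in> A. a \<preceq> z \<and> z \<preceq> b}"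
  let ?X = "?Y - {a, b}"
  have fin: "finite ?Y" using finite_poset by simp
  have neq: "a \<noteq> b" using assms by auto
  have sub: "{a, b} \<subseteq> ?Y" using assms le_refl by auto
  have mid: "mu a z = -1" if z: "z \<in> ?X" for z
  proof -
    have rk: "rk z = rk a + 1" using rk_less[of a z] rk_less[of z b] z assms by auto
    have "{y \<in> A. a \<preceq> y \<and> y \<preceq> z} = {a, z}" using interval_length_one[of a z] rk z assms(1) by simp
    then have "mu a a + mu a z = 0" using mu_upper[of a z] z assms by auto
    then show ?thesis using mu_refl assms(1) by simp
  qed
  have "0 = sum (mu a) ?Y" using mu_upper[of a b] neq assms by simp
  also have "\<dots> = sum (mu a) ?X + sum (mu a) {a, b}" using sum.subset_diff[OF sub fin] by blast
  also have "sum (mu a) ?X = - int (card ?X)" using mid by simp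
  finally have "int (card ?X) = 1 + mu a b" using neq mu_refl assms(1) by simp
  moreover have "card ?Y = card ?X + card {a, b}"
    using fin sub by (metis (no_types, lifting) card_Diff_subset card_mono finite.emptyI finite.insertI le_add_diff_inverse2)
  ultimately show ?thesis using neq by simp
qed

end

locale finite_order =
  fixes A :: "'p set" and leq :: "'p \<Rightarrow> 'p \<Rightarrow> bool"
  assumes fin: "finite A"
    and antisym: "\<lbrakk>x \<in> A; y \<in> A; leq x y; leq y x\<rbrakk> \<Longrightarrow> x = y"
    and trans: "\<lbrakk>x \<in> A; y \<in> A; z \<in> A; leq x y; leq y z\<rbrakk> \<Longrightarrow> leq x z"
    and refl: "x \<in> A \<Longrightarrow> leq x x"
begin

lemma mobius_self: "x \<in> A \<Longrightarrow> mobius A leq x x = 1"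
  by (subst mobius_rec[OF fin]) (assumption | erule (3) antisym | erule (4) trans | simp add: refl)+

lemma mobius_less:
  assumes "x \<in> A" "y \<in> A" "leq x y" "x \<noteq> y"
  shows "mobius A leq x y = - (\<Sum>z | z \<in> A \<and> leq x z \<and> leq z y \<and> z \<noteq> y. mobius A leq x z)"
  by (subst mobius_rec[OF fin]) (assumption | erule (3) antisym | erule (4) trans | simp add: assms)+

lemma mobius_sum_upper:
  assumes xy: "x \<in> A" "y \<in> A" "leq x y"
  shows "(\<Sum>z | z \<in> A \<and> leq x z \<and> leq z y. mobius A leq x z) = (if x = y then 1 else 0)"
proof (cases "x = y")
  case True
  then have "{z. z \<in> A \<and> leq x z \<and> leq z y} = {x}" using xy antisym refl by blast
  then show ?thesis using True mobius_self xy by simp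
next
  case False
  let ?X = "{z \<in> A. leq x z \<and> leq z y \<and> z \<noteq> y}"
  have "{z. z \<in> A \<and> leq x z \<and> leq z y} = insert y ?X" using xy refl by auto
  moreover have "finite ?X" "y \<notin> ?X" using fin by auto
  ultimately have "(\<Sum>z | z \<in> A \<and> leq x z \<and> leq z y. mobius A leq x z)
      = mobius A leq x y + (\<Sum>z\<in>?X. mobius A leq x z)" by simp
  also have "mobius A leq x y = - (\<Sum>z\<in>?X. mobius A leq x z)"
    using mobius_less xy False by simp
  finally show ?thesis using False by simp
qed

text \<open>A left inverse of the zeta function is a right inverse: \<open>G\<close> below is \<open>\<zeta>\<mu> - 1\<close>, and
  \<open>(\<zeta>\<mu> - 1)\<zeta> = \<zeta>(\<mu>\<zeta>) - \<zeta> = 0\<close>.\<close>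

lemma mobius_sum_lower:
  assumes xy: "x \<in> A" "y \<in> A" "leq x y"
  shows "(\<Sum>z | z \<in> A \<and> leq x z \<and> leq z y. mobius A leq z y) = (if x = y then 1 else 0)"
proof -
  let ?iv = "\<lambda>x y. {z. z \<in> A \<and> leq x z \<and> leq z y}"
  define G where "G = (\<lambda>y. (\<Sum>z\<in>?iv x y. mobius A leq z y) - (if x = y then 1 else 0))"
  have finiv: "finite (?iv a b)" for a b using fin by simp
  have sumG: "sum G (?iv x y) = 0" if y: "y \<in> A" "leq x y" for y
  proof -
    have "(\<Sum>v\<in>?iv x y. \<Sum>z\<in>?iv x v. mobius A leq z v)
        = (\<Sum>v\<in>?iv x y. \<Sum>z\<in>{z \<in> ?iv x y. leq z v}. mobius A leq z v)"
    proof (rule sum.cong[OF HOL.refl])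
      fix v assume "v \<in> ?iv x y"
      then have "?iv x v = {z \<in> ?iv x y. leq z v}" using trans[of _ v y] y by blast
      then show "(\<Sum>z\<in>?iv x v. mobius A leq z v) = (\<Sum>z\<in>{z \<in> ?iv x y. leq z v}. mobius A leq z v)"
        by (rule arg_cong)
    qed
    also have "\<dots> = (\<Sum>z\<in>?iv x y. \<Sum>v\<in>{v \<in> ?iv x y. leq z v}. mobius A leq z v)"
      by (rule sum.swap_restrict) (rule finiv)+
    also have "\<dots> = (\<Sum>z\<in>?iv x y. \<Sum>v\<in>?iv z y. mobius A leq z v)"
    proof (rule sum.cong[OF HOL.refl])
      fix z assume "z \<in> ?iv x y"
      then have "{v \<in> ?iv x y. leq z v} = ?iv z y" using trans[of x z] xy by blast
      then show "(\<Sum>v\<in>{v \<in> ?iv x y. leq z v}. mobius A leq z v) = (\<Sum>v\<in>?iv z y. mobius A leq z v)"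
        by (rule arg_cong)
    qed
    also have "\<dots> = (\<Sum>z\<in>?iv x y. if z = y then 1 else 0)"
    proof (rule sum.cong[OF HOL.refl])
      fix z assume "z \<in> ?iv x y"
      then show "(\<Sum>v\<in>?iv z y. mobius A leq z v) = (if z = y then 1 else 0)"
        using y by (intro mobius_sum_upper) auto
    qed
    also have "\<dots> = 1" using y refl by (subst sum.delta[OF finiv]) auto
    finally have 1: "(\<Sum>v\<in>?iv x y. \<Sum>z\<in>?iv x v. mobius A leq z v) = 1" .
    have "(\<Sum>v\<in>?iv x y. if x = v then 1 else (0::int)) = 1"
      using y xy refl by (subst sum.delta'[OF finiv]) auto
    then show ?thesis unfolding G_def using 1 by (simp add: sum_subtractf)
  qed
  have "G y = 0" if "y \<in> A" "leq x y" for y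
    using that
  proof (induction "card (?iv x y)" arbitrary: y rule: less_induct)
    case less
    have z: "G z = 0" if z: "z \<in> ?iv x y - {y}" for z
    proof -
      have "y \<notin> ?iv x z" using z antisym less.prems by blast
      moreover have "y \<in> ?iv x y" using less.prems refl by blast
      moreover have "?iv x z \<subseteq> ?iv x y" using z trans[of _ z y] less.prems by blast
      ultimately have "?iv x z \<subset> ?iv x y" by blast
      then show ?thesis using less.hyps[of z] psubset_card_mono[OF finiv] z by blast
    qed
    have "sum G (?iv x y) = G y + sum G (?iv x y - {y})"
      using less.prems refl by (intro sum.remove[OF finiv]) auto
    then show ?case using sumG[OF less.prems] z by simp
  qed
  then show ?thesis using xy unfolding G_def by fastforce
qed

end

theorem (in involution_poset) mobius_eq:
  assumes desc: "\<And>x y. \<lbrakk>x \<in> A; y \<in> A; x \<preceq> y; x \<noteq> y\<rbrakk> \<Longrightarrow> \<exists>i\<in>I. rk (act i y) < rk y"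
    and u: "u \<in> A" and w: "w \<in> A" and uw: "u \<preceq> w"
  shows "mobius A (\<preceq>) u w =
    (if \<forall>a\<in>A. \<forall>b\<in>A. a \<preceq> b \<and> rk b - rk a = 2 \<and>
          {z \<in> A. a \<preceq> z \<and> z \<preceq> b} \<subseteq> {z \<in> A. u \<preceq> z \<and> z \<preceq> w} \<longrightarrow> card {z \<in> A. a \<preceq> z \<and> z \<preceq> b} = 4
     then (-1) ^ nat (rk w - rk u) else 0)"
proof -
  have co: "\<exists>z\<in>A. x \<preceq> z \<and> z \<preceq> y \<and> rk z = rk y - 1" if "x \<in> A" "y \<in> A" "x \<preceq> y" "x \<noteq> y" for x y
    using that
  proof (induction "card {z \<in> A. rk z < rk y}" arbitrary: x y rule: less_induct)
    case less
    then obtain i where i: "i \<in> I" "rk (act i y) < rk y" using desc by blast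
    let ?x = "act i x" and ?y = "act i y"
    have y: "?y \<in> A" "?y \<preceq> y" "rk y = rk ?y + 1" "?x \<in> A" "act i ?y = y"
      using act_closed act_down act_act i less.prems by auto
    show ?case
    proof (cases "x \<preceq> ?y")
      case True
      then show ?thesis using y by (intro bexI[of _ ?y]) auto
    next
      case False
      then have x: "rk ?x < rk x" using le_lower[of i x y] i less.prems by linarith
      have le: "?x \<preceq> ?y" using lower_lower x i less.prems by blast
      have "{z \<in> A. rk z < rk ?y} \<subset> {z \<in> A. rk z < rk y}" using i y by force
      then have card: "card {z \<in> A. rk z < rk ?y} < card {z \<in> A. rk z < rk y}"
        using finite_poset by (intro psubset_card_mono) auto
      have "?x \<noteq> ?y" using act_act i less.prems by metis
      then obtain c where c: "c \<in> A" "?x \<preceq> c" "c \<preceq> ?y" "rk c = rk ?y - 1"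
        using less.hyps[OF card] y le by blast
      have up: "rk ?x < rk (act i ?x)" using x act_act i less.prems by simp
      have "rk c < rk (act i c)"
      proof (rule ccontr)
        assume "\<not> rk c < rk (act i c)"
        then have "act i ?x \<preceq> c" using raise_le[of i ?x c] up c y i by auto
        then have "x \<preceq> c" using act_act i less.prems by simp
      then show False using le_trans c y less.prems False by blast
      qed
      then have "act i ?x \<preceq> act i c" "act i c \<preceq> y" "rk (act i c) = rk c + 1"
        using raise_raise[of i ?x c] up raise_le[of i c y] act_up[of i c] le_trans[of c ?y y] c y i less.prems
        by auto
      then show ?thesis
        using c y act_closed act_act i less.prems by (intro bexI[of _ "act i c"]) auto
    qed
  qed
  have at: "\<exists>z\<in>A. x \<preceq> z \<and> z \<preceq> y \<and> rk z = rk x + 1" if xy: "x \<in> A" "y \<in> A" "x \<preceq> y" "x \<noteq> y" for x y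
  proof -
    let ?D = "{z \<in> A. x \<preceq> z \<and> z \<preceq> y \<and> z \<noteq> x}"
    have "finite ?D" "?D \<noteq> {}" using finite_poset xy le_refl by auto
    then obtain z where z: "z \<in> ?D" and min: "\<And>v. v \<in> ?D \<Longrightarrow> rk z \<le> rk v"
      using obtain_min_rank[of ?D rk] by blast
    obtain c where c: "c \<in> A" "x \<preceq> c" "c \<preceq> z" "rk c = rk z - 1" using co[of x z] z xy by auto
    have "c \<preceq> y" using le_trans c z xy by blast
    then have "c = x" using min[of c] c by auto
    then show ?thesis using z c by auto
  qed
  interpret order: finite_order A "(\<preceq>)"
    by unfold_locales
      (assumption | rule finite_poset le_refl | erule (3) le_antisym | erule (4) le_trans)+
  interpret mobius_involution_poset A "(\<preceq>)" rk I act "mobius A (\<preceq>)"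
  proof
    fix x assume "x \<in> A"
    then show "mobius A (\<preceq>) x x = 1" by (rule order.mobius_self)
next
    fix x y assume "x \<in> A" "y \<in> A" "x \<preceq> y" "x \<noteq> y"
    then show "(\<Sum>z | z \<in> A \<and> x \<preceq> z \<and> z \<preceq> y. mobius A (\<preceq>) x z) = 0"
      and "(\<Sum>z | z \<in> A \<and> x \<preceq> z \<and> z \<preceq> y. mobius A (\<preceq>) z y) = 0"
      using order.mobius_sum_upper[of x y] order.mobius_sum_lower[of x y] by simp_all
  qed (use co at in blast)+
  have two: "mobius A (\<preceq>) a b \<noteq> 0 \<longleftrightarrow> card {z \<in> A. a \<preceq> z \<and> z \<preceq> b} = 4"
    if "a \<in> A" "b \<in> A" "a \<preceq> b" "rk b - rk a = 2" for a b
    using card_length_two_interval[OF that] mu_eq[OF desc that(1-3)] that(4) by (auto split: if_splits)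
  have sub: "{z \<in> A. a \<preceq> z \<and> z \<preceq> b} \<subseteq> {z \<in> A. u \<preceq> z \<and> z \<preceq> w} \<longleftrightarrow> u \<preceq> a \<and> b \<preceq> w"
    if "a \<in> A" "b \<in> A" "a \<preceq> b" for a b
  proof
    assume "{z \<in> A. a \<preceq> z \<and> z \<preceq> b} \<subseteq> {z \<in> A. u \<preceq> z \<and> z \<preceq> w}"
    then show "u \<preceq> a \<and> b \<preceq> w" using that le_refl by blast
  next
    assume "u \<preceq> a \<and> b \<preceq> w"
    then show "{z \<in> A. a \<preceq> z \<and> z \<preceq> b} \<subseteq> {z \<in> A. u \<preceq> z \<and> z \<preceq> w}"
      using that le_trans[of u a] le_trans[of _ b w] u w by blast
  qed
  have "thin u w \<longleftrightarrow> (\<forall>a\<in>A. \<forall>b\<in>A. a \<preceq> b \<and> rk b - rk a = 2 \<and>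
          {z \<in> A. a \<preceq> z \<and> z \<preceq> b} \<subseteq> {z \<in> A. u \<preceq> z \<and> z \<preceq> w} \<longrightarrow> card {z \<in> A. a \<preceq> z \<and> z \<preceq> b} = 4)"
    unfolding thin_def
  proof (intro ball_cong HOL.refl)
    fix a b assume "a \<in> A" "b \<in> A"
    then show "(u \<preceq> a \<and> a \<preceq> b \<and> b \<preceq> w \<and> rk b - rk a = 2 \<longrightarrow> mobius A (\<preceq>) a b \<noteq> 0) \<longleftrightarrow>
      (a \<preceq> b \<and> rk b - rk a = 2 \<and> {z \<in> A. a \<preceq> z \<and> z \<preceq> b} \<subseteq> {z \<in> A. u \<preceq> z \<and> z \<preceq> w} \<longrightarrow>
       card {z \<in> A. a \<preceq> z \<and> z \<preceq> b} = 4)"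
      using two[of a b] sub[of a b] by (metis (no_types, lifting))
  qed
  then show ?thesis using mu_eq[OF desc u w uw] by simp
qed

section \<open>Groups with the exchange condition\<close>

locale involution_generated_group = group W for W (structure) and S :: "'a set" +
  assumes S_carrier: "S \<subseteq> carrier W"
    and S_generate: "generate W S = carrier W"
    and S_square: "s \<in> S \<Longrightarrow> s \<otimes> s = \<one>"
begin

abbreviation l :: "'a \<Rightarrow> nat" where "l \<equiv> word_length W S"

abbreviation wprod :: "'a list \<Rightarrow> 'a" where "wprod ws \<equiv> foldr (\<otimes>) ws \<one>"

lemma S_closed [simp, intro]: "s \<in> S \<Longrightarrow> s \<in> carrier W"
  using S_carrier by blast

lemma S_inv [simp]: "s \<in> S \<Longrightarrow> inv s = s"
  using S_square by (simp add: inv_equality)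

lemma S_cancel_left [simp]: "\<lbrakk>s \<in> S; w \<in> carrier W\<rbrakk> \<Longrightarrow> s \<otimes> (s \<otimes> w) = w"
  by (simp add: S_square flip: m_assoc)

lemma S_cancel_right [simp]: "\<lbrakk>s \<in> S; w \<in> carrier W\<rbrakk> \<Longrightarrow> w \<otimes> s \<otimes> s = w"
  by (simp add: S_square m_assoc)

lemma inv_cancel_left [simp]: "\<lbrakk>x \<in> carrier W; y \<in> carrier W\<rbrakk> \<Longrightarrow> inv x \<otimes> (x \<otimes> y) = y"
  by (simp flip: m_assoc)

lemma inv_cancel_left' [simp]: "\<lbrakk>x \<in> carrier W; y \<in> carrier W\<rbrakk> \<Longrightarrow> x \<otimes> (inv x \<otimes> y) = y"
  by (simp flip: m_assoc)

lemma wprod_closed [simp]: "set ws \<subseteq> S \<Longrightarrow> wprod ws \<in> carrier W"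
  by (induction ws) auto

lemma wprod_append: "\<lbrakk>set us \<subseteq> S; set ws \<subseteq> S\<rbrakk> \<Longrightarrow> wprod (us @ ws) = wprod us \<otimes> wprod ws"
proof (induction us)
  case Nil
  then show ?case using wprod_closed[of ws] by simp
next
  case (Cons a us)
  then show ?case by (simp add: m_assoc)
qed

lemma wprod_rev: "set ws \<subseteq> S \<Longrightarrow> wprod (rev ws) = inv (wprod ws)"
proof (induction ws)
  case (Cons a ws)
  then have "wprod (rev (a # ws)) = inv (wprod ws) \<otimes> a"
    using wprod_append[of "rev ws" "[a]"] by simp
  then show ?case using Cons.prems by (simp add: inv_mult_group)
qed simp

lemma generate_word:
  assumes "J \<subseteq> S" "w \<in> generate W J"
  shows "\<exists>ws. set ws \<subseteq> J \<and> wprod ws = w"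
  using assms(2)
proof induction
  case one
  have "set [] \<subseteq> J \<and> wprod [] = \<one>" by simp
  then show ?case by blast
next
  case (incl h)
  then have "set [h] \<subseteq> J \<and> wprod [h] = h" using assms(1) by auto
  then show ?case by blast
next
  case (inv h)
  then have "h \<in> S" using assms(1) by blast
  then have "set [h] \<subseteq> J \<and> wprod [h] = inv h" using inv by auto
  then show ?case by blast
next
  case (eng g h)
  then obtain us ws where "set us \<subseteq> J" "wprod us = g" "set ws \<subseteq> J" "wprod ws = h" by blast
  then have "set (us @ ws) \<subseteq> J \<and> wprod (us @ ws) = g \<otimes> h"
    using assms(1) wprod_append[of us ws] by auto
  then show ?case by blast
qed

lemma reduced_word:
  assumes "w \<in> carrier W"
  obtains ws where "set ws \<subseteq> S" "wprod ws = w" "length ws = l w"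
proof -
  have "\<exists>n ws. length ws = n \<and> set ws \<subseteq> S \<and> wprod ws = w"
    using generate_word[of S w] S_generate assms by auto
  then have "\<exists>ws. length ws = l w \<and> set ws \<subseteq> S \<and> wprod ws = w"
    unfolding word_length_def by (rule LeastI_ex)
  then show thesis using that by blast
qed

lemma length_le: "set ws \<subseteq> S \<Longrightarrow> l (wprod ws) \<le> length ws"
  unfolding word_length_def by (rule Least_le) blast

lemma length_one [simp]: "l \<one> = 0"
  using length_le[of "[]"] by simp

lemma length_eq_0: "w \<in> carrier W \<Longrightarrow> l w = 0 \<longleftrightarrow> w = \<one>"
  using reduced_word[of w] by force

lemma length_mult:
  assumes "v \<in> carrier W" "w \<in> carrier W"
  shows "l (v \<otimes> w) \<le> l v + l w"
proof -
  obtain us ws where "set us \<subseteq> S" "wprod us = v" "length us = l v"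
    and "set ws \<subseteq> S" "wprod ws = w" "length ws = l w"
    using reduced_word assms by metis
  then show ?thesis using length_le[of "us @ ws"] wprod_append[of us ws] by simp
qed

lemma length_inv_le: "w \<in> carrier W \<Longrightarrow> l (inv w) \<le> l w"
  using reduced_word[of w] length_le[of "rev _"] wprod_rev by (metis length_rev set_rev)

lemma length_inv [simp]: "w \<in> carrier W \<Longrightarrow> l (inv w) = l w"
  using length_inv_le[of w] length_inv_le[of "inv w"] by simp

lemma length_S_le: "s \<in> S \<Longrightarrow> l s \<le> 1"
  using length_le[of "[s]"] by simp

lemma length_S_mult_le: "\<lbrakk>s \<in> S; w \<in> carrier W\<rbrakk> \<Longrightarrow> l (s \<otimes> w) \<le> l w + 1"
  using length_mult[of s w] length_S_le[of s] by simp

lemma length_mult_S_le: "\<lbrakk>s \<in> S; w \<in> carrier W\<rbrakk> \<Longrightarrow> l (w \<otimes> s) \<le> l w + 1"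
  using length_mult[of w s] length_S_le[of s] by simp

lemma left_descent:
  assumes "w \<in> carrier W" "w \<noteq> \<one>"
  obtains s where "s \<in> S" "l (s \<otimes> w) < l w"
proof -
  obtain ws where ws: "set ws \<subseteq> S" "wprod ws = w" "length ws = l w"
    using reduced_word assms by metis
  then obtain s us where us: "ws = s # us" using assms(2) by (cases ws) auto
  then have "s \<otimes> w = wprod us" using ws by auto
  then have "l (s \<otimes> w) < l w" using length_le[of us] us ws by auto
  then show thesis using that us ws by auto
qed

lemma right_descent:
  assumes "w \<in> carrier W" "w \<noteq> \<one>"
  obtains s where "s \<in> S" "l (w \<otimes> s) < l w"
proof -
  obtain s where "s \<in> S" "l (s \<otimes> inv w) < l (inv w)"
    using left_descent[of "inv w"] assms by auto
  then show thesis using that[of s] length_inv[of "w \<otimes> s"] assms by (simp add: inv_mult_group)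
qed

end

text \<open>By a theorem of Matsumoto, these are exactly the Coxeter systems.\<close>

locale exchange_group = involution_generated_group +
  assumes length_neq: "\<lbrakk>s \<in> S; w \<in> carrier W\<rbrakk> \<Longrightarrow> l (s \<otimes> w) \<noteq> l w"
    and exchange: "\<lbrakk>s \<in> S; r \<in> S; w \<in> carrier W; l w < l (s \<otimes> w);
        l (s \<otimes> w \<otimes> r) < l (w \<otimes> r)\<rbrakk> \<Longrightarrow> s \<otimes> w = w \<otimes> r"
begin

abbreviation le :: "'a \<Rightarrow> 'a \<Rightarrow> bool" (infix "\<preceq>" 50) where "le \<equiv> bruhat_le W S"

lemma length_S: "s \<in> S \<Longrightarrow> l s = 1"
  using length_le[of "[s]"] length_neq[of s \<one>] by simp

lemma length_S_mult: "\<lbrakk>s \<in> S; w \<in> carrier W\<rbrakk> \<Longrightarrow> l (s \<otimes> w) = l w + 1 \<or> l w = l (s \<otimes> w) + 1"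
  using length_S_mult_le[of s w] length_S_mult_le[of s "s \<otimes> w"] length_neq[of s w] by fastforce

lemma length_mult_S: "\<lbrakk>s \<in> S; w \<in> carrier W\<rbrakk> \<Longrightarrow> l (w \<otimes> s) = l w + 1 \<or> l w = l (w \<otimes> s) + 1"
  using length_S_mult[of s "inv w"] length_inv[of "w \<otimes> s"] by (simp add: inv_mult_group)

lemma left_induct [consumes 1, case_names one mult]:
  assumes "w \<in> carrier W" "P \<one>"
    and step: "\<And>s w. \<lbrakk>s \<in> S; w \<in> carrier W; l w < l (s \<otimes> w); P w\<rbrakk> \<Longrightarrow> P (s \<otimes> w)"
  shows "P w"
  using assms(1)
proof (induction "l w" arbitrary: w rule: less_induct)
  case less
  show ?case
  proof (cases "w = \<one>")
    case False
    then obtain s where s: "s \<in> S" "l (s \<otimes> w) < l w" using left_descent less.prems by blast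
    then have "P (s \<otimes> w)" using less by simp
    then have "P (s \<otimes> (s \<otimes> w))" using s less.prems step[of s "s \<otimes> w"] by simp
    then show ?thesis using s less.prems by simp
  qed (use assms in simp)
qed

text \<open>\<open>separates v s w\<close>: the wall of the reflection \<open>t = v s v\<^sup>-\<^sup>1\<close> separates \<open>1\<close> from \<open>w\<close>.
  A gallery from \<open>1\<close> to \<open>w\<close> that crosses the wall can be folded along it, and so \<open>t w\<close> is
  shorter than \<open>w\<close>.\<close>

definition separates :: "'a \<Rightarrow> 'a \<Rightarrow> 'a \<Rightarrow> bool" where
  "separates v s w \<longleftrightarrow> (l (inv v) < l (s \<otimes> inv v)) \<noteq> (l (inv v \<otimes> w) < l (s \<otimes> inv v \<otimes> w))"

lemma exchange_iff:
  assumes "s \<in> S" "r \<in> S" "w \<in> carrier W"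
    and "(l w < l (s \<otimes> w)) \<noteq> (l (w \<otimes> r) < l (s \<otimes> (w \<otimes> r)))"
  shows "s \<otimes> w = w \<otimes> r"
proof (cases "l w < l (s \<otimes> w)")
  case True
  then have "l (s \<otimes> w \<otimes> r) < l (w \<otimes> r)"
    using assms length_neq[of s "w \<otimes> r"] by (simp add: m_assoc)
  then show ?thesis using exchange True assms by blast
next
  case False
  then have "l (w \<otimes> r) < l (s \<otimes> (w \<otimes> r))" "l (s \<otimes> w) < l w"
    using assms length_neq[of s w] by auto
  then have "s \<otimes> (w \<otimes> r) = w \<otimes> r \<otimes> r"
    using exchange[of s r "w \<otimes> r"] assms by (simp add: m_assoc S_square)
  then have "s \<otimes> w \<otimes> r \<otimes> r = w \<otimes> r" using assms by (simp add: m_assoc S_square)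
  then show ?thesis using assms by simp
qed

lemma separates_shorter_word:
  assumes v: "v \<in> carrier W" "s \<in> S"
  shows "\<lbrakk>set ws \<subseteq> S; separates v s (wprod ws)\<rbrakk> \<Longrightarrow>
    \<exists>us. set us \<subseteq> S \<and> length us < length ws \<and> wprod us = v \<otimes> s \<otimes> inv v \<otimes> wprod ws"
proof (induction ws rule: rev_induct)
  case Nil
  then show ?case using v by (simp add: separates_def)
next
  case (snoc r ws)
  let ?p = "wprod ws"
  have p: "?p \<in> carrier W" "r \<in> S" "set ws \<subseteq> S" using snoc.prems by auto
  have pr: "wprod (ws @ [r]) = ?p \<otimes> r" using wprod_append[of ws "[r]"] p by simp
  show ?case
  proof (cases "separates v s ?p")
    case True
    then obtain us where us: "set us \<subseteq> S" "length us < length ws"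
      "wprod us = v \<otimes> s \<otimes> inv v \<otimes> ?p" using snoc p by blast
    then have "wprod (us @ [r]) = v \<otimes> s \<otimes> inv v \<otimes> wprod (ws @ [r])"
      using wprod_append[of us "[r]"] p v pr by (simp add: m_assoc)
    then show ?thesis using us p by (intro exI[of _ "us @ [r]"]) auto
  next
    case False
    let ?g = "inv v \<otimes> ?p"
    have "(l ?g < l (s \<otimes> ?g)) \<noteq> (l (?g \<otimes> r) < l (s \<otimes> (?g \<otimes> r)))"
      using False snoc.prems(2) p v unfolding separates_def pr by (auto simp: m_assoc)
    then have "s \<otimes> ?g = ?g \<otimes> r" using exchange_iff p v by auto
    then have "v \<otimes> (s \<otimes> ?g) \<otimes> r = v \<otimes> (?g \<otimes> r) \<otimes> r" by simp
    then have "wprod ws = v \<otimes> s \<otimes> inv v \<otimes> wprod (ws @ [r])"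
      using p v unfolding pr by (simp add: m_assoc S_square)
    then show ?thesis using p by (intro exI[of _ ws]) auto
  qed
qed

lemma separates_imp_less:
  assumes "v \<in> carrier W" "s \<in> S" "w \<in> carrier W" "separates v s w"
  shows "l (v \<otimes> s \<otimes> inv v \<otimes> w) < l w"
proof -
  obtain ws where ws: "set ws \<subseteq> S" "wprod ws = w" "length ws = l w"
    using reduced_word assms by metis
  then obtain us where "set us \<subseteq> S" "length us < length ws" "wprod us = v \<otimes> s \<otimes> inv v \<otimes> w"
    using separates_shorter_word[of v s ws] assms by auto
  then show ?thesis using length_le[of us] ws by simp
qed

lemma separates_iff:
  assumes v: "v \<in> carrier W" "s \<in> S" "w \<in> carrier W"
  shows "separates v s w \<longleftrightarrow> l (v \<otimes> s \<otimes> inv v \<otimes> w) < l w"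
proof
  let ?t = "v \<otimes> s \<otimes> inv v"
  assume less: "l (?t \<otimes> w) < l w"
  show "separates v s w"
  proof (rule ccontr)
    assume "\<not> separates v s w"
    then have "separates v s (?t \<otimes> w)"
      using v length_neq[of s "inv v \<otimes> w"] unfolding separates_def by (auto simp: m_assoc)
    then have "l (?t \<otimes> (?t \<otimes> w)) < l (?t \<otimes> w)" using v by (intro separates_imp_less) auto
    then show False using less v by (simp add: m_assoc)
  qed
qed (use assms separates_imp_less in blast)

lemma reflection_length_neq:
  assumes v: "v \<in> carrier W" "s \<in> S" "w \<in> carrier W"
  shows "l (v \<otimes> s \<otimes> inv v \<otimes> w) \<noteq> l w"
proof
  let ?t = "v \<otimes> s \<otimes> inv v"
  assume eq: "l (?t \<otimes> w) = l w"
  then have "\<not> separates v s w" using separates_iff v by simp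
  then have "separates v s (?t \<otimes> w)"
    using v length_neq[of s "inv v \<otimes> w"] unfolding separates_def by (auto simp: m_assoc)
  then have "l (?t \<otimes> (?t \<otimes> w)) < l (?t \<otimes> w)" using v by (intro separates_imp_less) auto
  then show False using eq v by (simp add: m_assoc)
qed

lemma simple_reflection_of_crossing:
  assumes v: "v \<in> carrier W" "r \<in> S" "s \<in> S" "u \<in> carrier W"
    and up: "l u < l (v \<otimes> r \<otimes> inv v \<otimes> u)"
    and down: "l (s \<otimes> (v \<otimes> r \<otimes> inv v \<otimes> u)) < l (s \<otimes> u)"
  shows "v \<otimes> r \<otimes> inv v = s"
proof -
  have 1: "\<not> separates v r u" using separates_iff[of v r u] v up by simp
  have "s \<otimes> v \<otimes> r \<otimes> inv (s \<otimes> v) \<otimes> (s \<otimes> u) = s \<otimes> (v \<otimes> r \<otimes> inv v \<otimes> u)"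
    using v by (simp add: m_assoc inv_mult_group)
  then have 2: "separates (s \<otimes> v) r (s \<otimes> u)" using separates_iff[of "s \<otimes> v" r "s \<otimes> u"] v down by simp
  have "(l (inv v) < l (r \<otimes> inv v)) \<noteq> (l (inv v \<otimes> s) < l (r \<otimes> (inv v \<otimes> s)))"
    using 1 2 v unfolding separates_def by (auto simp: inv_mult_group m_assoc)
  then have "r \<otimes> inv v = inv v \<otimes> s" using exchange_iff v by simp
  then have "v \<otimes> (r \<otimes> inv v) = v \<otimes> (inv v \<otimes> s)" by simp
  then show ?thesis using v by (simp add: m_assoc)
qed

definition bruhat_step :: "('a \<times> 'a) set" where
  "bruhat_step = {(x, x \<otimes> t) | x t. x \<in> carrier W \<and> t \<in> reflections W S \<and> l x < l (x \<otimes> t)}"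

lemma le_iff_rtrancl: "u \<preceq> v \<longleftrightarrow> (u, v) \<in> bruhat_step\<^sup>*"
  unfolding bruhat_le_def bruhat_step_def by (rule refl)

lemma bruhat_stepI:
  assumes "u \<in> carrier W" "v \<in> carrier W" "s \<in> S" "l u < l (v \<otimes> s \<otimes> inv v \<otimes> u)"
  shows "(u, v \<otimes> s \<otimes> inv v \<otimes> u) \<in> bruhat_step"
proof -
  let ?t = "(inv u \<otimes> v) \<otimes> s \<otimes> inv (inv u \<otimes> v)"
  have eq: "u \<otimes> ?t = v \<otimes> s \<otimes> inv v \<otimes> u" using assms by (simp add: inv_mult_group m_assoc)
  have "?t \<in> reflections W S" unfolding reflections_def using assms by blast
  then show ?thesis unfolding bruhat_step_def using eq assms by force
qed

lemma bruhat_stepE: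
  assumes "(u, u') \<in> bruhat_step"
  obtains v s where "u \<in> carrier W" "v \<in> carrier W" "s \<in> S"
    "u' = v \<otimes> s \<otimes> inv v \<otimes> u" "l u < l u'"
proof -
  obtain v s where vs: "u \<in> carrier W" "v \<in> carrier W" "s \<in> S" "u' = u \<otimes> (v \<otimes> s \<otimes> inv v)" "l u < l u'"
    using assms unfolding bruhat_step_def reflections_def by auto
  have "u' = (u \<otimes> v) \<otimes> s \<otimes> inv (u \<otimes> v) \<otimes> u" using vs by (simp add: inv_mult_group m_assoc)
  then show thesis using that[of "u \<otimes> v" s] vs by blast
qed

lemma le_refl [simp]: "u \<preceq> u" unfolding le_iff_rtrancl by simp

lemma le_trans [trans]: "\<lbrakk>u \<preceq> v; v \<preceq> w\<rbrakk> \<Longrightarrow> u \<preceq> w"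
  unfolding le_iff_rtrancl by (rule rtrancl_trans)

lemma le_length_cases: "u \<preceq> v \<Longrightarrow> u = v \<or> l u < l v"
  unfolding le_iff_rtrancl
  by (induction rule: rtrancl_induct) (auto elim!: bruhat_stepE)

lemma le_length: "u \<preceq> v \<Longrightarrow> l u \<le> l v"
  using le_length_cases by fastforce

lemma le_length_eq: "\<lbrakk>u \<preceq> v; l v \<le> l u\<rbrakk> \<Longrightarrow> u = v"
  using le_length_cases by fastforce

lemma le_antisym: "\<lbrakk>u \<preceq> v; v \<preceq> u\<rbrakk> \<Longrightarrow> u = v"
  using le_length_eq le_length by blast

lemma le_closed: "\<lbrakk>u \<preceq> v; v \<in> carrier W\<rbrakk> \<Longrightarrow> u \<in> carrier W"
  unfolding le_iff_rtrancl by (induction rule: converse_rtrancl_induct) (auto elim: bruhat_stepE)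

lemma bruhat_step_inv:
  assumes "(u, v) \<in> bruhat_step"
  shows "(inv u, inv v) \<in> bruhat_step"
proof -
  obtain x s where x: "u \<in> carrier W" "x \<in> carrier W" "s \<in> S"
    "v = x \<otimes> s \<otimes> inv x \<otimes> u" "l u < l v" using bruhat_stepE assms by metis
  let ?y = "inv u \<otimes> x"
  have eq: "inv v = ?y \<otimes> s \<otimes> inv ?y \<otimes> inv u" using x by (simp add: inv_mult_group m_assoc)
  have "l (inv u) < l (?y \<otimes> s \<otimes> inv ?y \<otimes> inv u)"
    unfolding eq[symmetric] using x by (metis inv_closed length_inv m_closed S_closed)
  then show ?thesis using bruhat_stepI[of "inv u" ?y s] x unfolding eq by simp
qed

lemma le_inv: "u \<preceq> v \<Longrightarrow> inv u \<preceq> inv v"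
  unfolding le_iff_rtrancl
  by (induction rule: rtrancl_induct) (auto intro: rtrancl_into_rtrancl bruhat_step_inv)

lemma le_S_mult: "\<lbrakk>s \<in> S; w \<in> carrier W; l w < l (s \<otimes> w)\<rbrakk> \<Longrightarrow> w \<preceq> s \<otimes> w"
  using bruhat_stepI[of w \<one> s] unfolding le_iff_rtrancl by auto

lemma bruhat_step_mult:
  assumes "(u, u') \<in> bruhat_step" "s \<in> S"
  shows "s \<otimes> u = u' \<or> s \<otimes> u \<preceq> s \<otimes> u'"
proof -
  obtain v r where v: "u \<in> carrier W" "v \<in> carrier W" "r \<in> S"
    "u' = v \<otimes> r \<otimes> inv v \<otimes> u" "l u < l u'" using bruhat_stepE assms by metis
  have conj: "s \<otimes> u' = (s \<otimes> v) \<otimes> r \<otimes> inv (s \<otimes> v) \<otimes> (s \<otimes> u)"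
    using v assms by (simp add: inv_mult_group m_assoc)
  show ?thesis
  proof (cases "l (s \<otimes> u) < l (s \<otimes> u')")
    case True
    then show ?thesis
      using bruhat_stepI[of "s \<otimes> u" "s \<otimes> v" r] v assms conj unfolding le_iff_rtrancl by auto
  next
    case False
    then have "l (s \<otimes> u') < l (s \<otimes> u)"
      using reflection_length_neq[of "s \<otimes> v" r "s \<otimes> u"] v assms conj by simp
    then show ?thesis using simple_reflection_of_crossing[of v r s u] v assms by simp
  qed
qed

lemma lift_up:
  assumes "u \<preceq> v" "s \<in> S" "u \<in> carrier W"
  shows "s \<otimes> u \<preceq> v \<or> s \<otimes> u \<preceq> s \<otimes> v"
  using assms(1) unfolding le_iff_rtrancl
proof (induction rule: rtrancl_induct)
  case (step v v')
  have "v \<preceq> v'" using step.hyps le_iff_rtrancl by auto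
  then show ?case
    using step.IH bruhat_step_mult[OF step.hyps(2) assms(2)] le_trans unfolding le_iff_rtrancl[symmetric]
    by metis
qed simp

lemma lift_down:
  assumes "u \<preceq> v" "s \<in> S" "v \<in> carrier W"
  shows "u \<preceq> s \<otimes> v \<or> s \<otimes> u \<preceq> s \<otimes> v"
  using assms(1) unfolding le_iff_rtrancl
proof (induction rule: converse_rtrancl_induct)
  case (step u u')
  have uu: "u \<preceq> u'" using step.hyps le_iff_rtrancl by auto
  have u: "u \<in> carrier W" using step.hyps(1) by (auto elim: bruhat_stepE)
  have "s \<otimes> u' = u" if "s \<otimes> u = u'" using that u assms(2) by force
  then show ?case
    using step.IH bruhat_step_mult[OF step.hyps(1) assms(2)] le_trans uu unfolding le_iff_rtrancl[symmetric]
    by metis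
qed simp

definition lmax :: "'a \<Rightarrow> 'a \<Rightarrow> 'a" where "lmax s w = (if l w < l (s \<otimes> w) then s \<otimes> w else w)"
definition lmin :: "'a \<Rightarrow> 'a \<Rightarrow> 'a" where "lmin s w = (if l w < l (s \<otimes> w) then w else s \<otimes> w)"
definition rmax :: "'a \<Rightarrow> 'a \<Rightarrow> 'a" where "rmax w s = (if l w < l (w \<otimes> s) then w \<otimes> s else w)"
definition rmin :: "'a \<Rightarrow> 'a \<Rightarrow> 'a" where "rmin w s = (if l w < l (w \<otimes> s) then w else w \<otimes> s)"

lemma lmax_lmin_bounds:
  assumes "s \<in> S" "w \<in> carrier W"
  shows "w \<preceq> lmax s w" "s \<otimes> w \<preceq> lmax s w" "lmin s w \<preceq> w" "lmin s w \<preceq> s \<otimes> w"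
    "lmax s w \<in> carrier W" "lmin s w \<in> carrier W"
  using assms le_S_mult[of s w] le_S_mult[of s "s \<otimes> w"] length_neq[of s w]
  unfolding lmax_def lmin_def by auto

lemma lmax_cases: "lmax s w = w \<or> lmax s w = s \<otimes> w" and lmin_cases: "lmin s w = w \<or> lmin s w = s \<otimes> w"
  by (auto simp: lmax_def lmin_def)

lemma lmax_mono:
  assumes "u \<preceq> v" "s \<in> S" "v \<in> carrier W"
  shows "lmax s u \<preceq> lmax s v"
  using lift_up[of u v s] lmax_lmin_bounds(1,2)[of s v] lmax_cases[of s u] le_closed[of u v] assms le_trans
  by metis

lemma lmin_mono:
  assumes "u \<preceq> v" "s \<in> S" "v \<in> carrier W"
  shows "lmin s u \<preceq> lmin s v"
  using lift_down[of u v s] lmax_lmin_bounds(3,4)[of s u] lmin_cases[of s v] le_closed[of u v] assms le_trans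
  by metis

lemma rmax_inv: "\<lbrakk>s \<in> S; w \<in> carrier W\<rbrakk> \<Longrightarrow> rmax w s = inv (lmax s (inv w))"
  and rmin_inv: "\<lbrakk>s \<in> S; w \<in> carrier W\<rbrakk> \<Longrightarrow> rmin w s = inv (lmin s (inv w))"
  using length_inv[of "w \<otimes> s"] by (auto simp: rmax_def rmin_def lmax_def lmin_def inv_mult_group)

lemma rmax_rmin_bounds:
  assumes "s \<in> S" "w \<in> carrier W"
  shows "w \<preceq> rmax w s" "w \<otimes> s \<preceq> rmax w s" "rmin w s \<preceq> w" "rmin w s \<preceq> w \<otimes> s"
    "rmax w s \<in> carrier W" "rmin w s \<in> carrier W"
  using lmax_lmin_bounds(1-4)[of s "inv w", THEN le_inv] lmax_lmin_bounds(5,6)[of s "inv w"] assms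
  by (auto simp: rmax_inv rmin_inv inv_mult_group)

lemma rmax_cases: "rmax w s = w \<or> rmax w s = w \<otimes> s" and rmin_cases: "rmin w s = w \<or> rmin w s = w \<otimes> s"
  by (auto simp: rmax_def rmin_def)

lemma rmax_mono:
  assumes "u \<preceq> v" "s \<in> S" "v \<in> carrier W"
  shows "rmax u s \<preceq> rmax v s"
  using lmax_mono[OF le_inv[OF assms(1)] assms(2), THEN le_inv] assms le_closed[of u v]
  by (simp add: rmax_inv)

lemma rmin_mono:
  assumes "u \<preceq> v" "s \<in> S" "v \<in> carrier W"
  shows "rmin u s \<preceq> rmin v s"
  using lmin_mono[OF le_inv[OF assms(1)] assms(2), THEN le_inv] assms le_closed[of u v]
  by (simp add: rmin_inv)

end

section \<open>Parabolic quotients and the order on pairs\<close>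

context exchange_group
begin

lemma right_mult_le:
  assumes "a \<preceq> b" "b \<in> carrier W" "w \<in> carrier W"
  shows "\<exists>w'. w' \<preceq> w \<and> a \<otimes> w \<preceq> b \<otimes> w'"
  using assms(3)
proof (induction "l w" arbitrary: w rule: less_induct)
  case less
  show ?case
  proof (cases "w = \<one>")
    case True
    then show ?thesis using assms le_closed by (intro exI[of _ \<one>]) auto
  next
    case False
    then obtain s where s: "s \<in> S" "l (w \<otimes> s) < l w" using right_descent less.prems by blast
    let ?v = "w \<otimes> s"
    obtain v' where v': "v' \<preceq> ?v" "a \<otimes> ?v \<preceq> b \<otimes> v'" using less s by blast
    have cl: "v' \<in> carrier W" "a \<in> carrier W" "?v \<in> carrier W" using v' le_closed assms s less.prems by auto
    have "a \<otimes> ?v \<otimes> s \<preceq> rmax (a \<otimes> ?v) s" using rmax_rmin_bounds cl s by simp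
    also have "rmax (a \<otimes> ?v) s \<preceq> rmax (b \<otimes> v') s" using rmax_mono v' s cl assms by simp
    finally have 1: "a \<otimes> w \<preceq> rmax (b \<otimes> v') s" using cl s less.prems by (simp add: m_assoc S_square)
    have "rmax v' s \<preceq> rmax ?v s" using rmax_mono v' s cl by simp
    also have "rmax ?v s = w" using s less.prems by (simp add: rmax_def)
    finally have "v' \<preceq> w" "v' \<otimes> s \<preceq> w" using rmax_rmin_bounds[of s v'] s cl le_trans by blast+
    then show ?thesis
      using 1 rmax_cases[of "b \<otimes> v'" s] cl s assms by (auto simp: m_assoc)
  qed
qed

definition min_reps :: "'a set \<Rightarrow> 'a set" where
  "min_reps J = {x \<in> carrier W. \<forall>j\<in>J. l x < l (x \<otimes> j)}"

lemma min_reps_closed [simp]: "x \<in> min_reps J \<Longrightarrow> x \<in> carrier W"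
  unfolding min_reps_def by simp

lemma min_repsI: "\<lbrakk>x \<in> carrier W; \<And>j. j \<in> J \<Longrightarrow> l x < l (x \<otimes> j)\<rbrakk> \<Longrightarrow> x \<in> min_reps J"
  unfolding min_reps_def by blast

lemma min_repsD: "\<lbrakk>x \<in> min_reps J; j \<in> J\<rbrakk> \<Longrightarrow> l x < l (x \<otimes> j)"
  unfolding min_reps_def by blast

lemma not_min_repsE:
  assumes "x \<in> carrier W" "x \<notin> min_reps J"
  obtains j where "j \<in> J" "\<not> l x < l (x \<otimes> j)"
  using assms unfolding min_reps_def by blast

lemma parabolic_closed: "\<lbrakk>J \<subseteq> S; h \<in> generate W J\<rbrakk> \<Longrightarrow> h \<in> carrier W"
  using generate_in_carrier[of J h] S_carrier by auto

lemma parabolic_mult: "\<lbrakk>g \<in> generate W J; h \<in> generate W J\<rbrakk> \<Longrightarrow> g \<otimes> h \<in> generate W J"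
  by (rule generate.eng)

lemma parabolic_inv: "\<lbrakk>J \<subseteq> S; h \<in> generate W J\<rbrakk> \<Longrightarrow> inv h \<in> generate W J"
  using generate_m_inv_closed[of J h] S_carrier by auto

lemma parabolic_simple: "j \<in> J \<Longrightarrow> j \<in> generate W J"
  by (rule generate.incl)

lemma min_rep_le_left:
  assumes J: "J \<subseteq> S" and a: "a \<in> min_reps J" and h: "h \<in> generate W J"
    and b: "b \<in> carrier W" and le: "a \<preceq> b \<otimes> h"
  shows "a \<preceq> b"
proof -
  obtain ws where ws: "set ws \<subseteq> J" "wprod ws = h" using generate_word[OF J h] by blast
  have "a \<preceq> b \<otimes> wprod ws \<Longrightarrow> a \<preceq> b"
    using ws(1) b
  proof (induction ws arbitrary: b)
    case (Cons j ws)
    then have j: "j \<in> J" "j \<in> S" "set ws \<subseteq> S" using J by auto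
    have "a \<preceq> (b \<otimes> j) \<otimes> wprod ws" using Cons.prems(1,3) j by (simp add: m_assoc)
    then have "a \<preceq> b \<otimes> j" using Cons.IH[of "b \<otimes> j"] Cons.prems j by simp
    then have "rmin a j \<preceq> rmin (b \<otimes> j) j" using rmin_mono j Cons.prems by simp
    moreover have "rmin a j = a" using min_repsD[OF a j(1)] by (simp add: rmin_def)
    moreover have "rmin (b \<otimes> j) j \<preceq> b" using rmax_rmin_bounds(4)[of j "b \<otimes> j"] j Cons.prems by simp
    ultimately show ?case using le_trans by simp
  qed simp
  then show ?thesis using le ws by simp
qed

lemma min_rep_le_coset:
  assumes "J \<subseteq> S" "a \<in> min_reps J" "h \<in> generate W J"
  shows "a \<preceq> a \<otimes> h"
proof -
  have "h \<in> carrier W" "a \<in> carrier W" "inv h \<in> generate W J"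
    using parabolic_closed[OF assms(1,3)] parabolic_inv[OF assms(1,3)] assms(2) by simp_all
  then show ?thesis
    using min_rep_le_left[OF assms(1,2), of "inv h" "a \<otimes> h"] by (simp add: m_assoc)
qed

lemma min_coset_reps_eq:
  assumes "J \<subseteq> S"
  shows "min_coset_reps W S (generate W J) = min_reps J"
proof
  show "min_reps J \<subseteq> min_coset_reps W S (generate W J)"
    using min_rep_le_coset[OF assms] le_length unfolding min_coset_reps_def by auto
  show "min_coset_reps W S (generate W J) \<subseteq> min_reps J"
  proof
    fix x assume x: "x \<in> min_coset_reps W S (generate W J)"
    have "l x < l (x \<otimes> j)" if "j \<in> J" for j
    proof -
      have "l x \<le> l (x \<otimes> j)" "x \<in> carrier W" "j \<in> S"
        using x that assms parabolic_simple unfolding min_coset_reps_def by auto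
      then show ?thesis using length_mult_S[of j x] by auto
    qed
    then show "x \<in> min_reps J" using x by (intro min_repsI) (simp_all add: min_coset_reps_def)
  qed
qed

lemma min_rep_unique:
  assumes "J \<subseteq> S" "a \<in> min_reps J" "h \<in> generate W J" "a \<otimes> h \<in> min_reps J"
  shows "h = \<one>"
proof -
  have cl: "h \<in> carrier W" "a \<in> carrier W" using parabolic_closed[OF assms(1,3)] assms(2) by simp_all
  have "a \<otimes> h \<preceq> a \<otimes> h \<otimes> inv h"
    using min_rep_le_coset[OF assms(1,4)] parabolic_inv[OF assms(1,3)] by blast
  then have "a \<otimes> h \<preceq> a" using cl by (simp add: m_assoc)
  then have "a = a \<otimes> h" using le_antisym min_rep_le_coset[OF assms(1-3)] by blast
  then show ?thesis using cl by (metis l_cancel_one')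
qed

lemma min_rep_exists:
  assumes "J \<subseteq> S" "w \<in> carrier W"
  obtains x h where "x \<in> min_reps J" "h \<in> generate W J" "w = x \<otimes> h"
proof -
  have "\<exists>x\<in>min_reps J. \<exists>h\<in>generate W J. w = x \<otimes> h"
    using assms(2)
  proof (induction "l w" arbitrary: w rule: less_induct)
    case less
    show ?case
    proof (cases "w \<in> min_reps J")
      case True
      then show ?thesis using generate.one[of W J] by force
    next
      case False
      then obtain j where j: "j \<in> J" "\<not> l w < l (w \<otimes> j)" using less.prems not_min_repsE by blast
      then have "j \<in> S" "l (w \<otimes> j) < l w" using length_mult_S[of j w] less.prems assms by auto
      then obtain x h where xh: "x \<in> min_reps J" "h \<in> generate W J" "w \<otimes> j = x \<otimes> h"
        using less by (metis S_closed m_closed)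
      then have "w \<otimes> j \<otimes> j = x \<otimes> (h \<otimes> j)"
        using \<open>j \<in> S\<close> parabolic_closed[OF assms(1)] by (simp add: m_assoc)
      then have "w = x \<otimes> (h \<otimes> j)" using \<open>j \<in> S\<close> less.prems by simp
      then show ?thesis using xh j parabolic_mult parabolic_simple by blast
    qed
  qed
  then show thesis using that by blast
qed

lemma min_rep_left_mult:
  assumes "J \<subseteq> S" "x \<in> min_reps J" "s \<in> S" "s \<otimes> x \<notin> min_reps J"
  obtains j where "j \<in> J" "s \<otimes> x = x \<otimes> j" "l x < l (s \<otimes> x)"
proof -
  have x: "x \<in> carrier W" using assms by simp
  obtain j where j: "j \<in> J" "\<not> l (s \<otimes> x) < l (s \<otimes> x \<otimes> j)"
    using not_min_repsE[OF _ assms(4)] assms(3) x by (metis S_closed m_closed)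
  have jS: "j \<in> S" using j assms by auto
  have xj: "l x < l (x \<otimes> j)" using min_repsD[OF assms(2) j(1)] .
  have less: "l (s \<otimes> x \<otimes> j) < l (s \<otimes> x)" using length_mult_S[of j "s \<otimes> x"] j jS x assms by auto
  have up: "l x < l (s \<otimes> x)"
    using length_S_mult[of s x] length_S_mult[of s "x \<otimes> j"] less xj jS x assms
    by (auto simp: m_assoc)
  then have "l (s \<otimes> x \<otimes> j) < l (x \<otimes> j)"
    using length_S_mult[of s x] length_S_mult[of s "x \<otimes> j"] less xj jS x assms
    by (auto simp: m_assoc)
  then have "s \<otimes> x = x \<otimes> j" using exchange up jS x assms by blast
  then show thesis using that j up by blast
qed

lemma min_rep_ascent:
  assumes J: "J \<subseteq> S" and x: "x \<in> min_reps J" and h: "h \<in> generate W J"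
    and s: "s \<in> S" "s \<otimes> x \<in> min_reps J" "l x < l (s \<otimes> x)"
  shows "l (x \<otimes> h) < l (s \<otimes> (x \<otimes> h))"
proof -
  obtain ws where ws: "set ws \<subseteq> J" "wprod ws = h" using generate_word[OF J h] by blast
  have "l (x \<otimes> wprod ws) < l (s \<otimes> (x \<otimes> wprod ws))"
    using ws(1)
  proof (induction ws rule: rev_induct)
    case Nil
    then show ?case using s x by simp
  next
    case (snoc j ws)
    let ?g = "wprod ws"
    have j: "j \<in> J" "j \<in> S" "set ws \<subseteq> S" using snoc.prems J by auto
    have cl: "x \<in> carrier W" "?g \<in> carrier W" using x j by auto
    have g: "?g \<in> generate W J"
      using snoc.prems by (induction ws) (auto intro: generate.one generate.eng parabolic_simple)
    have wj: "wprod (ws @ [j]) = ?g \<otimes> j" using wprod_append[of ws "[j]"] j by simp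
    show ?case
    proof (rule ccontr)
      assume "\<not> ?case"
      then have "s \<otimes> (x \<otimes> ?g) = x \<otimes> ?g \<otimes> j"
        using exchange_iff[of s j "x \<otimes> ?g"] snoc s cl j unfolding wj by (simp add: m_assoc)
      then have "s \<otimes> (x \<otimes> ?g) \<otimes> inv ?g = x \<otimes> ?g \<otimes> j \<otimes> inv ?g" by simp
      then have eq: "s \<otimes> x = x \<otimes> (?g \<otimes> j \<otimes> inv ?g)" using s cl j by (simp add: m_assoc)
      have mem: "?g \<otimes> j \<otimes> inv ?g \<in> generate W J"
        
        using g j parabolic_simple[of j J] parabolic_inv[OF J g] by (intro parabolic_mult)
      have "?g \<otimes> j \<otimes> inv ?g = \<one>"
        by (rule min_rep_unique[OF J x mem]) (use eq s in simp)
      then have "s \<otimes> x = x" using eq cl by simp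
      then show False using s by simp
    qed
  qed
  then show ?thesis using ws by simp
qed

lemma min_rep_left_factor:
  assumes "J \<subseteq> S" "s \<in> S" "x \<in> carrier W" "l x < l (s \<otimes> x)" "s \<otimes> x \<in> min_reps J"
  shows "x \<in> min_reps J"
proof -
  have "l x < l (x \<otimes> j)" if j: "j \<in> J" for j
  proof -
    have "j \<in> S" "l (s \<otimes> x) < l (s \<otimes> (x \<otimes> j))"
      using assms j min_repsD[OF assms(5) j] by (auto simp: m_assoc)
    then show ?thesis
      using length_S_mult_le[of s "x \<otimes> j"] length_S_mult[of s x] assms by auto
  qed
  then show ?thesis using assms(3) min_repsI by blast
qed

lemma length_min_rep_mult:
  assumes J: "J \<subseteq> S" and x: "x \<in> min_reps J" and h: "h \<in> generate W J"
  shows "l (x \<otimes> h) = l x + l h"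
proof -
  have "x \<in> carrier W" using x by simp
  then have "x \<in> min_reps J \<longrightarrow> l (x \<otimes> h) = l x + l h"
  proof (induction rule: left_induct)
    case one
    then show ?case using parabolic_closed[OF J] h by simp
  next
    case (mult s x)
    have hc: "h \<in> carrier W" using parabolic_closed[OF J] h by simp
    show ?case
    proof
      assume sx: "s \<otimes> x \<in> min_reps J"
      then have x: "x \<in> min_reps J" using min_rep_left_factor J mult.hyps by blast
      have "l (x \<otimes> h) < l (s \<otimes> (x \<otimes> h))" using min_rep_ascent J x h sx mult.hyps by blast
      then show "l (s \<otimes> x \<otimes> h) = l (s \<otimes> x) + l h"
        using mult.IH x length_S_mult[of s x] length_S_mult[of s "x \<otimes> h"] mult.hyps hc
        by (auto simp: m_assoc)
    qed
  qed
  then show ?thesis using x by blast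
qed

lemma parabolic_right_descent:
  assumes J: "J \<subseteq> S" and h: "h \<in> generate W J" "h \<noteq> \<one>"
  obtains j where "j \<in> J" "l (h \<otimes> j) < l h"
proof -
  have hc: "h \<in> carrier W" using parabolic_closed[OF J] h by simp
  have "\<one> \<in> min_reps J"
  proof (rule min_repsI)
    fix j assume "j \<in> J"
    then show "l \<one> < l (\<one> \<otimes> j)" using length_S[of j] J by auto
  qed simp
  then have "h \<notin> min_reps J" using min_rep_unique[OF J _ h(1), of \<one>] h(2) hc by auto
  then obtain j where j: "j \<in> J" "\<not> l h < l (h \<otimes> j)" using hc not_min_repsE by blast
  then show thesis using that length_mult_S[of j h] J hc by fastforce
qed

lemma simple_in_parabolic:
  assumes "J \<subseteq> S" "s \<in> S" "s \<in> generate W J"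
  shows "s \<in> J"
proof -
  have "s \<noteq> \<one>" using length_S[of s] assms by auto
  then obtain j where j: "j \<in> J" "l (s \<otimes> j) < l s" using parabolic_right_descent assms by metis
  then have jS: "j \<in> S" using assms by auto
  then have "s \<otimes> j = \<one>" using j length_S length_eq_0[of "s \<otimes> j"] assms by auto
  then have "s \<otimes> j \<otimes> j = j" using jS by simp
  then show ?thesis using j jS assms by simp
qed

lemma le_parabolic:
  assumes J: "J \<subseteq> S" and w: "w \<in> generate W J" and u: "u \<preceq> w" and y: "y \<in> min_reps J"
  shows "u \<in> generate W J \<and> y \<otimes> u \<preceq> y \<otimes> w"
  using w u
proof (induction "l w" arbitrary: u w rule: less_induct)
  case less
  have wc: "w \<in> carrier W" using parabolic_closed[OF J] less.prems by simp
  have uc: "u \<in> carrier W" using le_closed less.prems wc by blast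
  show ?case
  proof (cases "w = \<one>")
    case True
    then have "u = \<one>" using le_length[of u w] length_eq_0[of u] less.prems uc by simp
    then show ?thesis using True generate.one by simp
  next
    case False
    then obtain j where j: "j \<in> J" "l (w \<otimes> j) < l w" using parabolic_right_descent J less.prems by blast
    then have jS: "j \<in> S" using J by auto
    let ?w = "w \<otimes> j"
    have wj: "?w \<in> generate W J" using less.prems j parabolic_mult parabolic_simple by blast
    have "rmin u j \<preceq> rmin w j" using rmin_mono less.prems jS wc by blast
    also have "rmin w j = ?w" using j by (simp add: rmin_def)
    finally have IH: "rmin u j \<in> generate W J" "y \<otimes> rmin u j \<preceq> y \<otimes> ?w"
      using less.hyps[of ?w "rmin u j"] wj j by auto
    have "u = rmin u j \<or> u = rmin u j \<otimes> j" using rmin_cases[of u j] uc jS by auto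
    then have mem: "u \<in> generate W J" using IH j parabolic_mult parabolic_simple by metis
    have yc: "y \<in> carrier W" using y by simp
    have rc: "rmin u j \<in> carrier W" using parabolic_closed[OF J IH(1)] .
    have "rmax (y \<otimes> ?w) j = y \<otimes> w"
      using length_min_rep_mult[OF J y] less.prems wj j yc wc jS
      by (simp add: rmax_def m_assoc S_square)
    then have "rmax (y \<otimes> rmin u j) j \<preceq> y \<otimes> w"
      using rmax_mono[OF IH(2) jS] yc wc jS by auto
    then have "y \<otimes> rmin u j \<preceq> y \<otimes> w" "y \<otimes> (rmin u j \<otimes> j) \<preceq> y \<otimes> w"
      using rmax_rmin_bounds(1,2)[of j "y \<otimes> rmin u j"] yc rc jS le_trans by (auto simp: m_assoc)
    then show ?thesis using mem \<open>u = rmin u j \<or> u = rmin u j \<otimes> j\<close> by metis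
  qed
qed

end

locale parabolic_pair = exchange_group +
  fixes J K :: "'a set"
  assumes J_subset: "J \<subseteq> S" and K_subset: "K \<subseteq> J"
    and K_normal: "\<lbrakk>h \<in> generate W J; k \<in> generate W K\<rbrakk> \<Longrightarrow> h \<otimes> k \<otimes> inv h \<in> generate W K"
begin

abbreviation "WJ \<equiv> generate W J"
abbreviation "WK \<equiv> generate W K"
abbreviation "DJ \<equiv> min_reps J"
abbreviation "DK \<equiv> min_reps K"

lemma KS: "K \<subseteq> S" using K_subset J_subset by blast

lemma WJ_closed [simp]: "h \<in> WJ \<Longrightarrow> h \<in> carrier W"
  and WK_closed [simp]: "k \<in> WK \<Longrightarrow> k \<in> carrier W"
  using parabolic_closed[OF J_subset] parabolic_closed[OF KS] by blast+

lemma J_S [simp]: "j \<in> J \<Longrightarrow> j \<in> S"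
  and J_WJ [simp]: "j \<in> J \<Longrightarrow> j \<in> WJ"
  and K_WK [simp]: "k \<in> K \<Longrightarrow> k \<in> WK"
  using J_subset parabolic_simple by blast+

lemma WJ_mult [simp]: "\<lbrakk>g \<in> WJ; h \<in> WJ\<rbrakk> \<Longrightarrow> g \<otimes> h \<in> WJ"
  by (rule parabolic_mult)

lemma WJ_inv [simp]: "h \<in> WJ \<Longrightarrow> inv h \<in> WJ"
  by (rule parabolic_inv[OF J_subset])

lemma WK_WJ [simp]: "k \<in> WK \<Longrightarrow> k \<in> WJ"
  using mono_generate[OF K_subset] by blast

lemma inv_DK:
  assumes "g \<in> WJ" "g \<in> DK"
  shows "inv g \<in> DK"
proof -
  have "l (inv g) < l (inv g \<otimes> k)" if k: "k \<in> K" for k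
  proof -
    have kJ: "k \<in> WJ" "k \<in> S" "k \<in> carrier W" using k KS K_subset by auto
    have "inv g \<otimes> k \<otimes> inv (inv g) \<in> WK" using K_normal[of "inv g" k] assms k by simp
    then have "g \<preceq> g \<otimes> (inv g \<otimes> k \<otimes> g)"
      using min_rep_le_coset[OF KS assms(2)] assms by simp
    then have "l g \<le> l (k \<otimes> g)" using le_length[of g "k \<otimes> g"] assms kJ by (simp add: m_assoc)
    moreover have "l (k \<otimes> g) \<noteq> l g" using length_neq kJ assms by simp
    moreover have "l (inv g \<otimes> k) = l (k \<otimes> g)"
      using length_inv[of "inv g \<otimes> k"] kJ assms by (simp add: inv_mult_group)
    ultimately show ?thesis using assms by simp
  qed
  then show ?thesis using assms(1) min_repsI by simp
qed

lemma right_mult_DK: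
  assumes "x \<in> DK" "j \<in> J" "x \<otimes> j \<notin> DK"
  shows "j \<in> K" "l x < l (x \<otimes> j)"
proof -
  have xc: "x \<in> carrier W" using assms by simp
  obtain x0 g where g: "x0 \<in> DJ" "g \<in> WJ" "x = x0 \<otimes> g" using min_rep_exists J_subset xc by blast
  have len: "l (x0 \<otimes> h) = l x0 + l h" if "h \<in> WJ" for h
    using length_min_rep_mult J_subset g that by blast
  have KJ: "k \<in> WJ" if "k \<in> K" for k using that by simp
  have gDK: "g \<in> DK"
  proof (rule min_repsI)
    fix k assume k: "k \<in> K"
    then have "x \<otimes> k = x0 \<otimes> (g \<otimes> k)" using g KS by (auto simp: m_assoc)
    then show "l g < l (g \<otimes> k)"
      using min_repsD[OF assms(1) k] len[OF g(2)] len[OF WJ_mult[OF g(2) KJ[OF k]]] g(3) by simp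
  qed (use g in simp)
  have gj: "g \<otimes> j \<in> WJ" using g assms by simp
  have "g \<otimes> j \<notin> DK"
  proof
    assume h: "g \<otimes> j \<in> DK"
    have "l (x \<otimes> j) < l (x \<otimes> j \<otimes> k)" if "k \<in> K" for k
    proof -
      have "x \<otimes> j = x0 \<otimes> (g \<otimes> j)" "x \<otimes> j \<otimes> k = x0 \<otimes> (g \<otimes> j \<otimes> k)"
        using g assms that KS by (auto simp: m_assoc)
      then show ?thesis using len[OF gj] len[OF WJ_mult[OF gj KJ[OF that]]] min_repsD[OF h that] by simp
    qed
    then show False using assms xc min_repsI[of "x \<otimes> j" K] by simp
  qed
  then have "inv (inv (g \<otimes> j)) \<notin> DK" using gj by simp
  then have "inv (g \<otimes> j) \<notin> DK" using inv_DK gj WJ_inv by blast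
  then have "j \<otimes> inv g \<notin> DK" using g assms by (simp add: inv_mult_group)
  then obtain k where k: "k \<in> K" "j \<otimes> inv g = inv g \<otimes> k"
    using min_rep_left_mult[OF KS inv_DK[OF g(2) gDK]] assms by (metis J_S)
  have c: "g \<in> carrier W" "j \<in> carrier W" using g assms by auto
  have "j = j \<otimes> inv g \<otimes> g" using c by (simp add: m_assoc)
  also have "\<dots> = inv g \<otimes> k \<otimes> inv (inv g)" unfolding k(2) using c by simp
  also have "\<dots> \<in> WK" using K_normal[of "inv g" k] g k by simp
  finally show "j \<in> K" using simple_in_parabolic KS assms by auto
  then show "l x < l (x \<otimes> j)" using min_repsD[OF assms(1)] by blast
qed

lemma le_mod_K:
  assumes "u \<in> DK" "x \<in> carrier W" "k \<in> WK" "w \<in> WJ" "u \<preceq> x \<otimes> k \<otimes> w"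
  shows "u \<preceq> x \<otimes> w"
proof (rule min_rep_le_left[OF KS assms(1)])
  show "inv w \<otimes> k \<otimes> inv (inv w) \<in> WK" using K_normal[of "inv w" k] assms by simp
  show "u \<preceq> x \<otimes> w \<otimes> (inv w \<otimes> k \<otimes> inv (inv w))" using assms by (simp add: m_assoc)
qed (use assms in simp)

definition pairs :: "('a \<times> 'a) set" where "pairs = DK \<times> DJ"

definition pair_le :: "'a \<times> 'a \<Rightarrow> 'a \<times> 'a \<Rightarrow> bool" where
  "pair_le \<theta> \<sigma> \<longleftrightarrow> (\<exists>w\<in>WJ. fst \<theta> \<preceq> fst \<sigma> \<otimes> w \<and> snd \<sigma> \<otimes> w \<preceq> snd \<theta>)"

definition pair_rank :: "'a \<times> 'a \<Rightarrow> int" where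
  "pair_rank \<sigma> = int (l (fst \<sigma>)) - int (l (snd \<sigma>))"

definition DK_act :: "'a \<Rightarrow> 'a \<Rightarrow> 'a" where
  "DK_act x x' = (if x' \<in> DK then x' else x)"

definition left_act :: "'a \<Rightarrow> 'a \<times> 'a \<Rightarrow> 'a \<times> 'a" where
  "left_act s \<sigma> = (DK_act (fst \<sigma>) (s \<otimes> fst \<sigma>), snd \<sigma>)"

text \<open>\<open>\<sigma> s = x e (s y)\<^sup>-\<^sup>1\<close>; if \<open>s y\<close> is not minimal in its coset, then \<open>s y = y j\<close> with \<open>j \<in> J\<close>
  and \<open>j\<close> moves across \<open>e\<close> to \<open>x\<close>.\<close>

definition right_act :: "'a \<Rightarrow> 'a \<times> 'a \<Rightarrow> 'a \<times> 'a" where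
  "right_act s \<sigma> =
     (if s \<otimes> snd \<sigma> \<in> DJ then (fst \<sigma>, s \<otimes> snd \<sigma>)
      else (DK_act (fst \<sigma>) (fst \<sigma> \<otimes> (inv (snd \<sigma>) \<otimes> s \<otimes> snd \<sigma>)), snd \<sigma>))"

lemma right_act_cases:
  assumes "x \<in> DK" "y \<in> DJ" "s \<in> S"
  obtains (moves) "s \<otimes> y \<in> DJ" "right_act s (x, y) = (x, s \<otimes> y)"
  | (crosses) j where "j \<in> J" "s \<otimes> y = y \<otimes> j" "l y < l (s \<otimes> y)" "s \<otimes> y \<notin> DJ"
      "right_act s (x, y) = (DK_act x (x \<otimes> j), y)"
proof (cases "s \<otimes> y \<in> DJ")
  case True
  then show thesis using moves by (simp add: right_act_def)
next
  case False
  then obtain j where j: "j \<in> J" "s \<otimes> y = y \<otimes> j" "l y < l (s \<otimes> y)"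
    using min_rep_left_mult[OF J_subset assms(2,3)] by blast
  have "inv y \<otimes> s \<otimes> y = j" using j assms by (simp add: m_assoc)
  then show thesis using crosses j False by (simp add: right_act_def)
qed

lemma min_mult:
  assumes "y \<in> DJ" "w \<in> WJ" "s \<in> S" "j \<in> J" "s \<otimes> y = y \<otimes> j"
  shows "lmin s (y \<otimes> w) = y \<otimes> lmin j w" "lmax s (y \<otimes> w) = y \<otimes> lmax j w"
proof -
  have "s \<otimes> (y \<otimes> w) = y \<otimes> (j \<otimes> w)" using assms by (metis J_S S_closed WJ_closed m_assoc min_reps_closed)
  then show "lmin s (y \<otimes> w) = y \<otimes> lmin j w" "lmax s (y \<otimes> w) = y \<otimes> lmax j w"
    using length_min_rep_mult[OF J_subset assms(1)] assms by (auto simp: lmin_def lmax_def)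
qed

lemma left_mult_min_rep_less:
  assumes "y \<in> DJ" "w \<in> WJ" "s \<in> S" "s \<otimes> y \<in> DJ"
  shows "l (y \<otimes> w) < l (s \<otimes> (y \<otimes> w)) \<longleftrightarrow> l y < l (s \<otimes> y)"
  using length_min_rep_mult[OF J_subset assms(1,2)] length_min_rep_mult[OF J_subset assms(4,2)] assms
  by (simp add: m_assoc)

lemma lmin_WJ [simp]: "\<lbrakk>j \<in> J; w \<in> WJ\<rbrakk> \<Longrightarrow> lmin j w \<in> WJ"
  and lmax_WJ [simp]: "\<lbrakk>j \<in> J; w \<in> WJ\<rbrakk> \<Longrightarrow> lmax j w \<in> WJ"
  and rmin_WJ [simp]: "\<lbrakk>j \<in> J; w \<in> WJ\<rbrakk> \<Longrightarrow> rmin w j \<in> WJ"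
  by (simp_all add: lmin_def lmax_def rmin_def)

lemma le_WJ:
  assumes "w \<in> WJ" "u \<preceq> w" "y \<in> DJ"
  shows "u \<in> WJ" "y \<otimes> u \<preceq> y \<otimes> w"
  using le_parabolic[OF J_subset] assms by blast+

lemma one_DJ: "\<one> \<in> DJ"
proof (rule min_repsI)
  fix j assume "j \<in> J"
  then show "l \<one> < l (\<one> \<otimes> j)" using length_S[of j] by simp
qed simp

lemma fst_step_up:
  assumes "u \<in> DK" "x \<in> DK" "j \<in> J" "w \<in> WJ" "u \<preceq> x \<otimes> w"
  shows "\<exists>w'\<in>WJ. w' \<preceq> lmin j w \<and> u \<preceq> (if x \<otimes> j \<in> DK then rmax x j else x) \<otimes> w'"
proof -
  let ?x = "if x \<otimes> j \<in> DK then rmax x j else x"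
  have cl: "x \<in> carrier W" "?x \<in> carrier W" "j \<in> S" "w \<in> carrier W" "j \<otimes> w \<in> WJ"
    using assms rmax_rmin_bounds(5)[of j x] by auto
  have grow: "\<exists>w'\<in>WJ. w' \<preceq> v \<and> u \<preceq> ?x \<otimes> w'"
    if a: "x' \<preceq> ?x" "v \<in> WJ" "u \<preceq> x' \<otimes> v" for x' v
  proof -
    obtain w' where "w' \<preceq> v" "x' \<otimes> v \<preceq> ?x \<otimes> w'" using right_mult_le[OF a(1) cl(2) WJ_closed[OF a(2)]] by blast
    then show ?thesis using a le_trans le_WJ(1)[OF _ _ one_DJ] by blast
  qed
  have xx: "x \<preceq> ?x" using rmax_rmin_bounds(1)[of j x] cl by simp
  show ?thesis
  proof (cases "l w < l (j \<otimes> w)")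
    case True
    then show ?thesis using grow[OF xx] assms by (simp add: lmin_def)
  next
    case False
    then have lm: "lmin j w = j \<otimes> w" by (simp add: lmin_def)
    have split: "u \<preceq> (x \<otimes> j) \<otimes> (j \<otimes> w)" using assms cl by (simp add: m_assoc)
    show ?thesis
    proof (cases "x \<otimes> j \<in> DK")
      case True
      then show ?thesis using grow[OF _ cl(5) split] lm rmax_rmin_bounds(2)[of j x] cl by simp
    next
      case False
      then have "j \<in> WK" using right_mult_DK assms by auto
      then have "u \<preceq> x \<otimes> (j \<otimes> w)" using le_mod_K[of u x j "j \<otimes> w"] split assms cl by simp
      then show ?thesis using False lm cl by (intro bexI[of _ "j \<otimes> w"]) auto
    qed
  qed
qed

lemma fst_step_down:
  assumes "x \<in> DK" "j \<in> J" "w \<in> WJ" "u \<preceq> x \<otimes> w"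
  shows "\<exists>w'\<in>WJ. w' \<preceq> lmax j w \<and> u \<preceq> rmin x j \<otimes> w'"
proof (cases "l x < l (x \<otimes> j)")
  case True
  then show ?thesis using assms lmax_lmin_bounds(1)[of j w] by (auto simp: rmin_def)
next
  case False
  have "u \<preceq> (x \<otimes> j) \<otimes> (j \<otimes> w)" using assms by (simp add: m_assoc)
  then show ?thesis
    using False assms lmax_lmin_bounds(2)[of j w] by (auto simp: rmin_def intro!: bexI[of _ "j \<otimes> w"])
qed

lemma raise_right_act:
  assumes "x \<in> DK" "y \<in> DJ" "s \<in> S"
  obtains (moves) "s \<otimes> y \<in> DJ" "raise pair_rank (right_act s) (x, y) = (x, lmin s y)"
  | (crosses) j where "j \<in> J" "s \<otimes> y = y \<otimes> j" "l y < l (s \<otimes> y)"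
      "raise pair_rank (right_act s) (x, y) = (if x \<otimes> j \<in> DK then rmax x j else x, y)"
  using assms
proof (cases rule: right_act_cases)
  case moves
  then show thesis using that(1) length_neq[of s y] assms
    by (auto simp: raise_def pair_rank_def lmin_def)
next
  case (crosses j)
  then show thesis using that(2)[of j] by (auto simp: raise_def pair_rank_def rmax_def DK_act_def)
qed

lemma lower_right_act:
  assumes "x \<in> DK" "y \<in> DJ" "s \<in> S"
  obtains (moves) "s \<otimes> y \<in> DJ" "lower pair_rank (right_act s) (x, y) = (x, lmax s y)"
  | (crosses) j where "j \<in> J" "s \<otimes> y = y \<otimes> j" "l y < l (s \<otimes> y)"
      "lower pair_rank (right_act s) (x, y) = (rmin x j, y)"
  using assms
proof (cases rule: right_act_cases)
  case moves
  then show thesis using that(1) by (auto simp: lower_def pair_rank_def lmax_def)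
next
  case (crosses j)
  have "lower pair_rank (right_act s) (x, y) = (rmin x j, y)"
  proof (cases "x \<otimes> j \<in> DK")
    case True
    then have "right_act s (x, y) = (x \<otimes> j, y)" using crosses(5) by (simp add: DK_act_def)
    moreover have "l (x \<otimes> j) < l x \<longleftrightarrow> \<not> l x < l (x \<otimes> j)"
      using length_mult_S[OF J_S[OF crosses(1)] min_reps_closed[OF assms(1)]] by linarith
    ultimately show ?thesis by (simp add: lower_def pair_rank_def rmin_def)
  next
    case False
    then show ?thesis
      using crosses(5) right_mult_DK(2)[OF assms(1) crosses(1)]
      by (simp add: lower_def pair_rank_def rmin_def DK_act_def)
  qed
  then show thesis using that(2)[of j] crosses by blast
qed

lemma raise_right_mono:
  assumes uv: "u \<in> DK" "v \<in> DJ" and xy: "x \<in> DK" "y \<in> DJ" and s: "s \<in> S"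
    and le: "pair_le (u, v) (x, y)"
  shows "pair_le (raise pair_rank (right_act s) (u, v)) (raise pair_rank (right_act s) (x, y))"
proof -
  obtain w where w: "w \<in> WJ" "u \<preceq> x \<otimes> w" "y \<otimes> w \<preceq> v" using le by (auto simp: pair_le_def)
  have cl: "u \<in> carrier W" "v \<in> carrier W" "x \<in> carrier W" "y \<in> carrier W" "w \<in> carrier W"
    using assms w by auto
  obtain u' v' where r: "raise pair_rank (right_act s) (u, v) = (u', v')" by fastforce
  have "u' \<in> DK \<and> (\<exists>w1\<in>WJ. u' \<preceq> x \<otimes> w1 \<and> lmin s (y \<otimes> w1) \<preceq> v')"
    using uv s
  proof (cases rule: raise_right_act)
    case moves
    have "lmin s (y \<otimes> w) \<preceq> lmin s v" using lmin_mono w s cl by blast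
    then show ?thesis using moves r w uv by auto
  next
    case (crosses j)
    have jS: "j \<in> S" using crosses by simp
    have same: "lmin s (y \<otimes> w) \<preceq> v"
      using lmax_lmin_bounds(3)[of s "y \<otimes> w"] w cl s le_trans by (metis m_closed)
    show ?thesis
    proof (cases "u' = u")
      case True
      then show ?thesis using same w uv crosses r by auto
    next
      case False
      then have u': "u' = rmax u j" "u' \<in> DK" using crosses r rmax_cases[of u j] uv by (auto split: if_splits)
      obtain w1 where w1: "w1 \<in> WJ" "rmax (x \<otimes> w) j = x \<otimes> w1" "y \<otimes> w1 \<preceq> rmax (y \<otimes> w) j"
      proof (cases "rmax (x \<otimes> w) j = x \<otimes> w")
        case True
        then show thesis using that[of w] w rmax_rmin_bounds(1)[of j "y \<otimes> w"] cl jS by simp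
      next
        case False
        then have "rmax (x \<otimes> w) j = x \<otimes> (w \<otimes> j)"
          using rmax_cases[of "x \<otimes> w" j] cl jS by (auto simp: m_assoc)
        moreover have "y \<otimes> (w \<otimes> j) \<preceq> rmax (y \<otimes> w) j"
          using rmax_rmin_bounds(2)[of j "y \<otimes> w"] cl jS by (simp add: m_assoc)
        ultimately show thesis using that[of "w \<otimes> j"] w crosses by simp
      qed
      have "y \<otimes> w1 \<preceq> rmax v j" using le_trans[OF w1(3) rmax_mono[OF w(3) jS cl(2)]] .
      also have "rmax v j = s \<otimes> v" using crosses by (simp add: rmax_def)
      finally have "lmin s (y \<otimes> w1) \<preceq> lmin s (s \<otimes> v)" using lmin_mono s cl by simp
      also have "lmin s (s \<otimes> v) = v" using crosses(3) s cl(2) by (simp add: lmin_def)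
      finally have "lmin s (y \<otimes> w1) \<preceq> v'" using crosses r by simp
      moreover have "u' \<preceq> x \<otimes> w1" using rmax_mono[OF w(2) jS] w1 u' cl by simp
      ultimately show ?thesis using w1 u' by blast
    qed
  qed
  then obtain w1 where u': "u' \<in> DK" and w1: "w1 \<in> WJ" "u' \<preceq> x \<otimes> w1" "lmin s (y \<otimes> w1) \<preceq> v'"
    by blast
  from xy s have "pair_le (u', v') (raise pair_rank (right_act s) (x, y))"
  proof (cases rule: raise_right_act)
    case moves
    have "lmin s (y \<otimes> w1) = lmin s y \<otimes> w1"
      using left_mult_min_rep_less[of y w1 s] moves w1 xy s cl by (simp add: lmin_def m_assoc)
    then show ?thesis using moves w1 by (auto simp: pair_le_def)
  next
    case (crosses j)
    obtain w2 where w2: "w2 \<in> WJ" "w2 \<preceq> lmin j w1" "u' \<preceq> (if x \<otimes> j \<in> DK then rmax x j else x) \<otimes> w2"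
      using fst_step_up[OF u' xy(1) crosses(1) w1(1,2)] by blast
    have "y \<otimes> w2 \<preceq> y \<otimes> lmin j w1"
      using le_WJ(2)[OF lmin_WJ[OF crosses(1) w1(1)] w2(2) xy(2)] .
    also have "y \<otimes> lmin j w1 = lmin s (y \<otimes> w1)"
      using min_mult(1)[OF xy(2) w1(1) s crosses(1,2)] by simp
    also note w1(3)
    finally have "y \<otimes> w2 \<preceq> v'" .
    then show ?thesis using crosses w2 by (auto simp: pair_le_def)
  qed
  then show ?thesis using r by simp
qed

lemma lower_right_mono:
  assumes uv: "u \<in> DK" "v \<in> DJ" and xy: "x \<in> DK" "y \<in> DJ" and s: "s \<in> S"
    and le: "pair_le (u, v) (x, y)"
  shows "pair_le (lower pair_rank (right_act s) (u, v)) (lower pair_rank (right_act s) (x, y))"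
proof -
  obtain w where w: "w \<in> WJ" "u \<preceq> x \<otimes> w" "y \<otimes> w \<preceq> v" using le by (auto simp: pair_le_def)
  have cl: "u \<in> carrier W" "v \<in> carrier W" "x \<in> carrier W" "y \<in> carrier W" "w \<in> carrier W"
    using assms w by auto
  obtain x' y' where r: "lower pair_rank (right_act s) (x, y) = (x', y')" by fastforce
  have "x' \<in> carrier W \<and> y' \<in> DJ \<and> (\<exists>w1\<in>WJ. u \<preceq> x' \<otimes> w1 \<and> y' \<otimes> w1 \<preceq> lmax s (y \<otimes> w))"
    using xy s
  proof (cases rule: lower_right_act)
    case moves
    have "lmax s (y \<otimes> w) = lmax s y \<otimes> w"
      using left_mult_min_rep_less[of y w s] moves w xy s cl by (simp add: lmax_def m_assoc)
    then show ?thesis using moves r w xy by (auto simp: lmax_def intro!: bexI[of _ w])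
  next
    case (crosses j)
    obtain w1 where w1: "w1 \<in> WJ" "w1 \<preceq> lmax j w" "u \<preceq> rmin x j \<otimes> w1"
      using fst_step_down[OF xy(1) crosses(1) w(1,2)] by blast
    have "y \<otimes> w1 \<preceq> y \<otimes> lmax j w"
      using le_WJ(2)[OF lmax_WJ[OF crosses(1) w(1)] w1(2) xy(2)] .
    then have "y \<otimes> w1 \<preceq> lmax s (y \<otimes> w)"
      using min_mult(2)[OF xy(2) w(1) s crosses(1,2)] by simp
    then show ?thesis
      using crosses r w1 xy rmax_rmin_bounds(6)[of j x] by auto
  qed
  then obtain w1 where x': "x' \<in> carrier W" "y' \<in> DJ" "y' \<in> carrier W"
    and w1: "w1 \<in> WJ" "u \<preceq> x' \<otimes> w1" "y' \<otimes> w1 \<preceq> lmax s (y \<otimes> w)"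
    by auto
  have le': "y' \<otimes> w1 \<preceq> lmax s v" using le_trans[OF w1(3) lmax_mono[OF w(3) s cl(2)]] .
  from uv s have "pair_le (lower pair_rank (right_act s) (u, v)) (x', y')"
  proof (cases rule: lower_right_act)
    case moves
    then show ?thesis using le' w1 by (auto simp: pair_le_def)
  next
    case (crosses j)
    have jS: "j \<in> S" "w1 \<in> carrier W" using crosses w1 by auto
    let ?w = "rmin w1 j"
    have "rmin (y' \<otimes> w1) j = y' \<otimes> ?w"
      using length_min_rep_mult[OF J_subset x'(2)] w1 crosses x' jS by (simp add: rmin_def m_assoc)
    moreover have "rmin (y' \<otimes> w1) j \<preceq> rmin (v \<otimes> j) j"
      using rmin_mono[OF le' jS(1)] crosses cl jS by (simp add: lmax_def)
    moreover have "rmin (v \<otimes> j) j = v" using crosses cl jS by (simp add: rmin_def)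
    ultimately have 1: "y' \<otimes> ?w \<preceq> v" by simp
    have "rmin u j \<preceq> rmin (x' \<otimes> w1) j" using rmin_mono[OF w1(2) jS(1)] x' jS by simp
    also have "rmin (x' \<otimes> w1) j \<preceq> x' \<otimes> ?w"
      using rmin_cases[of w1 j] rmax_rmin_bounds(3,4)[of j "x' \<otimes> w1"] x' jS by (auto simp: m_assoc)
    finally show ?thesis using 1 w1 crosses by (auto simp: pair_le_def)
  qed
  then show ?thesis using r by simp
qed

lemma raise_left_act:
  assumes "x \<in> DK" "s \<in> S"
  shows "raise pair_rank (left_act s) (x, y) = (if s \<otimes> x \<in> DK then lmax s x else x, y)"
  by (simp add: raise_def pair_rank_def left_act_def lmax_def DK_act_def)

lemma lower_left_act:
  assumes "x \<in> DK" "s \<in> S"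
  shows "lower pair_rank (left_act s) (x, y) = (lmin s x, y)"
proof (cases "s \<otimes> x \<in> DK")
  case True
  then show ?thesis using assms length_neq[of s x]
    by (auto simp: lower_def pair_rank_def left_act_def lmin_def DK_act_def)
next
  case False
  then have "l x < l (s \<otimes> x)" using min_rep_left_mult[OF KS assms] by blast
  then show ?thesis using False by (simp add: lower_def pair_rank_def left_act_def lmin_def DK_act_def)
qed

lemma raise_left_mono:
  assumes uv: "u \<in> DK" and xy: "x \<in> DK" "y \<in> DJ" and s: "s \<in> S"
    and le: "pair_le (u, v) (x, y)"
  shows "pair_le (raise pair_rank (left_act s) (u, v)) (raise pair_rank (left_act s) (x, y))"
proof -
  obtain w where w: "w \<in> WJ" "u \<preceq> x \<otimes> w" "y \<otimes> w \<preceq> v" using le by (auto simp: pair_le_def)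
  have cl: "u \<in> carrier W" "x \<in> carrier W" "w \<in> carrier W" using assms w by auto
  let ?u = "if s \<otimes> u \<in> DK then lmax s u else u"
  let ?x = "if s \<otimes> x \<in> DK then lmax s x else x"
  have u: "?u \<in> DK" using uv lmax_cases[of s u] by auto
  have "?u \<preceq> lmax s u" using lmax_lmin_bounds(1)[of s u] cl s by simp
  also have "lmax s u \<preceq> lmax s (x \<otimes> w)" using lmax_mono w s cl by simp
  finally have ux: "?u \<preceq> x \<otimes> w \<or> ?u \<preceq> s \<otimes> x \<otimes> w"
    using lmax_cases[of s "x \<otimes> w"] cl s by (auto simp: m_assoc)
  have "\<exists>w'\<in>WJ. w' \<preceq> w \<and> ?u \<preceq> ?x \<otimes> w'"
  proof (cases "s \<otimes> x \<in> DK")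
    case True
    then have xx: "x \<preceq> ?x" "s \<otimes> x \<preceq> ?x" "?x \<in> carrier W" using lmax_lmin_bounds[of s x] cl s by auto
    then obtain x' where x': "x' \<preceq> ?x" "?u \<preceq> x' \<otimes> w" using ux by blast
    then obtain w' where "w' \<preceq> w" "x' \<otimes> w \<preceq> ?x \<otimes> w'" using right_mult_le[of x' ?x w] xx cl by auto
    then show ?thesis using x' le_trans le_WJ(1)[OF w(1) _ one_DJ] by blast
  next
    case False
    then obtain k where k: "k \<in> K" "s \<otimes> x = x \<otimes> k" using min_rep_left_mult[OF KS xy(1) s] by blast
    then have "?u \<preceq> x \<otimes> w" using ux le_mod_K[OF u cl(2) K_WK[OF k(1)] w(1)] by auto
    then show ?thesis using False w(1) by (intro bexI[of _ w]) auto
  qed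
  then obtain w' where w': "w' \<in> WJ" "w' \<preceq> w" "?u \<preceq> ?x \<otimes> w'" by blast
  have "y \<otimes> w' \<preceq> v" using le_trans[OF le_WJ(2)[OF w(1) w'(2) xy(2)] w(3)] .
  then have "pair_le (?u, v) (?x, y)" using w' unfolding pair_le_def by auto
  then show ?thesis using raise_left_act[OF uv s] raise_left_act[OF xy(1) s] by simp
qed

lemma lower_left_mono:
  assumes uv: "u \<in> DK" and xy: "x \<in> DK" and s: "s \<in> S"
    and le: "pair_le (u, v) (x, y)"
  shows "pair_le (lower pair_rank (left_act s) (u, v)) (lower pair_rank (left_act s) (x, y))"
proof -
  obtain w where w: "w \<in> WJ" "u \<preceq> x \<otimes> w" "y \<otimes> w \<preceq> v" using le by (auto simp: pair_le_def)
  have cl: "u \<in> carrier W" "x \<in> carrier W" "w \<in> carrier W" using assms w by auto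
  have "lmin s u \<preceq> lmin s (x \<otimes> w)" using lmin_mono w s cl by simp
  also have "lmin s (x \<otimes> w) \<preceq> lmin s x \<otimes> w"
    using lmin_cases[of s x] lmax_lmin_bounds(3,4)[of s "x \<otimes> w"] cl s by (auto simp: m_assoc)
  finally show ?thesis using w lower_left_act uv xy s by (auto simp: pair_le_def)
qed

lemma pair_le_trans:
  assumes "\<theta> \<in> pairs" "\<sigma> \<in> pairs" "\<tau> \<in> pairs" "pair_le \<theta> \<sigma>" "pair_le \<sigma> \<tau>"
  shows "pair_le \<theta> \<tau>"
proof -
  obtain u v x y x2 y2 where eq: "\<theta> = (u, v)" "\<sigma> = (x, y)" "\<tau> = (x2, y2)" by (metis surj_pair)
  have mem: "u \<in> DK" "v \<in> DJ" "x \<in> DK" "y \<in> DJ" "x2 \<in> DK" "y2 \<in> DJ"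
    using assms eq by (auto simp: pairs_def)
  obtain w where w: "w \<in> WJ" "u \<preceq> x \<otimes> w" "y \<otimes> w \<preceq> v" using assms eq by (auto simp: pair_le_def)
  obtain w' where w': "w' \<in> WJ" "x \<preceq> x2 \<otimes> w'" "y2 \<otimes> w' \<preceq> y" using assms eq by (auto simp: pair_le_def)
  obtain w1 where w1: "w1 \<preceq> w" "x \<otimes> w \<preceq> x2 \<otimes> w' \<otimes> w1" 
    using right_mult_le[OF w'(2) m_closed[OF min_reps_closed[OF mem(5)] WJ_closed[OF w'(1)]] WJ_closed[OF w(1)]]
    by blast
  have w1J: "w1 \<in> WJ" "y \<otimes> w1 \<preceq> y \<otimes> w" using le_WJ w w1 mem by auto
  have "u \<preceq> x2 \<otimes> (w' \<otimes> w1)" using le_trans[OF w(2) w1(2)] mem w' w1J by (simp add: m_assoc)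
  moreover have "y2 \<otimes> (w' \<otimes> w1) \<preceq> v"
  proof -
    have "y2 \<otimes> w' \<otimes> w1 \<preceq> y \<otimes> w1" if "w1 \<in> WJ" for w1
      using that
    proof (induction "l w1" arbitrary: w1 rule: less_induct)
      case less
      show ?case
      proof (cases "w1 = \<one>")
        case True
        then show ?thesis using w' mem by simp
      next
        case False
        then obtain j where j: "j \<in> J" "l (w1 \<otimes> j) < l w1"
          using parabolic_right_descent[OF J_subset less.prems] by blast
        let ?v = "w1 \<otimes> j"
        have jS: "j \<in> S" "j \<in> carrier W" "w1 \<in> carrier W" using j less.prems by auto
        have "y2 \<otimes> w' \<otimes> ?v \<preceq> y \<otimes> ?v" using less j by simp
        then have "rmax (y2 \<otimes> w' \<otimes> ?v) j \<preceq> rmax (y \<otimes> ?v) j" using rmax_mono jS mem by simp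
        moreover have "rmax (y \<otimes> ?v) j = y \<otimes> w1"
          using length_min_rep_mult[OF J_subset mem(4)] less.prems j jS mem
          by (simp add: rmax_def m_assoc S_square)
        moreover have "y2 \<otimes> w' \<otimes> ?v \<otimes> j \<preceq> rmax (y2 \<otimes> w' \<otimes> ?v) j"
          using rmax_rmin_bounds(2) jS mem w' by simp
        moreover have "y2 \<otimes> w' \<otimes> ?v \<otimes> j = y2 \<otimes> w' \<otimes> w1"
          using jS mem w' by (simp add: m_assoc S_square)
        ultimately show ?thesis by (metis le_trans)
      qed
    qed
    then have "y2 \<otimes> w' \<otimes> w1 \<preceq> y \<otimes> w1" using w1J by blast
    then have "y2 \<otimes> w' \<otimes> w1 \<preceq> v" using le_trans[OF _ le_trans[OF w1J(2) w(3)]] by blast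
    then show ?thesis using mem w' w1J by (simp add: m_assoc)
  qed
  ultimately show ?thesis using w' w1J eq by (auto simp: pair_le_def)
qed

lemma pair_rank_less:
  assumes "\<theta> \<in> pairs" "\<sigma> \<in> pairs" "pair_le \<theta> \<sigma>" "\<theta> \<noteq> \<sigma>"
  shows "pair_rank \<theta> < pair_rank \<sigma>"
proof (rule ccontr)
  obtain u v x y where eq: "\<theta> = (u, v)" "\<sigma> = (x, y)" by (metis surj_pair)
  have mem: "u \<in> DK" "v \<in> DJ" "x \<in> DK" "y \<in> DJ" using assms eq by (auto simp: pairs_def)
  obtain w where w: "w \<in> WJ" "u \<preceq> x \<otimes> w" "y \<otimes> w \<preceq> v" using assms eq by (auto simp: pair_le_def)
  have len: "l u \<le> l (x \<otimes> w)" "l (x \<otimes> w) \<le> l x + l w" "l (y \<otimes> w) = l y + l w" "l (y \<otimes> w) \<le> l v"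
    using le_length[OF w(2)] le_length[OF w(3)] length_mult[OF min_reps_closed[OF mem(3)] WJ_closed[OF w(1)]]
      length_min_rep_mult[OF J_subset mem(4) w(1)] by simp_all
  assume "\<not> ?thesis"
  then have ge: "int (l x) - int (l y) \<le> int (l u) - int (l v)" using eq by (simp add: pair_rank_def)
  then have "u = x \<otimes> w" "y \<otimes> w = v" using le_length_eq w len by auto
  moreover have "w = \<one>" using min_rep_unique[OF J_subset mem(4) w(1)] calculation mem by simp
  ultimately show False using assms(4) eq mem by simp
qed

lemma pair_descent:
  assumes "\<theta> \<in> pairs" "\<sigma> \<in> pairs" "pair_le \<theta> \<sigma>" "\<theta> \<noteq> \<sigma>"
  shows "\<exists>s\<in>S. pair_rank (left_act s \<sigma>) < pair_rank \<sigma> \<or> pair_rank (right_act s \<sigma>) < pair_rank \<sigma>"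
proof (rule ccontr)
  assume neg: "\<not> ?thesis"
  obtain u v x y where eq: "\<theta> = (u, v)" "\<sigma> = (x, y)" by (metis surj_pair)
  have mem: "u \<in> DK" "v \<in> DJ" "x \<in> DK" "y \<in> DJ" using assms eq by (auto simp: pairs_def)
  have x: "x = \<one>"
  proof (rule ccontr)
    assume "x \<noteq> \<one>"
    then obtain s where s: "s \<in> S" "l (s \<otimes> x) < l x" using left_descent mem by (metis min_reps_closed)
    then have "s \<otimes> x \<in> DK" using min_rep_left_mult[OF KS mem(3) s(1)] by (metis less_asym)
    then have "pair_rank (left_act s \<sigma>) < pair_rank \<sigma>"
      using s eq by (simp add: pair_rank_def left_act_def DK_act_def)
    then show False using neg s by blast
  qed
  have top: "\<exists>w\<in>WJ. g \<preceq> y \<otimes> w" if "g \<in> carrier W" for g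
    using that
  proof (induction rule: left_induct)
    case one
    have "\<one> \<preceq> y"
    proof -
      have "y \<in> carrier W" using mem by simp
      then show ?thesis
        by (induction rule: left_induct) (rule le_refl, rule le_trans[OF _ le_S_mult])
    qed
    then show ?case using mem by (intro bexI[of _ \<one>]) (auto intro: generate.one)
  next
    case (mult s g)
    then obtain w where w: "w \<in> WJ" "g \<preceq> y \<otimes> w" by blast
    have yc: "y \<in> carrier W" "w \<in> carrier W" using mem w by auto
    have sg: "s \<otimes> g \<preceq> lmax s (y \<otimes> w)"
      using lmax_lmin_bounds(2)[of s g] lmax_mono[OF w(2) mult.hyps(1)] le_trans mult.hyps yc by blast
    from mem(3,4) mult.hyps(1) show ?case
    proof (cases rule: right_act_cases)
      case moves
      then have "\<not> l y < l (s \<otimes> y)" using neg eq mult.hyps by (auto simp: pair_rank_def)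
      then have "lmax s (y \<otimes> w) = y \<otimes> w"
        using left_mult_min_rep_less[of y w s] moves w mem mult.hyps by (simp add: lmax_def)
      then show ?thesis using sg w by auto
    next
      case (crosses j)
      then show ?thesis using min_mult(2)[of y w s j] sg w mem mult.hyps by auto
    qed
  qed
  obtain g where "g \<in> WJ" "v \<preceq> y \<otimes> g" using top mem by (metis min_reps_closed)
  then have vy: "v \<preceq> y" using min_rep_le_left[OF J_subset mem(2)] mem by simp
  obtain w where w: "w \<in> WJ" "u \<preceq> x \<otimes> w" "y \<otimes> w \<preceq> v" using assms eq by (auto simp: pair_le_def)
  have "l y + l w \<le> l v" "l v \<le> l y"
    using le_length w vy length_min_rep_mult[OF J_subset mem(4)] by fastforce+
  then have "w = \<one>" using length_eq_0[of w] w by simp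
  then have "y \<preceq> v" "u \<preceq> \<one>" using w x mem by auto
  then have "v = y" "u = \<one>" using vy le_antisym le_length[of u \<one>] length_eq_0[of u] mem by auto
  then show False using assms(4) eq x by simp
qed

definition act :: "bool \<times> 'a \<Rightarrow> 'a \<times> 'a \<Rightarrow> 'a \<times> 'a" where
  "act i = (if fst i then left_act (snd i) else right_act (snd i))"

lemma left_act_facts:
  assumes "x \<in> DK" "y \<in> DJ" "s \<in> S"
  shows "left_act s (x, y) \<in> pairs \<and> left_act s (left_act s (x, y)) = (x, y) \<and>
    (pair_rank (x, y) < pair_rank (left_act s (x, y)) \<longrightarrow>
      pair_le (x, y) (left_act s (x, y)) \<and> pair_rank (left_act s (x, y)) = pair_rank (x, y) + 1) \<and>
    (pair_rank (left_act s (x, y)) = pair_rank (x, y) \<longrightarrow> left_act s (x, y) = (x, y))"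
proof -
  have c: "x \<in> carrier W" "y \<in> carrier W" using assms by auto
  have "pair_le (x, y) (s \<otimes> x, y)" if "l x < l (s \<otimes> x)"
    using that le_S_mult[of s x] assms c by (auto simp: pair_le_def intro!: bexI[of _ \<one>] generate.one)
  moreover have "pair_rank (s \<otimes> x, y) = pair_rank (x, y) + 1 \<and> l x < l (s \<otimes> x) \<or>
      pair_rank (s \<otimes> x, y) < pair_rank (x, y)"
    using length_S_mult[OF assms(3) c(1)] unfolding pair_rank_def by auto
  ultimately show ?thesis using assms c by (auto simp: left_act_def DK_act_def pairs_def)
qed

lemma right_act_facts:
  assumes "x \<in> DK" "y \<in> DJ" "s \<in> S"
  shows "right_act s (x, y) \<in> pairs \<and> right_act s (right_act s (x, y)) = (x, y) \<and>
    (pair_rank (x, y) < pair_rank (right_act s (x, y)) \<longrightarrow>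
      pair_le (x, y) (right_act s (x, y)) \<and> pair_rank (right_act s (x, y)) = pair_rank (x, y) + 1) \<and>
    (pair_rank (right_act s (x, y)) = pair_rank (x, y) \<longrightarrow> right_act s (x, y) = (x, y))"
proof -
  have c: "x \<in> carrier W" "y \<in> carrier W" using assms by auto
  from assms show ?thesis
  proof (cases rule: right_act_cases)
    case moves
    have "right_act s (x, s \<otimes> y) = (x, y)" using assms c by (simp add: right_act_def)
    moreover have "pair_le (x, y) (x, s \<otimes> y)" if "l (s \<otimes> y) < l y"
      using that le_S_mult[of s "s \<otimes> y"] assms c
      by (auto simp: pair_le_def intro!: bexI[of _ \<one>] generate.one)
    moreover have "pair_rank (x, s \<otimes> y) = pair_rank (x, y) + 1 \<and> l (s \<otimes> y) < l y \<or>
        pair_rank (x, s \<otimes> y) < pair_rank (x, y)"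
      using length_S_mult[OF assms(3) c(2)] unfolding pair_rank_def by auto
    ultimately show ?thesis
      using assms(1) unfolding moves(2) by (auto simp: pairs_def moves(1))
  next
    case (crosses j)
    have jS: "j \<in> S" using crosses by simp
    have "inv y \<otimes> s \<otimes> y = j" using crosses assms c by (simp add: m_assoc)
    then have r: "right_act s (x', y) = (DK_act x' (x' \<otimes> j), y)" for x'
      using crosses by (simp add: right_act_def)
    have "DK_act (DK_act x (x \<otimes> j)) (DK_act x (x \<otimes> j) \<otimes> j) = x"
      using assms c jS by (auto simp: DK_act_def)
    moreover have "pair_le (x, y) (x \<otimes> j, y)" if "l x < l (x \<otimes> j)"
      using that rmax_rmin_bounds(1)[of j x] jS c
      by (auto simp: pair_le_def rmax_def intro!: bexI[of _ \<one>] generate.one)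
    moreover have "pair_rank (x \<otimes> j, y) = pair_rank (x, y) + 1 \<and> l x < l (x \<otimes> j) \<or>
        pair_rank (x \<otimes> j, y) < pair_rank (x, y)"
      using length_mult_S[OF jS c(1)] unfolding pair_rank_def by auto
    ultimately show ?thesis
      using assms(1,2) unfolding r by (auto simp: pairs_def DK_act_def)
  qed
qed

lemma involution_poset_pairs:
  assumes "finite (carrier W)"
  shows "involution_poset pairs pair_le pair_rank (UNIV \<times> S) act"
proof
  have "pairs \<subseteq> carrier W \<times> carrier W" by (auto simp: pairs_def)
  then show "finite pairs" using assms finite_subset by blast
next
  fix x assume "x \<in> pairs"
  then show "pair_le x x"
    by (auto simp: pair_le_def pairs_def intro!: bexI[of _ \<one>] generate.one)
next
  fix i :: "bool \<times> 'a" and x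
  assume i: "i \<in> UNIV \<times> S" "x \<in> pairs"
  obtain u v where x: "x = (u, v)" "u \<in> DK" "v \<in> DJ" using i by (auto simp: pairs_def)
  have s: "snd i \<in> S" using i by auto
  note facts = left_act_facts[OF x(2,3) s] right_act_facts[OF x(2,3) s]
  show "act i x \<in> pairs" "act i (act i x) = x" using facts x by (auto simp: act_def)
  show "pair_le x (act i x) \<and> pair_rank (act i x) = pair_rank x + 1"
    if "pair_rank x < pair_rank (act i x)" using that facts x by (auto simp: act_def split: if_splits)
  show "act i x = x" if "pair_rank (act i x) = pair_rank x"
    using that facts x by (auto simp: act_def split: if_splits)
  fix y assume y: "y \<in> pairs" "pair_le x y"
  obtain u' v' where y': "y = (u', v')" "u' \<in> DK" "v' \<in> DJ" using y by (auto simp: pairs_def)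
  show "pair_le (raise pair_rank (act i) x) (raise pair_rank (act i) y)"
    using raise_left_mono[of u u' v' _ v] raise_right_mono[of u v u' v'] x y y' s by (simp add: act_def)
  show "pair_le (lower pair_rank (act i) x) (lower pair_rank (act i) y)"
    using lower_left_mono[of u u' _ v v'] lower_right_mono[of u v u' v'] x y y' s by (simp add: act_def)
qed (use pair_le_trans pair_rank_less in blast)+

lemma pair_descent_act:
  assumes "\<theta> \<in> pairs" "\<sigma> \<in> pairs" "pair_le \<theta> \<sigma>" "\<theta> \<noteq> \<sigma>"
  shows "\<exists>i\<in>UNIV \<times> S. pair_rank (act i \<sigma>) < pair_rank \<sigma>"
proof -
  obtain s where "s \<in> S" "pair_rank (act (True, s) \<sigma>) < pair_rank \<sigma> \<or> pair_rank (act (False, s) \<sigma>) < pair_rank \<sigma>"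
    using pair_descent[OF assms] by (auto simp: act_def)
  then show ?thesis by auto
qed

end

section \<open>Groups with a BN-pair\<close>

context exchange_group
begin

lemma length_one_simple:
  assumes "w \<in> carrier W" "l w = 1"
  shows "w \<in> S"
proof -
  have "w \<noteq> \<one>" using assms(2) by auto
  then obtain s where s: "s \<in> S" "l (s \<otimes> w) < l w" using left_descent assms(1) by blast
  then have "s \<otimes> w = \<one>" using length_eq_0[of "s \<otimes> w"] assms by simp
  then have "s \<otimes> (s \<otimes> w) = s" using s by simp
  then show ?thesis using s assms(1) by simp
qed

text \<open>Every wall separates \<open>1\<close> from an element of maximal length.\<close>

lemma length_longest_quotient:
  assumes w0: "w0 \<in> carrier W" "\<And>w. w \<in> carrier W \<Longrightarrow> l w \<le> l w0" and w: "w \<in> carrier W"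
  shows "l w + l (w \<otimes> w0) = l w0"
  using w
proof (induction rule: left_induct)
  case (mult s w)
  have c: "w \<in> carrier W" "s \<in> S" "s \<in> carrier W" using mult.hyps by auto
  let ?t = "inv w \<otimes> s \<otimes> inv (inv w)"
  have "l (?t \<otimes> w0) < l w0"
    using reflection_length_neq[of "inv w" s w0] w0(2)[of "?t \<otimes> w0"] w0(1) c by simp
  then have "separates (inv w) s w0" using separates_iff[of "inv w" s w0] w0 c by simp
  then have "l (s \<otimes> (w \<otimes> w0)) < l (w \<otimes> w0)"
    using mult.hyps c w0(1) length_neq[of s "w \<otimes> w0"] by (auto simp: separates_def m_assoc)
  then show ?case
    using mult.IH mult.hyps(3) length_S_mult[of s w] length_S_mult[of s "w \<otimes> w0"] c w0(1)
    by (auto simp: m_assoc)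
qed (simp add: w0(1))

lemma longest_conjugates_simple:
  assumes w0: "w0 \<in> carrier W" "\<And>w. w \<in> carrier W \<Longrightarrow> l w \<le> l w0" and s: "s \<in> S"
  shows "w0 \<otimes> s \<otimes> inv w0 \<in> S"
proof (rule length_one_simple)
  have c: "s \<in> carrier W" using s by simp
  have "l (w0 \<otimes> s) + 1 = l w0"
    using length_mult_S[of s w0] w0(2)[of "w0 \<otimes> s"] w0(1) s c by auto
  moreover have "l (w0 \<otimes> s \<otimes> inv w0) + l (w0 \<otimes> s \<otimes> inv w0 \<otimes> w0) = l w0"
    using w0 c by (intro length_longest_quotient) auto
  moreover have "w0 \<otimes> s \<otimes> inv w0 \<otimes> w0 = w0 \<otimes> s" using w0 c by (simp add: m_assoc)
  ultimately show "l (w0 \<otimes> s \<otimes> inv w0) = 1" by simp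
qed (use assms in auto)

lemma parabolic_conjugate:
  assumes "c \<in> carrier W" "I \<subseteq> S" "\<And>s. s \<in> I \<Longrightarrow> c \<otimes> s \<otimes> inv c \<in> J" "w \<in> generate W I"
  shows "c \<otimes> w \<otimes> inv c \<in> generate W J"
  using assms(4)
proof induction
  case one
  then show ?case using assms(1) generate.one by simp
next
  case (incl h)
  then show ?case by (intro generate.incl assms(3))
next
  case (inv h)
  then have "inv h = h" using assms(2) by auto
  then show ?case using generate.incl[OF assms(3)[OF inv]] by simp
next
  case (eng g h)
  have gh: "g \<in> carrier W" "h \<in> carrier W" using parabolic_closed[OF assms(2)] eng.hyps by auto
  have "c \<otimes> (g \<otimes> h) \<otimes> inv c = (c \<otimes> g \<otimes> inv c) \<otimes> (c \<otimes> h \<otimes> inv c)"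
    using gh assms(1) by (simp add: m_assoc)
  then show ?case using generate.eng[OF eng.IH] by simp
qed

end

lemma (in group) mem_conjugate: "y \<in> g <# K #> inv g \<longleftrightarrow> (\<exists>x\<in>K. y = g \<otimes> x \<otimes> inv g)"
  unfolding l_coset_def r_coset_def by auto

lemma (in group) conjugate_subgroup:
  assumes K: "subgroup K G" and g: "g \<in> carrier G"
  shows "subgroup (g <# K #> inv g) G"
proof (rule subgroupI)
  have KG: "x \<in> carrier G" if "x \<in> K" for x using that subgroup.mem_carrier[OF K] by blast
  show "g <# K #> inv g \<subseteq> carrier G" using KG g by (auto simp: mem_conjugate)
  show "g <# K #> inv g \<noteq> {}" using subgroup.one_closed[OF K] mem_conjugate by blast
  fix a assume "a \<in> g <# K #> inv g"
  then obtain x where x: "x \<in> K" "a = g \<otimes> x \<otimes> inv g" using mem_conjugate by blast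
  have "inv a = g \<otimes> inv x \<otimes> inv g" using x g KG[OF x(1)] by (simp add: inv_mult_group m_assoc)
  then show "inv a \<in> g <# K #> inv g" using subgroup.m_inv_closed[OF K x(1)] mem_conjugate by blast
  fix b assume "b \<in> g <# K #> inv g"
  then obtain y where y: "y \<in> K" "b = g \<otimes> y \<otimes> inv g" using mem_conjugate by blast
  have "inv g \<otimes> (g \<otimes> z) = z" if "z \<in> carrier G" for z using that g by (simp flip: m_assoc)
  then have "a \<otimes> b = g \<otimes> (x \<otimes> y) \<otimes> inv g" using x y g KG[OF x(1)] KG[OF y(1)] by (simp add: m_assoc)
  then show "a \<otimes> b \<in> g <# K #> inv g" using subgroup.m_closed[OF K x(1) y(1)] mem_conjugate by blast
qed

context BN_pair
begin

abbreviation "T \<equiv> B \<inter> N"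
abbreviation "Wl \<equiv> weyl_group G B N"
abbreviation wmult (infixl "\<odot>" 70) where "wmult \<equiv> monoid.mult (weyl_group G B N)"
abbreviation "wlen \<equiv> word_length (weyl_group G B N) S"

definition proj :: "'a \<Rightarrow> 'a set" where "proj n = T #> n"

lemma N_closed [simp]: "n \<in> N \<Longrightarrow> n \<in> carrier G"
  and B_closed [simp]: "b \<in> B \<Longrightarrow> b \<in> carrier G"
  using N_subgroup B_subgroup by (auto dest: subgroup.mem_carrier)

lemma B_mult [simp]: "\<lbrakk>b \<in> B; c \<in> B\<rbrakk> \<Longrightarrow> b \<otimes> c \<in> B"
  and N_mult [simp]: "\<lbrakk>n \<in> N; m \<in> N\<rbrakk> \<Longrightarrow> n \<otimes> m \<in> N"
  and B_inv [simp]: "b \<in> B \<Longrightarrow> inv b \<in> B"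
  and N_inv [simp]: "n \<in> N \<Longrightarrow> inv n \<in> N"
  and B_one [simp]: "\<one> \<in> B"
  and N_one [simp]: "\<one> \<in> N"
  using N_subgroup B_subgroup by (auto simp: subgroup_def)

lemma cancel_left [simp]: "\<lbrakk>x \<in> carrier G; y \<in> carrier G\<rbrakk> \<Longrightarrow> inv x \<otimes> (x \<otimes> y) = y"
  and cancel_left' [simp]: "\<lbrakk>x \<in> carrier G; y \<in> carrier G\<rbrakk> \<Longrightarrow> x \<otimes> (inv x \<otimes> y) = y"
  by (simp_all flip: m_assoc)

lemma T_conj: "\<lbrakk>n \<in> N; t \<in> B; t \<in> N\<rbrakk> \<Longrightarrow> n \<otimes> t \<otimes> inv n \<in> B"
  using normal.inv_op_closed2[OF T_normal, of n t] m_inv_consistent[OF N_subgroup, of n] by simp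

lemma Wl_group: "group Wl"
  unfolding weyl_group_def by (rule normal.factorgroup_is_group[OF T_normal])

lemma Wl_carrier: "carrier Wl = proj ` N"
  unfolding weyl_group_def FactGroup_def RCOSETS_def proj_def r_coset_def by auto

lemma Wl_mult: "x \<odot> y = x <#> y"
  unfolding weyl_group_def FactGroup_def set_mult_def by simp

lemma Wl_one: "\<one>\<^bsub>Wl\<^esub> = T"
  unfolding weyl_group_def FactGroup_def by simp

lemma proj_closed [simp]: "n \<in> N \<Longrightarrow> proj n \<in> carrier Wl"
  unfolding Wl_carrier by blast

lemma mem_proj: "m \<in> proj n \<longleftrightarrow> (\<exists>t\<in>T. m = t \<otimes> n)"
  unfolding proj_def r_coset_def by auto

lemma proj_mult: "\<lbrakk>n \<in> N; m \<in> N\<rbrakk> \<Longrightarrow> proj (n \<otimes> m) = proj n \<odot> proj m"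
  using normal.rcos_sum[OF T_normal, of n m]
  unfolding Wl_mult proj_def r_coset_def set_mult_def by simp

lemma proj_eq_iff:
  assumes "n \<in> N" "m \<in> N"
  shows "proj n = proj m \<longleftrightarrow> (\<exists>t\<in>T. n = t \<otimes> m)"
proof
  assume "proj n = proj m"
  moreover have "n \<in> proj n" using assms mem_proj[of n n] by force
  ultimately show "\<exists>t\<in>T. n = t \<otimes> m" using mem_proj by blast
next
  assume "\<exists>t\<in>T. n = t \<otimes> m"
  then obtain t where t: "t \<in> T" "n = t \<otimes> m" by blast
  have "x \<in> proj n \<longleftrightarrow> x \<in> proj m" for x
  proof
    assume "x \<in> proj n"
    then obtain r where "r \<in> T" "x = r \<otimes> n" using mem_proj by blast
    then have "x = (r \<otimes> t) \<otimes> m" "r \<otimes> t \<in> T" using t assms by (auto simp: m_assoc)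
    then show "x \<in> proj m" using mem_proj by blast
  next
    assume "x \<in> proj m"
    then obtain r where "r \<in> T" "x = r \<otimes> m" using mem_proj by blast
    then have "x = (r \<otimes> inv t) \<otimes> n" "r \<otimes> inv t \<in> T" using t assms by (auto simp: m_assoc)
    then show "x \<in> proj n" using mem_proj by blast
  qed
  then show "proj n = proj m" by blast
qed

lemma proj_eq_one_iff: "n \<in> N \<Longrightarrow> proj n = \<one>\<^bsub>Wl\<^esub> \<longleftrightarrow> n \<in> B"
proof -
  assume n: "n \<in> N"
  have "proj \<one> = T" unfolding proj_def r_coset_def by force
  then show ?thesis using proj_eq_iff[OF n N_one] n Wl_one by auto
qed

lemma mem_Wl: "w \<in> carrier Wl \<Longrightarrow> n \<in> w \<longleftrightarrow> n \<in> N \<and> proj n = w"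
proof -
  assume "w \<in> carrier Wl"
  then obtain m where m: "m \<in> N" "w = proj m" unfolding Wl_carrier by blast
  have "n \<in> N" if "\<exists>t\<in>T. n = t \<otimes> m" using that m(1) by auto
  then show ?thesis unfolding m(2) mem_proj using proj_eq_iff[OF _ m(1)] by blast
qed

lemma Wl_rep:
  assumes "w \<in> carrier Wl"
  obtains n where "n \<in> N" "proj n = w"
  using assms unfolding Wl_carrier by blast

lemma proj_inv: "n \<in> N \<Longrightarrow> proj (inv n) = inv\<^bsub>Wl\<^esub> proj n"
proof -
  assume n: "n \<in> N"
  interpret W: group Wl by (rule Wl_group)
  have "proj (inv n) \<odot> proj n = \<one>\<^bsub>Wl\<^esub>"
    using n proj_mult[of "inv n" n] proj_eq_one_iff[of \<one>] by simp
  then show ?thesis using W.inv_equality n by simp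
qed

lemma Wl_involution_generated: "involution_generated_group Wl S"
proof -
  interpret W: group Wl by (rule Wl_group)
  show ?thesis
    by unfold_locales (use S_subset S_generates S_order_2 in \<open>auto simp: Wl_mult Wl_one\<close>)
qed

lemma S_not_one: "s \<in> S \<Longrightarrow> s \<noteq> \<one>\<^bsub>Wl\<^esub>"
  using S_order_2 Wl_one by simp

definition dcoset :: "'a set \<Rightarrow> 'a set" where
  "dcoset w = {b \<otimes> n \<otimes> c | b n c. b \<in> B \<and> n \<in> N \<and> proj n = w \<and> c \<in> B}"

lemma dcosetI: "\<lbrakk>b \<in> B; n \<in> N; proj n = w; c \<in> B\<rbrakk> \<Longrightarrow> b \<otimes> n \<otimes> c \<in> dcoset w"
  unfolding dcoset_def by blast

lemma dcosetE:
  assumes "x \<in> dcoset w"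
  obtains b n c where "b \<in> B" "n \<in> N" "proj n = w" "c \<in> B" "x = b \<otimes> n \<otimes> c"
  using assms unfolding dcoset_def by blast

lemma dcoset_rep: "n \<in> N \<Longrightarrow> n \<in> dcoset (proj n)"
  using dcosetI[of \<one> n "proj n" \<one>] by simp

lemma dcoset_closed: "x \<in> dcoset w \<Longrightarrow> x \<in> carrier G"
  by (auto elim!: dcosetE)

lemma dcoset_B_left: "\<lbrakk>b \<in> B; x \<in> dcoset w\<rbrakk> \<Longrightarrow> b \<otimes> x \<in> dcoset w"
proof -
  assume b: "b \<in> B" and "x \<in> dcoset w"
  then obtain a n c where x: "a \<in> B" "n \<in> N" "proj n = w" "c \<in> B" "x = a \<otimes> n \<otimes> c" by (elim dcosetE)
  then have "b \<otimes> x = (b \<otimes> a) \<otimes> n \<otimes> c" using b by (simp add: m_assoc)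
  then show ?thesis using dcosetI[of "b \<otimes> a" n w c] x b by simp
qed

lemma dcoset_B_right: "\<lbrakk>b \<in> B; x \<in> dcoset w\<rbrakk> \<Longrightarrow> x \<otimes> b \<in> dcoset w"
proof -
  assume b: "b \<in> B" and "x \<in> dcoset w"
  then obtain a n c where x: "a \<in> B" "n \<in> N" "proj n = w" "c \<in> B" "x = a \<otimes> n \<otimes> c" by (elim dcosetE)
  then have "x \<otimes> b = a \<otimes> n \<otimes> (c \<otimes> b)" using b by (simp add: m_assoc)
  then show ?thesis using dcosetI[of a n w "c \<otimes> b"] x b by simp
qed

lemma dcoset_inv: "x \<in> dcoset w \<Longrightarrow> inv x \<in> dcoset (inv\<^bsub>Wl\<^esub> w)"
proof -
  assume "x \<in> dcoset w"
  then obtain a n c where x: "a \<in> B" "n \<in> N" "proj n = w" "c \<in> B" "x = a \<otimes> n \<otimes> c" by (elim dcosetE)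
  then have "inv x = inv c \<otimes> inv n \<otimes> inv a" by (simp add: inv_mult_group m_assoc)
  then show ?thesis using dcosetI[of "inv c" "inv n" "inv\<^bsub>Wl\<^esub> w" "inv a"] x proj_inv[of n] by simp
qed

lemma dcoset_one: "dcoset \<one>\<^bsub>Wl\<^esub> = B"
proof
  show "dcoset \<one>\<^bsub>Wl\<^esub> \<subseteq> B" using proj_eq_one_iff by (auto elim!: dcosetE)
  show "B \<subseteq> dcoset \<one>\<^bsub>Wl\<^esub>"
  proof
    fix b assume "b \<in> B"
    then show "b \<in> dcoset \<one>\<^bsub>Wl\<^esub>" using dcosetI[of b \<one> "\<one>\<^bsub>Wl\<^esub>" \<one>] proj_eq_one_iff[of \<one>] by simp
  qed
qed

lemma mult_dcoset:
  assumes "m \<in> N" "proj m \<in> S" "x \<in> dcoset w" "w \<in> carrier Wl"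
  shows "m \<otimes> x \<in> dcoset w \<union> dcoset (proj m \<odot> w)"
proof -
  interpret W: group Wl by (rule Wl_group)
  obtain b n c where x: "b \<in> B" "n \<in> N" "proj n = w" "c \<in> B" "x = b \<otimes> n \<otimes> c"
    using assms(3) by (elim dcosetE)
  have "m \<in> proj m" "n \<in> w" using mem_Wl[of "proj m" m] mem_Wl[OF assms(4)] assms x by auto
  then have "m \<otimes> b \<otimes> n \<in> proj m <#> B <#> w" using x(1) unfolding set_mult_def by blast
  then have "m \<otimes> b \<otimes> n \<in> (B <#> w <#> B) \<union> (B <#> (proj m \<odot> w) <#> B)"
    using double_cosets[OF assms(2,4)] unfolding Wl_mult by blast
  moreover have "B <#> v <#> B = dcoset v" if "v \<in> carrier Wl" for v
    unfolding set_mult_def dcoset_def using mem_Wl[OF that] by fast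
  moreover have "proj m \<odot> w \<in> carrier Wl" using assms by simp
  ultimately have "m \<otimes> b \<otimes> n \<in> dcoset w \<union> dcoset (proj m \<odot> w)" using assms(4) by simp
  then have "m \<otimes> b \<otimes> n \<otimes> c \<in> dcoset w \<union> dcoset (proj m \<odot> w)" using dcoset_B_right x(4) by blast
  then show ?thesis using x assms(1) by (simp add: m_assoc)
qed

lemma dcoset_mult:
  assumes "m \<in> N" "proj m \<in> S" "x \<in> dcoset w" "w \<in> carrier Wl"
  shows "x \<otimes> m \<in> dcoset w \<union> dcoset (w \<odot> proj m)"
proof -
  interpret W: involution_generated_group Wl S by (rule Wl_involution_generated)
  have c: "x \<in> carrier G" using assms(3) dcoset_closed by blast
  have "proj (inv m) = proj m" using proj_inv assms by simp
  then have "inv m \<otimes> inv x \<in> dcoset (inv\<^bsub>Wl\<^esub> w) \<union> dcoset (proj m \<odot> inv\<^bsub>Wl\<^esub> w)"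
    using mult_dcoset[of "inv m" "inv x" "inv\<^bsub>Wl\<^esub> w"] dcoset_inv assms by simp
  then have "inv (inv m \<otimes> inv x) \<in> dcoset w \<union> dcoset (w \<odot> proj m)"
    using dcoset_inv[of "inv m \<otimes> inv x" "inv\<^bsub>Wl\<^esub> w"] dcoset_inv[of "inv m \<otimes> inv x" "proj m \<odot> inv\<^bsub>Wl\<^esub> w"] assms
    by (auto simp: W.inv_mult_group)
  then show ?thesis using assms(1) c by (simp add: inv_mult_group)
qed

lemma dcoset_unique_aux:
  assumes "w \<in> carrier Wl"
  shows "\<lbrakk>v \<in> carrier Wl; wlen w \<le> wlen v; x \<in> dcoset w; x \<in> dcoset v\<rbrakk> \<Longrightarrow> w = v"
  using assms
proof (induction "wlen w" arbitrary: w v x rule: less_induct)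
  case less
  interpret W: involution_generated_group Wl S by (rule Wl_involution_generated)
  show ?case
  proof (cases "w = \<one>\<^bsub>Wl\<^esub>")
    case True
    then have x: "x \<in> B" using less.prems dcoset_one by simp
    obtain b n c where n: "b \<in> B" "n \<in> N" "proj n = v" "c \<in> B" "x = b \<otimes> n \<otimes> c"
      using less.prems(4) by (elim dcosetE)
    then have "n = inv b \<otimes> x \<otimes> inv c" by (simp add: m_assoc)
    then have "n \<in> B" using n(1,4) x by (metis B_inv B_mult)
    then show ?thesis using True n(3) proj_eq_one_iff[OF n(2)] by simp
  next
    case False
    then obtain s where s: "s \<in> S" "wlen (s \<odot> w) < wlen w" using W.left_descent less.prems by blast
    let ?w = "s \<odot> w"
    obtain m where m: "m \<in> N" "proj m = s" using Wl_rep s S_subset by blast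
    obtain b n c where n: "b \<in> B" "n \<in> N" "proj n = w" "c \<in> B" "x = b \<otimes> n \<otimes> c"
      using less.prems(3) by (elim dcosetE)
    have "n = inv b \<otimes> x \<otimes> inv c" using n by (simp add: m_assoc)
    then have "n \<in> dcoset v"
      using dcoset_B_right[OF B_inv[OF n(4)] dcoset_B_left[OF B_inv[OF n(1)] less.prems(4)]] by simp
    then have "m \<otimes> n \<in> dcoset v \<union> dcoset (s \<odot> v)" using mult_dcoset m s less.prems by blast
    moreover have "m \<otimes> n \<in> dcoset ?w" using dcoset_rep[of "m \<otimes> n"] m n proj_mult by simp
    moreover have "wlen ?w \<le> wlen v" "wlen ?w \<le> wlen (s \<odot> v)"
      using s less.prems W.length_S_mult_le[of s "s \<odot> v"] by auto
    ultimately consider "?w = v" | "?w = s \<odot> v"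
      using less.hyps[OF s(2), of v] less.hyps[OF s(2), of "s \<odot> v"] s less.prems by auto
    then show ?thesis
    proof cases
      case 1
      then show ?thesis using s less.prems by simp
    next
      case 2
      then show ?thesis using s less.prems by simp
    qed
  qed
qed

lemma dcoset_unique:
  assumes "x \<in> dcoset w" "x \<in> dcoset v" "w \<in> carrier Wl" "v \<in> carrier Wl"
  shows "w = v"
  using dcoset_unique_aux[of w v x] dcoset_unique_aux[of v w x] assms by (cases "wlen w \<le> wlen v") auto

lemma S_mult_neq: "\<lbrakk>s \<in> S; w \<in> carrier Wl\<rbrakk> \<Longrightarrow> s \<odot> w \<noteq> w"
proof
  interpret W: involution_generated_group Wl S by (rule Wl_involution_generated)
  assume "s \<in> S" "w \<in> carrier Wl" "s \<odot> w = w"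
  then have "s = \<one>\<^bsub>Wl\<^esub>" using W.r_cancel_one by auto
  then show False using S_not_one \<open>s \<in> S\<close> by simp
qed

lemma dcoset_ascend:
  assumes "m \<in> N" "proj m \<in> S" "b \<in> B" "n \<in> N" "wlen (proj n) \<le> wlen (proj (m \<otimes> n))"
  shows "m \<otimes> b \<otimes> n \<in> dcoset (proj (m \<otimes> n))"
  using assms(4,5)
proof (induction "wlen (proj n)" arbitrary: n rule: less_induct)
  case less
  interpret W: involution_generated_group Wl S by (rule Wl_involution_generated)
  let ?w = "proj n" and ?s = "proj m"
  have w: "?w \<in> carrier Wl" using less.prems by simp
  have "b \<otimes> n \<in> dcoset ?w" using dcoset_B_left dcoset_rep assms(3) less.prems by simp
  then have "m \<otimes> (b \<otimes> n) \<in> dcoset ?w \<union> dcoset (?s \<odot> ?w)" using mult_dcoset assms w by blast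
  then have alt: "m \<otimes> b \<otimes> n \<in> dcoset ?w \<or> m \<otimes> b \<otimes> n \<in> dcoset (proj (m \<otimes> n))"
    using assms less.prems proj_mult by (auto simp: m_assoc)
  have "m \<otimes> b \<otimes> n \<notin> dcoset ?w"
  proof
    assume mem: "m \<otimes> b \<otimes> n \<in> dcoset ?w"
    show False
    proof (cases "?w = \<one>\<^bsub>Wl\<^esub>")
      case True
      then have nB: "n \<in> B" using proj_eq_one_iff less.prems by simp
      have "m = m \<otimes> b \<otimes> n \<otimes> inv n \<otimes> inv b" using assms less.prems by (simp add: m_assoc)
      moreover have "m \<otimes> b \<otimes> n \<in> B" using mem True dcoset_one by simp
      ultimately have "m \<in> B" using nB assms(3) by (metis B_inv B_mult)
      then show False using S_not_one[OF assms(2)] proj_eq_one_iff assms(1) by simp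
    next
      case False
      then obtain r where r: "r \<in> S" "wlen (?w \<odot> r) < wlen ?w" using W.right_descent w by blast
      obtain k where k: "k \<in> N" "proj k = r" using Wl_rep r S_subset by blast
      let ?n = "n \<otimes> inv k"
      have kinv: "proj (inv k) = r" using proj_inv k r by simp
      have n': "?n \<in> N" "proj ?n = ?w \<odot> r" using k kinv less.prems proj_mult by auto
      have "proj (m \<otimes> n) = proj (m \<otimes> ?n) \<odot> r"
        using proj_mult[of "m \<otimes> ?n" k] k less.prems assms(1) by (simp add: m_assoc)
      then have "wlen (proj (m \<otimes> n)) \<le> wlen (proj (m \<otimes> ?n)) + 1"
        using W.length_mult_S_le[OF r(1), of "proj (m \<otimes> ?n)"] n' assms(1) by simp
      then have "m \<otimes> b \<otimes> ?n \<in> dcoset (proj (m \<otimes> ?n))"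
        using less.hyps[of ?n] r n' less.prems by simp
      moreover have "m \<otimes> b \<otimes> n \<otimes> inv k \<in> dcoset ?w \<union> dcoset (?w \<odot> r)"
        using dcoset_mult[of "inv k", OF _ _ mem w] k kinv r by simp
      moreover have "m \<otimes> b \<otimes> n \<otimes> inv k = m \<otimes> b \<otimes> ?n" using assms less.prems k by (simp add: m_assoc)
      ultimately have "proj (m \<otimes> ?n) = ?w \<or> proj (m \<otimes> ?n) = proj ?n"
        using dcoset_unique[of "m \<otimes> b \<otimes> ?n" "proj (m \<otimes> ?n)"] n' w assms(1) by (metis N_mult Un_iff proj_closed)
      moreover have "proj (m \<otimes> ?n) = ?s \<odot> proj ?n" using proj_mult assms(1) n' by simp
      ultimately have "?w = ?s \<odot> proj ?n" 
        using S_mult_neq[OF assms(2) proj_closed[OF n'(1)]] by metis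
      then have "?s \<odot> ?w = proj ?n" using W.S_cancel_left[OF assms(2) proj_closed[OF n'(1)]] by metis
      then have "proj (m \<otimes> n) = proj ?n" using proj_mult assms(1) less.prems by simp
      then show False using less.prems(2) r n' by simp
    qed
  qed
  then show ?case using alt by blast
qed

lemma dcoset_descend:
  assumes "s \<in> S" "n \<in> N" "wlen (s \<odot> proj n) \<le> wlen (proj n)"
  obtains m b where "m \<in> N" "proj m = s" "b \<in> B" "m \<otimes> b \<otimes> n \<in> dcoset (proj n)"
proof -
  interpret W: involution_generated_group Wl S by (rule Wl_involution_generated)
  have sW: "s \<in> carrier Wl" using assms S_subset by blast
  obtain y where y: "y \<in> s <#> B <#> s" "y \<notin> B" using not_normalizing[OF assms(1)] by blast
  then obtain m b k where m: "m \<in> N" "proj m = s" "b \<in> B" "k \<in> N" "proj k = s" "y = m \<otimes> b \<otimes> k"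
    using mem_Wl[OF sW] unfolding set_mult_def by blast
  have "m \<otimes> (b \<otimes> k) \<in> dcoset s \<union> dcoset (s \<odot> s)"
    using mult_dcoset[of m "b \<otimes> k" s] dcoset_B_left[of b k s] dcoset_rep[of k] m assms(1) sW by simp
  then have "y \<in> dcoset s" using y m W.S_square[OF assms(1)] dcoset_one by (simp add: m_assoc)
  then obtain b1 m2 b2 where y': "b1 \<in> B" "m2 \<in> N" "proj m2 = s" "b2 \<in> B" "y = b1 \<otimes> m2 \<otimes> b2"
    by (elim dcosetE)
  let ?n = "inv k \<otimes> n"
  have n: "?n \<in> N" "proj ?n = s \<odot> proj n" using proj_mult proj_inv m assms by auto
  then have mn: "proj (m2 \<otimes> ?n) = proj n" using proj_mult[of m2 ?n] y' assms W.S_cancel_left by simp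
  have "m2 \<otimes> b2 \<otimes> ?n \<in> dcoset (proj n)"
    using dcoset_ascend[of m2 b2 ?n] y' n mn assms by simp
  then have "b1 \<otimes> (m2 \<otimes> b2 \<otimes> ?n) \<in> dcoset (proj n)" using dcoset_B_left y' by blast
  moreover have "b1 \<otimes> (m2 \<otimes> b2 \<otimes> ?n) = y \<otimes> ?n" using y' m assms by (simp add: m_assoc)
  moreover have "y \<otimes> ?n = m \<otimes> b \<otimes> n" using m assms by (simp add: m_assoc)
  ultimately show thesis using that m by simp
qed

theorem Wl_exchange_group: "exchange_group Wl S"
proof -
  interpret W: involution_generated_group Wl S by (rule Wl_involution_generated)
  show ?thesis
  proof
    fix s w assume s: "s \<in> S" and w: "w \<in> carrier Wl"
    obtain n where n: "n \<in> N" "proj n = w" using Wl_rep w by blast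
    show "wlen (s \<odot> w) \<noteq> wlen w"
    proof
      assume eq: "wlen (s \<odot> w) = wlen w"
      then obtain m b where m: "m \<in> N" "proj m = s" "b \<in> B" "m \<otimes> b \<otimes> n \<in> dcoset w"
        using dcoset_descend[of s n] s n by auto
      then have mn: "proj (m \<otimes> n) = s \<odot> w" using proj_mult n by simp
      then have "m \<otimes> b \<otimes> n \<in> dcoset (s \<odot> w)" using dcoset_ascend[of m b n] m n s eq by simp
      then have "s \<odot> w = w" using dcoset_unique m(4) w s by (meson W.S_closed W.m_closed)
      then show False using S_mult_neq s w by blast
    qed
  next
    fix s r w assume s: "s \<in> S" and r: "r \<in> S" and w: "w \<in> carrier Wl"
      and up: "wlen w < wlen (s \<odot> w)"
      and down: "wlen (s \<odot> w \<odot> r) < wlen (w \<odot> r)"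
    obtain n where n: "n \<in> N" "proj n = w" using Wl_rep w by blast
    obtain k where k: "k \<in> N" "proj k = r" using Wl_rep r S_subset by blast
    let ?v = "w \<odot> r"
    have sr: "s \<in> carrier Wl" "r \<in> carrier Wl" "?v \<in> carrier Wl" using s r w by auto
    have v: "proj (n \<otimes> k) = ?v" using n k proj_mult by simp
    obtain m b where m: "m \<in> N" "proj m = s" "b \<in> B" "m \<otimes> b \<otimes> (n \<otimes> k) \<in> dcoset ?v"
      using dcoset_descend[of s "n \<otimes> k"] s n k v down w sr by (auto simp: W.m_assoc)
    have "proj (m \<otimes> n) = s \<odot> w" using proj_mult m n by simp
    then have "m \<otimes> b \<otimes> n \<in> dcoset (s \<odot> w)" using dcoset_ascend[of m b n] m n s up by simp
    then have "m \<otimes> b \<otimes> n \<otimes> k \<in> dcoset (s \<odot> w) \<union> dcoset (s \<odot> w \<odot> r)"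
      using dcoset_mult[of k "m \<otimes> b \<otimes> n" "s \<odot> w"] k r w sr by simp
    moreover have "m \<otimes> b \<otimes> n \<otimes> k = m \<otimes> b \<otimes> (n \<otimes> k)" using m n k by (simp add: m_assoc)
    ultimately have "?v = s \<odot> w \<or> ?v = s \<odot> w \<odot> r"
      using dcoset_unique[OF m(4) _ sr(3)] sr w by (metis Un_iff W.m_closed)
    moreover have "?v \<noteq> s \<odot> w \<odot> r"
      using S_mult_neq[OF s sr(3)] sr w by (simp add: W.m_assoc)
    ultimately show "s \<odot> w = ?v" by simp
  qed
qed

definition parabolic :: "'a set set \<Rightarrow> 'a set" where
  "parabolic I = generate G (B \<union> \<Union>I)"

lemma mem_simple: "\<lbrakk>s \<in> S; n \<in> s\<rbrakk> \<Longrightarrow> n \<in> N \<and> proj n = s"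
  using mem_Wl[of s n] S_subset by blast

lemma parabolic_generators: "I \<subseteq> S \<Longrightarrow> B \<union> \<Union>I \<subseteq> carrier G"
  using mem_simple by force

lemma parabolic_subgroup: "I \<subseteq> S \<Longrightarrow> subgroup (parabolic I) G"
  unfolding parabolic_def using generate_is_subgroup parabolic_generators by blast

lemma B_parabolic: "B \<subseteq> parabolic I"
  unfolding parabolic_def by (auto intro: generate.incl)

lemma parabolic_dcoset:
  assumes I: "I \<subseteq> S" and g: "g \<in> parabolic I"
  shows "\<exists>w\<in>generate Wl I. g \<in> dcoset w"
proof -
  interpret W: exchange_group Wl S by (rule Wl_exchange_group)
  let ?Q = "\<Union>w\<in>generate Wl I. dcoset w"
  have mult: "m \<otimes> x \<in> ?Q" if mx: "m \<in> N" "proj m \<in> I" "x \<in> ?Q" for m x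
  proof -
    obtain w where w: "w \<in> generate Wl I" "x \<in> dcoset w" using mx(3) by blast
    have "m \<otimes> x \<in> dcoset w \<union> dcoset (proj m \<odot> w)"
      using mult_dcoset[OF mx(1) _ w(2)] W.parabolic_closed[OF I w(1)] mx(2) I by blast
    moreover have "proj m \<odot> w \<in> generate Wl I"
      using generate.eng[OF generate.incl[OF mx(2)] w(1)] .
    ultimately show ?thesis using w(1) by blast
  qed
  have "g \<otimes> x \<in> ?Q" if "x \<in> ?Q" for x
    using g that unfolding parabolic_def
  proof (induction arbitrary: x)
    case one
    then show ?case using dcoset_closed by auto
  next
    case (incl h)
    then show ?case
    proof (cases "h \<in> B")
      case False
      then obtain s where "s \<in> I" "h \<in> s" using incl.hyps by blast
      then show ?thesis using mem_simple[of s h] I mult incl.prems by blast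
    qed (use dcoset_B_left in blast)
  next
    case (inv h)
    then show ?case
    proof (cases "h \<in> B")
      case False
      then obtain s where s: "s \<in> I" "h \<in> s" using inv.hyps by blast
      then have h: "h \<in> N" "proj h = s" "s \<in> S" using mem_simple[of s h] I by auto
      then have "proj (inv h) = s" using proj_inv by simp
      then show ?thesis using mult[of "inv h" x] h s inv.prems by simp
    next
      case True
      then show ?thesis using dcoset_B_left[OF B_inv[OF True]] inv.prems by blast
    qed
  next
    case (eng a c)
    have "a \<in> carrier G" "c \<in> carrier G" "x \<in> carrier G"
      using eng.hyps generate_in_carrier[OF parabolic_generators[OF I]] eng.prems dcoset_closed by auto
    then show ?case using eng.IH(1)[OF eng.IH(2)[OF eng.prems]] by (simp add: m_assoc)
  qed
  moreover have "\<one> \<in> ?Q" using dcoset_one generate.one[of Wl I] by force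
  moreover have "g \<in> carrier G" using g subgroup.mem_carrier[OF parabolic_subgroup[OF I]] by blast
  ultimately show ?thesis by fastforce
qed

lemma parabolic_N:
  assumes I: "I \<subseteq> S" and n: "n \<in> N"
  shows "n \<in> parabolic I \<longleftrightarrow> proj n \<in> generate Wl I"
proof
  interpret W: exchange_group Wl S by (rule Wl_exchange_group)
  {
    assume "n \<in> parabolic I"
    then obtain w where "w \<in> generate Wl I" "n \<in> dcoset w" using parabolic_dcoset[OF I] by blast
    then show "proj n \<in> generate Wl I"
      using dcoset_unique[OF _ dcoset_rep[OF n], of w] W.parabolic_closed[OF I] n by auto
  next
    assume "proj n \<in> generate Wl I"
    then have "proj n \<in> carrier Wl \<and> (\<forall>k\<in>N. proj k = proj n \<longrightarrow> k \<in> parabolic I)"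
    proof induction
      case one
      then show ?case using proj_eq_one_iff B_parabolic by auto
    next
      case (incl s)
      then have "k \<in> parabolic I" if "k \<in> N" "proj k = s" for k
        using mem_Wl[of s k] that I S_subset unfolding parabolic_def by (auto intro!: generate.incl)
      then show ?case using incl I S_subset by blast
    next
      case (inv s)
      then have "inv\<^bsub>Wl\<^esub> s = s" using I by auto
      moreover have "k \<in> parabolic I" if "k \<in> N" "proj k = s" for k
        using inv mem_Wl[of s k] that I S_subset unfolding parabolic_def by (auto intro!: generate.incl)
      ultimately show ?case using inv I S_subset by auto
    next
      case (eng v w)
      have "k \<in> parabolic I" if k: "k \<in> N" "proj k = v \<odot> w" for k
      proof -
        obtain a where a: "a \<in> N" "proj a = v" using eng.IH(1) Wl_rep by blast
        have "proj (inv a \<otimes> k) = w" using proj_mult proj_inv a k eng.IH by simp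
        then have "a \<in> parabolic I" "inv a \<otimes> k \<in> parabolic I" using eng.IH a k by auto
        then have "a \<otimes> (inv a \<otimes> k) \<in> parabolic I" by (rule subgroup.m_closed[OF parabolic_subgroup[OF I]])
        then show ?thesis using a k by simp
      qed
      then show ?case using eng.IH by simp
    qed
    then show "n \<in> parabolic I" using n by blast
  }
qed

lemma bruhat_decomposition:
  assumes "g \<in> carrier G"
  obtains b n c where "b \<in> B" "n \<in> N" "c \<in> B" "g = b \<otimes> n \<otimes> c"
proof -
  have "N \<subseteq> parabolic S" using parabolic_N[of S] S_generates by auto
  then have "generate G (B \<union> N) \<subseteq> parabolic S"
    using B_parabolic parabolic_subgroup[of S] by (intro generate_subgroup_incl) auto
  then have "g \<in> parabolic S" using assms generated by blast
  then obtain w where "g \<in> dcoset w" using parabolic_dcoset[of S g] by blast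
  then show thesis using that by (elim dcosetE)
qed

text \<open>A subgroup containing \<open>B\<close> and \<open>n B n\<^sup>-\<^sup>1\<close> contains the first letter of every reduced word of \<open>n\<close>.\<close>

lemma overgroup_conjugate_mem:
  assumes H: "subgroup H G" "B \<subseteq> H" and K: "B \<subseteq> K" "K \<subseteq> carrier G" and n: "n \<in> N"
    and conj: "\<And>x. x \<in> K \<Longrightarrow> n \<otimes> x \<otimes> inv n \<in> H"
  shows "n \<in> H"
  using n conj
proof (induction "wlen (proj n)" arbitrary: n rule: less_induct)
  case less
  interpret W: exchange_group Wl S by (rule Wl_exchange_group)
  note Hm = subgroup.m_closed[OF H(1)] and Hi = subgroup.m_inv_closed[OF H(1)]
  show ?case
  proof (cases "proj n = \<one>\<^bsub>Wl\<^esub>")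
    case True
    then show ?thesis using proj_eq_one_iff less.prems H by auto
  next
    case False
    then obtain s where s: "s \<in> S" "wlen (s \<odot> proj n) < wlen (proj n)"
      using W.left_descent less.prems by (metis proj_closed)
    then obtain m b where m: "m \<in> N" "proj m = s" "b \<in> B" "m \<otimes> b \<otimes> n \<in> dcoset (proj n)"
      using dcoset_descend[of s n] less.prems by auto
    then obtain b1 k b2 where k: "b1 \<in> B" "k \<in> N" "proj k = proj n" "b2 \<in> B" "m \<otimes> b \<otimes> n = b1 \<otimes> k \<otimes> b2"
      by (elim dcosetE)
    obtain t where t: "t \<in> T" "k = t \<otimes> n" using proj_eq_iff k less.prems by blast
    have "m = m \<otimes> b \<otimes> n \<otimes> inv n \<otimes> inv b" using m less.prems by (simp add: m_assoc)
    also have "\<dots> = b1 \<otimes> t \<otimes> (n \<otimes> b2 \<otimes> inv n) \<otimes> inv b"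
      unfolding k(5) using t k m less.prems by (simp add: m_assoc)
    finally have m_eq: "m = b1 \<otimes> t \<otimes> (n \<otimes> b2 \<otimes> inv n) \<otimes> inv b" .
    have mem: "b1 \<in> H" "t \<in> H" "inv b \<in> H" "n \<otimes> b2 \<otimes> inv n \<in> H"
      using k t m H K less.prems Hi by auto
    have mH: "m \<in> H" unfolding m_eq using Hm[OF Hm[OF Hm[OF mem(1,2)] mem(4)] mem(3)] .
    have "m \<otimes> n \<otimes> x \<otimes> inv (m \<otimes> n) \<in> H" if x: "x \<in> K" for x
    proof -
      have xc: "x \<in> carrier G" using x K by blast
      have "m \<otimes> (n \<otimes> x \<otimes> inv n) \<otimes> inv m \<in> H" using less.prems x mH Hm Hi by simp
      then show ?thesis using m less.prems(1) xc by (simp add: m_assoc inv_mult_group)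
    qed
    then have "m \<otimes> n \<in> H"
      using less.hyps[of "m \<otimes> n"] s m less.prems proj_mult by auto
    then have "inv m \<otimes> (m \<otimes> n) \<in> H" using mH Hm Hi by blast
    then show ?thesis using m less.prems by simp
  qed
qed

lemma conjugate_overgroup_eq:
  assumes H: "subgroup H G" "B \<subseteq> H" and K: "subgroup K G" "B \<subseteq> K"
    and g: "g \<in> carrier G" "H = g <# K #> inv g"
  shows "H = K"
proof -
  note Hm = subgroup.m_closed[OF H(1)] and Hi = subgroup.m_inv_closed[OF H(1)]
  note Km = subgroup.m_closed[OF K(1)] and Ki = subgroup.m_inv_closed[OF K(1)]
  have KG: "K \<subseteq> carrier G" "H \<subseteq> carrier G"
    using subgroup.subset[OF K(1)] subgroup.subset[OF H(1)] by auto
  have mem: "y \<in> H \<longleftrightarrow> (\<exists>x\<in>K. y = g \<otimes> x \<otimes> inv g)" for y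
    unfolding g(2) by (rule mem_conjugate)
  obtain b n c where n: "b \<in> B" "n \<in> N" "c \<in> B" "g = b \<otimes> n \<otimes> c"
    using bruhat_decomposition g(1) by blast
  have BH: "b \<in> H" "inv b \<in> H" "c \<in> K" "inv c \<in> K" using n H(2) K(2) Hi Ki by auto
  have in_H: "n \<otimes> x \<otimes> inv n \<in> H" if x: "x \<in> K" for x
  proof -
    have xc: "x \<in> carrier G" using x KG by blast
    have "inv c \<otimes> x \<otimes> c \<in> K" using x BH Km by simp
    then have "g \<otimes> (inv c \<otimes> x \<otimes> c) \<otimes> inv g \<in> H" using mem by blast
    then have "inv b \<otimes> (g \<otimes> (inv c \<otimes> x \<otimes> c) \<otimes> inv g) \<otimes> b \<in> H" using BH Hm by simp
    moreover have "inv b \<otimes> (g \<otimes> (inv c \<otimes> x \<otimes> c) \<otimes> inv g) \<otimes> b = n \<otimes> x \<otimes> inv n"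
      using n xc by (simp add: m_assoc inv_mult_group)
    ultimately show ?thesis by simp
  qed
  have nH: "n \<in> H" using overgroup_conjugate_mem[OF H K(2) KG(1) n(2) in_H] .
  show ?thesis
  proof
    show "K \<subseteq> H"
    proof
      fix x assume x: "x \<in> K"
      then have xc: "x \<in> carrier G" using KG by blast
      have "inv n \<otimes> (n \<otimes> x \<otimes> inv n) \<otimes> n \<in> H" using in_H[OF x] nH Hm Hi by simp
      then show "x \<in> H" using n xc by (simp add: m_assoc)
    qed
    show "H \<subseteq> K"
    proof
      fix y assume y: "y \<in> H"
      then have yc: "y \<in> carrier G" using KG by blast
      let ?z = "b \<otimes> n \<otimes> y \<otimes> inv n \<otimes> inv b"
      have "?z \<in> H" using y nH BH Hm Hi by simp
      then obtain x where x: "x \<in> K" "?z = g \<otimes> x \<otimes> inv g" using mem by blast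
      have xc: "x \<in> carrier G" using x KG by blast
      have "y = inv n \<otimes> inv b \<otimes> ?z \<otimes> b \<otimes> n" using n yc by (simp add: m_assoc)
      also have "\<dots> = c \<otimes> x \<otimes> inv c" unfolding x(2) using n xc by (simp add: m_assoc inv_mult_group)
      also have "\<dots> \<in> K" using x BH Km by simp
      finally show "y \<in> K" .
    qed
  qed
qed

lemma parabolic_conjugate_eq:
  assumes "I \<subseteq> S" "g \<in> carrier G" "B \<subseteq> g <# parabolic I #> inv g"
  shows "g <# parabolic I #> inv g = parabolic I"
  using conjugate_overgroup_eq[OF conjugate_subgroup[OF parabolic_subgroup[OF assms(1)] assms(2)] assms(3)
    parabolic_subgroup[OF assms(1)] B_parabolic assms(2) refl] .

end

context finite_group_of_Lie_type
begin

lemma Wl_finite: "finite (carrier Wl)"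
  using finite_subset[OF subgroup.subset[OF N_subgroup] finite_carrier] unfolding Wl_carrier by simp

lemma longest_element:
  obtains n0 where "n0 \<in> N" "proj n0 = longest Wl S (carrier Wl)"
    and "\<And>w. w \<in> carrier Wl \<Longrightarrow> wlen w \<le> wlen (proj n0)"
proof -
  let ?w = "longest Wl S (carrier Wl)"
  have "\<forall>y. y \<in> carrier Wl \<longrightarrow> wlen y < Suc (Max (wlen ` carrier Wl))"
    using Wl_finite by (auto simp: less_Suc_eq_le)
  then have "?w \<in> carrier Wl \<and> (\<forall>y. y \<in> carrier Wl \<longrightarrow> wlen y \<le> wlen ?w)"
    unfolding longest_def
    using arg_max_nat_lemma[of "\<lambda>w. w \<in> carrier Wl" "proj \<one>" wlen] by simp
  then show thesis using that Wl_rep by metis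
qed

lemma opposite_borel_eq:
  assumes "n0 \<in> N" "proj n0 = longest Wl S (carrier Wl)"
  shows "opposite_borel G B N S = n0 <# B #> inv n0"
proof -
  let ?w = "proj n0"
  interpret W: group Wl by (rule Wl_group)
  have eq: "opposite_borel G B N S = ?w <#> B <#> inv\<^bsub>Wl\<^esub> ?w"
    unfolding opposite_borel_def Let_def assms(2) by (rule refl)
  have c: "?w \<in> carrier Wl" "inv\<^bsub>Wl\<^esub> ?w \<in> carrier Wl" using assms(1) by simp_all
  show ?thesis
  proof
    show "n0 <# B #> inv n0 \<subseteq> opposite_borel G B N S"
    proof
      fix y assume "y \<in> n0 <# B #> inv n0"
      then obtain b where b: "b \<in> B" "y = n0 \<otimes> b \<otimes> inv n0" using mem_conjugate by blast
      have "n0 \<in> ?w" "inv n0 \<in> inv\<^bsub>Wl\<^esub> ?w"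
        using mem_Wl[OF c(1)] mem_Wl[OF c(2)] assms(1) proj_inv by simp_all
      then show "y \<in> opposite_borel G B N S" unfolding eq b(2) set_mult_def using b(1) by blast
    qed
    show "opposite_borel G B N S \<subseteq> n0 <# B #> inv n0"
    proof
      fix y assume "y \<in> opposite_borel G B N S"
      then obtain n b m where n: "n \<in> ?w" "b \<in> B" "m \<in> inv\<^bsub>Wl\<^esub> ?w" "y = n \<otimes> b \<otimes> m"
        unfolding eq set_mult_def by blast
      obtain t where t: "t \<in> T" "n = t \<otimes> n0" using n(1) mem_proj by blast
      have "m \<in> proj (inv n0)" using n(3) proj_inv assms(1) by simp
      then obtain r where r: "r \<in> T" "m = r \<otimes> inv n0" using mem_proj by blast
      have "inv n0 \<otimes> t \<otimes> inv (inv n0) \<in> B" using T_conj[of "inv n0" t] assms(1) t by simp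
      then have "inv n0 \<otimes> t \<otimes> n0 \<otimes> b \<otimes> r \<in> B" using n(2) r(1) assms(1) by simp
      moreover have "y = n0 \<otimes> (inv n0 \<otimes> t \<otimes> n0 \<otimes> b \<otimes> r) \<otimes> inv n0"
        using n(2,4) t r assms(1) by (simp add: m_assoc)
      ultimately show "y \<in> n0 <# B #> inv n0" using mem_conjugate by blast
    qed
  qed
qed

lemma T_opposite_borel: "T \<subseteq> opposite_borel G B N S"
proof
  fix t assume t: "t \<in> T"
  obtain n0 where n0: "n0 \<in> N" "proj n0 = longest Wl S (carrier Wl)" using longest_element by metis
  have "inv n0 \<otimes> t \<otimes> inv (inv n0) \<in> B" using T_conj[of "inv n0" t] n0 t by simp
  moreover have "t = n0 \<otimes> (inv n0 \<otimes> t \<otimes> inv (inv n0)) \<otimes> inv n0" using n0 t by (simp add: m_assoc)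
  ultimately show "t \<in> opposite_borel G B N S" unfolding opposite_borel_eq[OF n0] using mem_conjugate by blast
qed

lemma opposite_parabolics_N:
  assumes opp: "opposite_parabolics G B N S P Q"
    and BP: "B \<subseteq> P" and BQ: "opposite_borel G B N S \<subseteq> Q"
  obtains I where "I \<subseteq> S" "\<And>n. n \<in> N \<Longrightarrow> n \<in> P \<longleftrightarrow> proj n \<in> generate Wl I"
    "\<And>n. n \<in> N \<Longrightarrow> n \<in> Q \<longleftrightarrow> proj n \<in> generate Wl I"
proof -
  interpret W: exchange_group Wl S by (rule Wl_exchange_group)
  obtain n0 where n0: "n0 \<in> N" "proj n0 = longest Wl S (carrier Wl)"
    "\<And>w. w \<in> carrier Wl \<Longrightarrow> wlen w \<le> wlen (proj n0)" using longest_element by metis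
  have n0c: "n0 \<in> carrier G" using n0 by simp
  let ?w = "proj n0"
  have w: "?w \<in> carrier Wl" using n0(1) by simp
  obtain g I where g: "g \<in> carrier G" and I: "I \<subseteq> S" and P: "P = g <# parabolic I #> inv g"
    and Q: "Q = g <# generate G (opposite_borel G B N S \<union> \<Union>I) #> inv g"
    using opp unfolding opposite_parabolics_def parabolic_def by blast
  have P_eq: "P = parabolic I" using parabolic_conjugate_eq[OF I g] BP P by simp
  define J where "J = (\<lambda>s. inv\<^bsub>Wl\<^esub> ?w \<odot> s \<odot> ?w) ` I"
  have J: "J \<subseteq> S"
  proof
    fix r assume "r \<in> J"
    then obtain s where s: "s \<in> I" "r = inv\<^bsub>Wl\<^esub> ?w \<odot> s \<odot> inv\<^bsub>Wl\<^esub> (inv\<^bsub>Wl\<^esub> ?w)"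
      using w unfolding J_def by auto
    show "r \<in> S" unfolding s(2)
      by (rule W.longest_conjugates_simple) (use w s I n0(3) in auto)
  qed
  have proj_conj: "proj (inv n0 \<otimes> n \<otimes> n0) = inv\<^bsub>Wl\<^esub> ?w \<odot> proj n \<odot> ?w" if "n \<in> N" for n
    using that n0(1) proj_mult proj_inv by simp
  have conj_J: "proj (inv n0 \<otimes> n \<otimes> n0) \<in> generate Wl J \<longleftrightarrow> proj n \<in> generate Wl I" if n: "n \<in> N" for n
  proof
    assume "proj n \<in> generate Wl I"
    then have "inv\<^bsub>Wl\<^esub> ?w \<odot> proj n \<odot> inv\<^bsub>Wl\<^esub> (inv\<^bsub>Wl\<^esub> ?w) \<in> generate Wl J"
      by (intro W.parabolic_conjugate[OF _ I]) (use w in \<open>auto simp: J_def\<close>)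
    then show "proj (inv n0 \<otimes> n \<otimes> n0) \<in> generate Wl J" using proj_conj[OF n] w by simp
  next
    assume "proj (inv n0 \<otimes> n \<otimes> n0) \<in> generate Wl J"
    then have "?w \<odot> proj (inv n0 \<otimes> n \<otimes> n0) \<odot> inv\<^bsub>Wl\<^esub> ?w \<in> generate Wl I"
    proof (rule W.parabolic_conjugate[OF w J, rotated])
      fix r assume "r \<in> J"
      then obtain s where s: "s \<in> I" "r = inv\<^bsub>Wl\<^esub> ?w \<odot> s \<odot> ?w" unfolding J_def by blast
      have "s \<in> carrier Wl" using s I by auto
      then have "?w \<odot> r \<odot> inv\<^bsub>Wl\<^esub> ?w = s" unfolding s(2) using w by (simp add: W.m_assoc)
      then show "?w \<odot> r \<odot> inv\<^bsub>Wl\<^esub> ?w \<in> I" using s by simp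
    qed
    moreover have "?w \<odot> proj (inv n0 \<otimes> n \<otimes> n0) \<odot> inv\<^bsub>Wl\<^esub> ?w = proj n"
      unfolding proj_conj[OF n] using w n by (simp add: W.m_assoc)
    ultimately show "proj n \<in> generate Wl I" by simp
  qed
  let ?O = "generate G (opposite_borel G B N S \<union> \<Union>I)"
  have O_eq: "?O = n0 <# parabolic J #> inv n0"
  proof
    have sub: "opposite_borel G B N S \<union> \<Union>I \<subseteq> n0 <# parabolic J #> inv n0"
    proof
      fix y assume "y \<in> opposite_borel G B N S \<union> \<Union>I"
      then consider b where "b \<in> B" "y = n0 \<otimes> b \<otimes> inv n0" | s where "s \<in> I" "y \<in> s"
        unfolding opposite_borel_eq[OF n0(1,2)] using mem_conjugate by blast
      then show "y \<in> n0 <# parabolic J #> inv n0"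
      proof cases
        case 1
        then show ?thesis using B_parabolic mem_conjugate by blast
      next
        case 2
        then have y: "y \<in> N" "proj y = s" using mem_simple I by blast+
        then have "inv n0 \<otimes> y \<otimes> n0 \<in> parabolic J"
          using conj_J[OF y(1)] parabolic_N[OF J, of "inv n0 \<otimes> y \<otimes> n0"] n0(1) generate.incl[OF 2(1)] by simp
        moreover have "y = n0 \<otimes> (inv n0 \<otimes> y \<otimes> n0) \<otimes> inv n0" using y n0c by (simp add: m_assoc)
        ultimately show ?thesis using mem_conjugate by blast
      qed
    qed
    show "?O \<subseteq> n0 <# parabolic J #> inv n0"
      by (rule generate_subgroup_incl[OF sub conjugate_subgroup[OF parabolic_subgroup[OF J] n0c]])
    have "opposite_borel G B N S \<subseteq> carrier G"
      unfolding opposite_borel_eq[OF n0(1,2)] using n0c by (auto simp: mem_conjugate)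
    then have O: "subgroup ?O G"
      using parabolic_generators[OF I] by (intro generate_is_subgroup) blast
    have "B \<union> \<Union>J \<subseteq> inv n0 <# ?O #> inv (inv n0)"
    proof
      fix y assume y: "y \<in> B \<union> \<Union>J"
      then have yc: "y \<in> carrier G" using parabolic_generators[OF J] by blast
      have "n0 \<otimes> y \<otimes> inv n0 \<in> ?O"
      proof (cases "y \<in> B")
        case True
        then have "n0 \<otimes> y \<otimes> inv n0 \<in> opposite_borel G B N S"
          unfolding opposite_borel_eq[OF n0(1,2)] using mem_conjugate by blast
        then show ?thesis by (auto intro: generate.incl)
      next
        case False
        then obtain r where "r \<in> J" "y \<in> r" using y by blast
        then obtain s where s: "s \<in> I" "proj y = inv\<^bsub>Wl\<^esub> ?w \<odot> s \<odot> ?w" "y \<in> N"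
          using mem_simple J unfolding J_def by blast
        have sc: "s \<in> carrier Wl" using s I by auto
        have "proj (n0 \<otimes> y \<otimes> inv n0) = ?w \<odot> proj y \<odot> inv\<^bsub>Wl\<^esub> ?w"
          using s(3) n0(1) proj_mult proj_inv by simp
        also have "\<dots> = s" unfolding s(2) using w sc by (simp add: W.m_assoc)
        finally have "n0 \<otimes> y \<otimes> inv n0 \<in> s" using mem_Wl[OF sc] s(3) n0(1) by simp
        then show ?thesis using s(1) by (auto intro: generate.incl)
      qed
      moreover have "y = inv n0 \<otimes> (n0 \<otimes> y \<otimes> inv n0) \<otimes> inv (inv n0)" using yc n0c by (simp add: m_assoc)
      ultimately show "y \<in> inv n0 <# ?O #> inv (inv n0)" using mem_conjugate by blast
    qed
    then have PJ: "parabolic J \<subseteq> inv n0 <# ?O #> inv (inv n0)"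
      unfolding parabolic_def
      by (rule generate_subgroup_incl[OF _ conjugate_subgroup[OF O inv_closed[OF n0c]]])
    show "n0 <# parabolic J #> inv n0 \<subseteq> ?O"
    proof
      fix y assume "y \<in> n0 <# parabolic J #> inv n0"
      then obtain x where x: "x \<in> parabolic J" "y = n0 \<otimes> x \<otimes> inv n0" using mem_conjugate by blast
      then obtain z where z: "z \<in> ?O" "x = inv n0 \<otimes> z \<otimes> inv (inv n0)" using PJ mem_conjugate by blast
      have "z \<in> carrier G" using z(1) subgroup.mem_carrier[OF O] by blast
      then have "y = z" unfolding x(2) z(2) using n0c by (simp add: m_assoc)
      then show "y \<in> ?O" using z by simp
    qed
  qed
  let ?h = "inv n0 \<otimes> g \<otimes> n0"
  have h: "?h \<in> carrier G" using n0c g by simp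
  have PJc: "x \<in> carrier G" if "x \<in> parabolic J" for x
    using that subgroup.mem_carrier[OF parabolic_subgroup[OF J]] by blast
  have Q_mem: "y \<in> Q \<longleftrightarrow> inv n0 \<otimes> y \<otimes> n0 \<in> ?h <# parabolic J #> inv ?h" if y: "y \<in> carrier G" for y
  proof -
    have "y \<in> Q \<longleftrightarrow> (\<exists>z\<in>n0 <# parabolic J #> inv n0. y = g \<otimes> z \<otimes> inv g)"
      unfolding Q O_eq by (rule mem_conjugate)
    also have "\<dots> \<longleftrightarrow> (\<exists>x\<in>parabolic J. y = g \<otimes> (n0 \<otimes> x \<otimes> inv n0) \<otimes> inv g)"
      by (metis mem_conjugate)
    also have "\<dots> \<longleftrightarrow> (\<exists>x\<in>parabolic J. inv n0 \<otimes> y \<otimes> n0 = ?h \<otimes> x \<otimes> inv ?h)"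
    proof (intro bex_cong refl)
      fix x assume x: "x \<in> parabolic J"
      have 1: "?h \<otimes> x \<otimes> inv ?h = inv n0 \<otimes> (g \<otimes> (n0 \<otimes> x \<otimes> inv n0) \<otimes> inv g) \<otimes> n0"
        using PJc[OF x] g n0c by (simp add: m_assoc inv_mult_group)
      show "y = g \<otimes> (n0 \<otimes> x \<otimes> inv n0) \<otimes> inv g \<longleftrightarrow> inv n0 \<otimes> y \<otimes> n0 = ?h \<otimes> x \<otimes> inv ?h"
        unfolding 1 using y PJc[OF x] g n0c by simp
    qed
    finally show ?thesis unfolding mem_conjugate .
  qed
  have "B \<subseteq> ?h <# parabolic J #> inv ?h"
  proof
    fix b assume b: "b \<in> B"
    then have "n0 \<otimes> b \<otimes> inv n0 \<in> Q" using BQ mem_conjugate unfolding opposite_borel_eq[OF n0(1,2)] by blast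
    then have "inv n0 \<otimes> (n0 \<otimes> b \<otimes> inv n0) \<otimes> n0 \<in> ?h <# parabolic J #> inv ?h" using Q_mem b n0c by simp
    then show "b \<in> ?h <# parabolic J #> inv ?h" using b n0c by (simp add: m_assoc)
  qed
  then have hJ: "?h <# parabolic J #> inv ?h = parabolic J" by (rule parabolic_conjugate_eq[OF J h])
  show thesis
  proof (rule that[OF I])
    fix n assume n: "n \<in> N"
    show "n \<in> P \<longleftrightarrow> proj n \<in> generate Wl I" unfolding P_eq by (rule parabolic_N[OF I n])
    have "n \<in> Q \<longleftrightarrow> inv n0 \<otimes> n \<otimes> n0 \<in> parabolic J" using Q_mem[of n] n unfolding hJ by simp
    also have "\<dots> \<longleftrightarrow> proj n \<in> generate Wl I" using parabolic_N[OF J, of "inv n0 \<otimes> n \<otimes> n0"] conj_J n n0(1) by simp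
    finally show "n \<in> Q \<longleftrightarrow> proj n \<in> generate Wl I" .
  qed
qed

end

section \<open>The orbits \<open>WeW\<close>\<close>

lemma involution_poset_transport:
  assumes poset: "involution_poset A leq rk I act" and f: "bij_betw f A A'"
    and leq': "\<And>x y. \<lbrakk>x \<in> A; y \<in> A\<rbrakk> \<Longrightarrow> leq' (f x) (f y) \<longleftrightarrow> leq x y"
    and rk': "\<And>x. x \<in> A \<Longrightarrow> rk' (f x) = rk x + c"
  shows "involution_poset A' leq' rk' I (\<lambda>i z. f (act i (inv_into A f z)))"
proof -
  interpret involution_poset A leq rk I act by (rule poset)
  let ?act = "\<lambda>i z. f (act i (inv_into A f z))"
  have inv: "inv_into A f (f x) = x" if "x \<in> A" for x
    using that f by (simp add: bij_betw_def)
  have A': "A' = f ` A" using f by (simp add: bij_betw_def)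
  have inj: "f x = f y \<longleftrightarrow> x = y" if "x \<in> A" "y \<in> A" for x y
    using that f by (auto simp: bij_betw_def inj_on_def)
  have raise: "raise rk' (?act i) (f x) = f (raise rk (act i) x)" if "i \<in> I" "x \<in> A" for i x
    using that act_closed by (simp add: raise_def rk' inv)
  have lower: "lower rk' (?act i) (f x) = f (lower rk (act i) x)" if "i \<in> I" "x \<in> A" for i x
    using that act_closed by (simp add: lower_def rk' inv)
  have closed: "raise rk (act i) x \<in> A" "lower rk (act i) x \<in> A" if "i \<in> I" "x \<in> A" for i x
    using that act_closed by (simp_all add: raise_def lower_def)
  show ?thesis
  proof
    show "finite A'" unfolding A' using finite_poset by simp
    show "leq' x x" if "x \<in> A'" for x using that le_refl leq' unfolding A' by blast
    show "leq' x z" if "x \<in> A'" "y \<in> A'" "z \<in> A'" "leq' x y" "leq' y z" for x y z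
    proof -
      obtain a b c where "a \<in> A" "b \<in> A" "c \<in> A" "x = f a" "y = f b" "z = f c" using \<open>x \<in> A'\<close> \<open>y \<in> A'\<close> \<open>z \<in> A'\<close> A' by blast
      then show ?thesis using \<open>leq' x y\<close> \<open>leq' y z\<close> le_trans[of a b c] leq' by simp
    qed
    show "rk' x < rk' y" if xy: "x \<in> A'" "y \<in> A'" "leq' x y" "x \<noteq> y" for x y
    proof -
      obtain a b where "a \<in> A" "b \<in> A" "x = f a" "y = f b" using xy A' by blast
      then show ?thesis using xy rk_less[of a b] leq' rk' by auto
    qed
    fix i x assume i: "i \<in> I" and "x \<in> A'"
    then obtain a where a: "a \<in> A" "x = f a" using A' by blast
    show "?act i x \<in> A'" "?act i (?act i x) = x"
      using a i act_closed act_act inv A' by auto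
    show "leq' x (?act i x) \<and> rk' (?act i x) = rk' x + 1" if "rk' x < rk' (?act i x)"
      using that a i act_closed act_up[of i a] inv rk' leq' by auto
    show "?act i x = x" if "rk' (?act i x) = rk' x"
      using that a i act_closed act_fixed[of i a] inv rk' by auto
    fix y assume "y \<in> A'" "leq' x y"
    then obtain b where b: "b \<in> A" "y = f b" using A' by blast
    have "leq a b" using \<open>leq' x y\<close> a b leq' by simp
    then show "leq' (raise rk' (?act i) x) (raise rk' (?act i) y)"
      and "leq' (lower rk' (?act i) x) (lower rk' (?act i) y)"
      using raise_mono[of i a b] lower_mono[of i a b] raise lower closed a b i leq' by simp_all
  qed
qed

locale renner_orbit = finite_monoid_of_Lie_type +
  fixes e :: 'a
  assumes e_mem: "e \<in> cross_section_lattice M B N S"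
begin

sublocale G: finite_group_of_Lie_type "units_of M" p B N S
  by (rule unit_group)

lemmas units_simps = units_of_mult units_of_carrier units_of_one

lemma e_closed [simp]: "e \<in> carrier M" and e_idem [simp]: "e \<otimes> e = e"
  using e_mem unfolding cross_section_lattice_def idempotents_def by auto

lemma e_left [simp]: "x \<in> carrier M \<Longrightarrow> e \<otimes> (e \<otimes> x) = e \<otimes> x"
  by (simp flip: m_assoc)

lemma N_Units [simp]: "n \<in> N \<Longrightarrow> n \<in> Units M"
  using G.N_closed by (simp add: units_simps)

lemma N_carrier [simp]: "n \<in> N \<Longrightarrow> n \<in> carrier M"
  by (rule Units_closed[OF N_Units])

lemma N_inv_closed [simp]: "n \<in> N \<Longrightarrow> inv n \<in> N"
  using G.N_inv[of n] by (simp add: units_of_inv)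

lemma N_mult_closed [simp]: "\<lbrakk>n \<in> N; m \<in> N\<rbrakk> \<Longrightarrow> n \<otimes> m \<in> N"
  using G.N_mult[of n m] by (simp add: units_simps)

lemma N_one_closed [simp]: "\<one> \<in> N"
  using G.N_one by (simp add: units_simps)

lemma Units_cancel [simp]: "\<lbrakk>n \<in> Units M; x \<in> carrier M\<rbrakk> \<Longrightarrow> inv n \<otimes> (n \<otimes> x) = x"
  and Units_cancel' [simp]: "\<lbrakk>n \<in> Units M; x \<in> carrier M\<rbrakk> \<Longrightarrow> n \<otimes> (inv n \<otimes> x) = x"
  by (simp_all add: Units_closed flip: m_assoc)

lemma T_mult [simp]: "\<lbrakk>s \<in> B \<inter> N; t \<in> B \<inter> N\<rbrakk> \<Longrightarrow> s \<otimes> t \<in> B \<inter> N"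
  and T_one [simp]: "\<one> \<in> B \<inter> N"
  and T_inv [simp]: "t \<in> B \<inter> N \<Longrightarrow> inv t \<in> B \<inter> N"
  using G.B_mult[of s t] G.B_one G.B_inv[of t] by (simp_all add: units_simps units_of_inv)

lemma T_conj: "\<lbrakk>n \<in> N; t \<in> B \<inter> N\<rbrakk> \<Longrightarrow> n \<otimes> t \<otimes> inv n \<in> B \<inter> N"
  using G.T_conj[of n t] by (simp add: units_simps units_of_inv)

lemma T_e:
  assumes "t \<in> B \<inter> N"
  shows "t \<otimes> e = e \<otimes> t"
proof -
  have "t \<in> P_plus M e" "t \<in> P_minus M e"
    using assms e_mem G.T_opposite_borel unfolding cross_section_lattice_def by auto
  then show ?thesis unfolding P_plus_def P_minus_def by simp
qed

lemma P_plus_minus_iff: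
  assumes "n \<in> N"
  shows "n \<in> P_plus M e \<longleftrightarrow> n \<otimes> e = e \<otimes> n \<otimes> e" "n \<in> P_minus M e \<longleftrightarrow> e \<otimes> n = e \<otimes> n \<otimes> e"
  using assms unfolding P_plus_def P_minus_def by auto

lemma N_parabolic:
  obtains J where "J \<subseteq> S"
    "\<And>n. n \<in> N \<Longrightarrow> G.proj n \<in> generate (Weyl M B N) J \<longleftrightarrow> n \<otimes> e = e \<otimes> n"
    "\<And>n. \<lbrakk>n \<in> N; n \<otimes> e = e \<otimes> n \<otimes> e\<rbrakk> \<Longrightarrow> n \<otimes> e = e \<otimes> n"
    "\<And>n. \<lbrakk>n \<in> N; e \<otimes> n = e \<otimes> n \<otimes> e\<rbrakk> \<Longrightarrow> n \<otimes> e = e \<otimes> n"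
proof -
  have "e \<in> idempotents M" "B \<subseteq> P_plus M e" "opposite_borel (units_of M) B N S \<subseteq> P_minus M e"
    using e_mem unfolding cross_section_lattice_def by auto
  then obtain J where J: "J \<subseteq> S"
    "\<And>n. n \<in> N \<Longrightarrow> n \<in> P_plus M e \<longleftrightarrow> G.proj n \<in> generate (weyl_group (units_of M) B N) J"
    "\<And>n. n \<in> N \<Longrightarrow> n \<in> P_minus M e \<longleftrightarrow> G.proj n \<in> generate (weyl_group (units_of M) B N) J"
    using G.opposite_parabolics_N[OF opposite_parabolic] by metis
  have iff: "G.proj n \<in> generate (weyl_group (units_of M) B N) J \<longleftrightarrow> n \<otimes> e = e \<otimes> n" if n: "n \<in> N" for n
  proof
    assume "G.proj n \<in> generate (weyl_group (units_of M) B N) J"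
    then have "n \<otimes> e = e \<otimes> n \<otimes> e" "e \<otimes> n = e \<otimes> n \<otimes> e"
      using J(2,3)[OF n] P_plus_minus_iff[OF n] by simp_all
    then show "n \<otimes> e = e \<otimes> n" by simp
  next
    assume comm: "n \<otimes> e = e \<otimes> n"
    have "e \<otimes> n \<otimes> e = n \<otimes> e \<otimes> e" using comm by simp
    also have "\<dots> = n \<otimes> e" using n by (simp add: m_assoc)
    finally show "G.proj n \<in> generate (weyl_group (units_of M) B N) J"
      using J(2)[OF n] P_plus_minus_iff(1)[OF n] by simp
  qed
  show thesis
    using that[OF J(1)] iff J(2,3) P_plus_minus_iff unfolding Weyl_def by metis
qed

definition cls :: "'a \<Rightarrow> 'a set" where "cls x = (B \<inter> N) #> x"

definition normalizes_T :: "'a \<Rightarrow> bool" where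
  "normalizes_T x \<longleftrightarrow> x \<in> carrier M \<and> (\<forall>t\<in>B \<inter> N. \<exists>r\<in>B \<inter> N. x \<otimes> t = r \<otimes> x)"

lemma mem_cls: "y \<in> cls x \<longleftrightarrow> (\<exists>t\<in>B \<inter> N. y = t \<otimes> x)"
  unfolding cls_def r_coset_def by auto

lemma cls_eq_iff:
  assumes "x \<in> carrier M" "y \<in> carrier M"
  shows "cls x = cls y \<longleftrightarrow> (\<exists>t\<in>B \<inter> N. x = t \<otimes> y)"
proof
  assume "cls x = cls y"
  moreover have "x = \<one> \<otimes> x" using assms by simp
  then have "x \<in> cls x" using mem_cls T_one by blast
  ultimately show "\<exists>t\<in>B \<inter> N. x = t \<otimes> y" using mem_cls by simp
next
  assume "\<exists>t\<in>B \<inter> N. x = t \<otimes> y"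
  then obtain t where t: "t \<in> B \<inter> N" "x = t \<otimes> y" by blast
  have "z \<in> cls x \<longleftrightarrow> z \<in> cls y" for z
  proof
    assume "z \<in> cls x"
    then obtain r where r: "r \<in> B \<inter> N" "z = r \<otimes> x" using mem_cls by blast
    then have "z = (r \<otimes> t) \<otimes> y" using t assms by (simp add: m_assoc)
    then show "z \<in> cls y" using mem_cls T_mult r t by blast
  next
    assume "z \<in> cls y"
    then obtain r where r: "r \<in> B \<inter> N" "z = r \<otimes> y" using mem_cls by blast
    then have "z = (r \<otimes> inv t) \<otimes> x" using t assms by (simp add: m_assoc)
    then show "z \<in> cls x" using mem_cls T_mult T_inv r t by blast
  qed
  then show "cls x = cls y" by blast
qed

lemma cls_mult:
  assumes x: "normalizes_T x" and y: "y \<in> carrier M"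
  shows "cls x <#> cls y = cls (x \<otimes> y)"
proof
  have xc: "x \<in> carrier M" using x unfolding normalizes_T_def by blast
  have Tc: "t \<in> carrier M" if "t \<in> B \<inter> N" for t using that by simp
  show "cls x <#> cls y \<subseteq> cls (x \<otimes> y)"
  proof
    fix z assume "z \<in> cls x <#> cls y"
    then obtain h k where "h \<in> cls x" "k \<in> cls y" "z = h \<otimes> k" unfolding set_mult_def by blast
    then obtain t r where t: "t \<in> B \<inter> N" "r \<in> B \<inter> N" "z = (t \<otimes> x) \<otimes> (r \<otimes> y)"
      unfolding mem_cls by blast
    obtain q where q: "q \<in> B \<inter> N" "x \<otimes> r = q \<otimes> x" using x t(2) unfolding normalizes_T_def by blast
    have "z = t \<otimes> (x \<otimes> r) \<otimes> y" using t xc y by (simp add: m_assoc)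
    also have "\<dots> = (t \<otimes> q) \<otimes> (x \<otimes> y)" unfolding q(2) using t q(1) xc y by (simp add: m_assoc)
    finally show "z \<in> cls (x \<otimes> y)" using mem_cls T_mult[OF t(1) q(1)] by blast
  qed
  show "cls (x \<otimes> y) \<subseteq> cls x <#> cls y"
  proof
    fix z assume "z \<in> cls (x \<otimes> y)"
    then obtain t where t: "t \<in> B \<inter> N" "z = t \<otimes> (x \<otimes> y)" using mem_cls by blast
    have "z = (t \<otimes> x) \<otimes> (\<one> \<otimes> y)" using t xc y by (simp add: m_assoc)
    moreover have "t \<otimes> x \<in> cls x" "\<one> \<otimes> y \<in> cls y" using mem_cls t(1) T_one by blast+
    ultimately show "z \<in> cls x <#> cls y" unfolding set_mult_def by blast
  qed
qed

lemma normalizes_T_N: "n \<in> N \<Longrightarrow> normalizes_T n"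
  unfolding normalizes_T_def
proof (intro conjI ballI)
  fix t assume n: "n \<in> N" and t: "t \<in> B \<inter> N"
  have "n \<otimes> t = (n \<otimes> t \<otimes> inv n) \<otimes> n" using n t by (simp add: m_assoc)
  then show "\<exists>r\<in>B \<inter> N. n \<otimes> t = r \<otimes> n" using T_conj[OF n t] by blast
qed simp

lemma normalizes_T_e: "normalizes_T e"
  unfolding normalizes_T_def using T_e by force

lemma normalizes_T_mult:
  assumes x: "normalizes_T x" and y: "normalizes_T y"
  shows "normalizes_T (x \<otimes> y)"
  unfolding normalizes_T_def
proof (intro conjI ballI)
  have c: "x \<in> carrier M" "y \<in> carrier M" using x y unfolding normalizes_T_def by auto
  then show "x \<otimes> y \<in> carrier M" by simp
  fix t assume t: "t \<in> B \<inter> N"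
  obtain r where r: "r \<in> B \<inter> N" "y \<otimes> t = r \<otimes> y" using y t unfolding normalizes_T_def by blast
  obtain q where q: "q \<in> B \<inter> N" "x \<otimes> r = q \<otimes> x" using x r unfolding normalizes_T_def by blast
  have "x \<otimes> y \<otimes> t = (x \<otimes> r) \<otimes> y" using c t r by (simp add: m_assoc)
  also have "\<dots> = q \<otimes> (x \<otimes> y)" unfolding q(2) using c q(1) by (simp add: m_assoc)
  finally show "\<exists>r\<in>B \<inter> N. x \<otimes> y \<otimes> t = r \<otimes> (x \<otimes> y)" using q(1) by blast
qed

lemma proj_cls: "G.proj n = cls n"
  unfolding G.proj_def cls_def r_coset_def by (simp add: units_simps)

lemma renner_mult: "x \<otimes>\<^bsub>renner_monoid M B N S\<^esub> y = x <#> y"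
  unfolding renner_monoid_def by simp

lemma idem_class_cls: "idem_class M B N e = cls e"
  unfolding idem_class_def cls_def by simp

lemma orbit_mult:
  assumes "n \<in> N" "m \<in> N"
  shows "G.proj n \<otimes>\<^bsub>renner_monoid M B N S\<^esub> idem_class M B N e \<otimes>\<^bsub>renner_monoid M B N S\<^esub> G.proj m
    = cls (n \<otimes> e \<otimes> m)"
  unfolding renner_mult idem_class_cls proj_cls
  using assms cls_mult[OF normalizes_T_N[OF assms(1)] e_closed]
    cls_mult[OF normalizes_T_mult[OF normalizes_T_N[OF assms(1)] normalizes_T_e], of m] by simp

lemma Weyl_rep:
  assumes "x \<in> carrier (Weyl M B N)"
  obtains n where "n \<in> N" "x = G.proj n"
  using assms G.Wl_rep unfolding Weyl_def by metis

lemma W_centralizer_iff: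
  assumes n: "n \<in> N"
  shows "G.proj n \<in> W_centralizer M B N S e \<longleftrightarrow> n \<otimes> e = e \<otimes> n"
proof -
  have "G.proj n \<in> W_centralizer M B N S e \<longleftrightarrow> cls (n \<otimes> e) = cls (e \<otimes> n)"
    unfolding W_centralizer_def Weyl_def
    using G.proj_closed[OF n] cls_mult[OF normalizes_T_N[OF n] e_closed]
      cls_mult[OF normalizes_T_e N_carrier[OF n]]
    by (simp add: renner_mult idem_class_cls proj_cls)
  also have "\<dots> \<longleftrightarrow> (\<exists>t\<in>B \<inter> N. n \<otimes> e = t \<otimes> (e \<otimes> n))"
    using n by (intro cls_eq_iff) auto
  also have "\<dots> \<longleftrightarrow> n \<otimes> e = e \<otimes> n"
  proof
    assume "\<exists>t\<in>B \<inter> N. n \<otimes> e = t \<otimes> (e \<otimes> n)"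
    then obtain t where t: "t \<in> B \<inter> N" "n \<otimes> e = t \<otimes> (e \<otimes> n)" by blast
    have te: "e \<otimes> (t \<otimes> x) = t \<otimes> (e \<otimes> x)" if "x \<in> carrier M" for x
      using T_e[OF t(1)] that t(1) by (metis Int_iff N_carrier e_closed m_assoc)
    have "e \<otimes> (n \<otimes> e) = n \<otimes> e" unfolding t(2) using n t(1) te by simp
    then have "n \<otimes> e = e \<otimes> n \<otimes> e" using n by (simp add: m_assoc)
    then show "n \<otimes> e = e \<otimes> n" using N_parabolic n by metis
  next
    assume "n \<otimes> e = e \<otimes> n"
    then show "\<exists>t\<in>B \<inter> N. n \<otimes> e = t \<otimes> (e \<otimes> n)" using n T_one by (intro bexI[of _ \<one>]) simp_all
  qed
  finally show ?thesis .
qed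

lemma W_stabilizer_iff:
  assumes n: "n \<in> N"
  shows "G.proj n \<in> W_stabilizer M B N S e \<longleftrightarrow> (\<exists>t\<in>B \<inter> N. n \<otimes> e = t \<otimes> e)"
proof -
  have "G.proj n \<in> W_stabilizer M B N S e \<longleftrightarrow> cls (n \<otimes> e) = cls e"
    unfolding W_stabilizer_def Weyl_def
    using G.proj_closed[OF n] cls_mult[OF normalizes_T_N[OF n] e_closed]
    by (simp add: renner_mult idem_class_cls proj_cls)
  then show ?thesis using cls_eq_iff[of "n \<otimes> e" e] n by simp
qed

lemma W_stabilizer_subset: "W_stabilizer M B N S e \<subseteq> W_centralizer M B N S e"
proof
  fix x assume x: "x \<in> W_stabilizer M B N S e"
  then have "x \<in> carrier (Weyl M B N)" unfolding W_stabilizer_def by blast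
  then obtain n where n: "n \<in> N" "x = G.proj n" using Weyl_rep by blast
  obtain t where t: "t \<in> B \<inter> N" "n \<otimes> e = t \<otimes> e" using W_stabilizer_iff x n by blast
  have "e \<otimes> n \<otimes> e = e \<otimes> t \<otimes> e" using n t by (simp add: m_assoc)
  also have "\<dots> = t \<otimes> e" using T_e[OF t(1), symmetric] t(1) by (simp add: m_assoc)
  finally have "n \<otimes> e = e \<otimes> n \<otimes> e" using t by simp
  then have "n \<otimes> e = e \<otimes> n" using N_parabolic n by metis
  then show "x \<in> W_centralizer M B N S e" using W_centralizer_iff n by simp
qed

lemma W_stabilizer_normal:
  assumes "h \<in> W_centralizer M B N S e" "k \<in> W_stabilizer M B N S e"
  shows "h \<otimes>\<^bsub>Weyl M B N\<^esub> k \<otimes>\<^bsub>Weyl M B N\<^esub> inv\<^bsub>Weyl M B N\<^esub> h \<in> W_stabilizer M B N S e"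
proof -
  have "h \<in> carrier (Weyl M B N)" "k \<in> carrier (Weyl M B N)"
    using assms unfolding W_centralizer_def W_stabilizer_def by auto
  then obtain n m where n: "n \<in> N" "h = G.proj n" and m: "m \<in> N" "k = G.proj m" using Weyl_rep by metis
  have ne: "n \<otimes> e = e \<otimes> n" using assms n W_centralizer_iff by simp
  obtain t where t: "t \<in> B \<inter> N" "m \<otimes> e = t \<otimes> e" using assms m W_stabilizer_iff by blast
  have nie: "inv n \<otimes> e = e \<otimes> inv n"
  proof -
    have "inv n \<otimes> e = inv n \<otimes> (e \<otimes> n) \<otimes> inv n" using n by (simp add: m_assoc)
    also have "\<dots> = e \<otimes> inv n" unfolding ne[symmetric] using n by simp
    finally show ?thesis .
  qed
  have "n \<otimes> m \<otimes> inv n \<otimes> e = n \<otimes> (m \<otimes> e) \<otimes> inv n" using n m nie by (simp add: m_assoc)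
  also have "\<dots> = (n \<otimes> t) \<otimes> (e \<otimes> inv n)" unfolding t(2) using n t(1) by (simp add: m_assoc)
  also have "\<dots> = (n \<otimes> t \<otimes> inv n) \<otimes> e" unfolding nie[symmetric] using n t(1) by (simp add: m_assoc)
  finally have "\<exists>r\<in>B \<inter> N. n \<otimes> m \<otimes> inv n \<otimes> e = r \<otimes> e" using T_conj[OF n(1) t(1)] by blast
  then have "G.proj (n \<otimes> m \<otimes> inv n) \<in> W_stabilizer M B N S e" using W_stabilizer_iff n m by simp
  moreover have "G.proj (n \<otimes> m \<otimes> inv n) = h \<otimes>\<^bsub>Weyl M B N\<^esub> k \<otimes>\<^bsub>Weyl M B N\<^esub> inv\<^bsub>Weyl M B N\<^esub> h"
    using G.proj_mult[of "n \<otimes> m" "inv n"] G.proj_mult[of n m] G.proj_inv[of n] n m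
    unfolding Weyl_def by (simp add: units_simps units_of_inv)
  ultimately show ?thesis by simp
qed

lemma orbit_eq_iff:
  assumes N: "a \<in> N" "b \<in> N" "a' \<in> N" "b' \<in> N"
    and eq: "cls (a \<otimes> e \<otimes> inv b) = cls (a' \<otimes> e \<otimes> inv b')"
  obtains n m where "n \<in> N" "m \<in> N" "G.proj a' = G.proj (a \<otimes> n)" "b' = b \<otimes> m"
    "n \<otimes> e = e \<otimes> n" "m \<otimes> e = e \<otimes> m" "n \<otimes> e = e \<otimes> m"
proof -
  obtain t where t: "t \<in> B \<inter> N" "a \<otimes> e \<otimes> inv b = t \<otimes> (a' \<otimes> e \<otimes> inv b')"
    using cls_eq_iff eq N by auto
  define n where "n = inv a \<otimes> t \<otimes> a'"
  define m where "m = inv b \<otimes> b'"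
  have nm: "n \<in> N" "m \<in> N" using N t by (simp_all add: n_def m_def)
  have "n \<otimes> e = inv a \<otimes> (t \<otimes> (a' \<otimes> e \<otimes> inv b')) \<otimes> b'"
    using N t(1) by (simp add: n_def m_assoc)
  also have "\<dots> = e \<otimes> m" unfolding t(2)[symmetric] using N by (simp add: m_def m_assoc)
  finally have ne: "n \<otimes> e = e \<otimes> m" .
  have "e \<otimes> n \<otimes> e = e \<otimes> (e \<otimes> m)" using ne nm by (simp add: m_assoc)
  then have "n \<otimes> e = e \<otimes> n \<otimes> e" using ne nm by simp
  then have n: "n \<otimes> e = e \<otimes> n" using N_parabolic nm by metis
  have "e \<otimes> m \<otimes> e = n \<otimes> e \<otimes> e" using ne by simp
  also have "\<dots> = e \<otimes> m" unfolding ne[symmetric] using nm by (simp add: m_assoc)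
  finally have "e \<otimes> m = e \<otimes> m \<otimes> e" by simp
  then have m: "m \<otimes> e = e \<otimes> m" using N_parabolic nm by metis
  have an: "a \<otimes> n = t \<otimes> a'" using N t(1) by (simp add: n_def m_assoc)
  have "G.proj (a \<otimes> n) = G.proj a'"
    using G.proj_eq_iff[of "a \<otimes> n" a'] N nm t(1) an by (auto simp: units_simps)
  moreover have "b' = b \<otimes> m" using N by (simp add: m_def m_assoc)
  ultimately show thesis using that nm n m ne by simp
qed

lemma orbit_involution_poset:
  assumes "standard_parabolic (Weyl M B N) S (W_stabilizer M B N S e)"
  shows "\<exists>act. involution_poset (orbit M B N S e) (orbit_le M B N S e) (orbit_length M B N S e)
      ((UNIV :: bool set) \<times> S) act \<and>
    (\<forall>\<rho>\<in>orbit M B N S e. \<forall>\<tau>\<in>orbit M B N S e. orbit_le M B N S e \<rho> \<tau> \<and> \<rho> \<noteq> \<tau> \<longrightarrow>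
      (\<exists>i\<in>UNIV \<times> S. orbit_length M B N S e (act i \<tau>) < orbit_length M B N S e \<tau>))"
proof -
  let ?W = "Weyl M B N" and ?E = "idem_class M B N e"
  let ?O = "orbit M B N S e" and ?le = "orbit_le M B N S e" and ?rk = "orbit_length M B N S e"
  let ?Z = "W_centralizer M B N S e" and ?Y = "W_stabilizer M B N S e"
  interpret W: exchange_group ?W S unfolding Weyl_def by (rule G.Wl_exchange_group)
  obtain J where J: "J \<subseteq> S" "\<And>n. n \<in> N \<Longrightarrow> G.proj n \<in> generate ?W J \<longleftrightarrow> n \<otimes> e = e \<otimes> n"
    using N_parabolic by metis
  have projc: "G.proj n \<in> carrier ?W" if "n \<in> N" for n using that unfolding Weyl_def by simp
  have proj_mult: "G.proj (n \<otimes> m) = G.proj n \<otimes>\<^bsub>?W\<^esub> G.proj m" if "n \<in> N" "m \<in> N" for n m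
    using G.proj_mult[OF that] unfolding Weyl_def by (simp add: units_simps)
  have proj_inv: "G.proj (inv n) = inv\<^bsub>?W\<^esub> G.proj n" if "n \<in> N" for n
    using G.proj_inv[OF that] that unfolding Weyl_def by (simp add: units_of_inv)
  have Z: "?Z = generate ?W J"
  proof -
    have "x \<in> ?Z \<longleftrightarrow> x \<in> generate ?W J" if "x \<in> carrier ?W" for x
      using that W_centralizer_iff J(2) Weyl_rep by metis
    moreover have "?Z \<subseteq> carrier ?W" unfolding W_centralizer_def by blast
    ultimately show ?thesis using W.parabolic_closed[OF J(1)] by blast
  qed
  obtain K where K: "K \<subseteq> S" "?Y = generate ?W K" using assms unfolding standard_parabolic_def by blast
  have KJ: "K \<subseteq> J"
  proof
    fix s assume s: "s \<in> K"
    then have "s \<in> ?Y" unfolding K(2) by (rule generate.incl)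
    then have "s \<in> generate ?W J" using W_stabilizer_subset Z by blast
    then show "s \<in> J" using W.simple_in_parabolic[OF J(1)] s K(1) by blast
  qed
  interpret Q: parabolic_pair ?W S J K
    using J(1) KJ W_stabilizer_normal unfolding Z K(2) by unfold_locales blast+
  define f where "f = (\<lambda>(x, y). x \<otimes>\<^bsub>renner_monoid M B N S\<^esub> ?E \<otimes>\<^bsub>renner_monoid M B N S\<^esub> inv\<^bsub>?W\<^esub> y)"
  have f_proj: "f (G.proj a, G.proj b) = cls (a \<otimes> e \<otimes> inv b)" if "a \<in> N" "b \<in> N" for a b
    unfolding f_def using orbit_mult[of a "inv b"] that proj_inv by simp
  have form: "standard_form M B N S e \<tau> x y \<longleftrightarrow> (x, y) \<in> Q.pairs \<and> \<tau> = f (x, y)" for \<tau> x y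
    unfolding standard_form_def Z K(2) W.min_coset_reps_eq[OF J(1)] W.min_coset_reps_eq[OF K(1)]
      Q.pairs_def f_def by simp
  have inj: "inj_on f Q.pairs"
  proof (rule inj_onI, clarify)
    fix x y x' y'
    assume xy: "(x, y) \<in> Q.pairs" "(x', y') \<in> Q.pairs" and eq: "f (x, y) = f (x', y')"
    then have D: "x \<in> Q.DK" "y \<in> Q.DJ" "x' \<in> Q.DK" "y' \<in> Q.DJ" by (auto simp: Q.pairs_def)
    then obtain a b a' b' where ab: "a \<in> N" "b \<in> N" "a' \<in> N" "b' \<in> N"
      "x = G.proj a" "y = G.proj b" "x' = G.proj a'" "y' = G.proj b'"
      using Weyl_rep W.min_reps_closed by metis
    have "cls (a \<otimes> e \<otimes> inv b) = cls (a' \<otimes> e \<otimes> inv b')" using eq f_proj ab by simp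
    then obtain n m where nm: "n \<in> N" "m \<in> N" "G.proj a' = G.proj (a \<otimes> n)" "b' = b \<otimes> m"
      "n \<otimes> e = e \<otimes> n" "m \<otimes> e = e \<otimes> m" "n \<otimes> e = e \<otimes> m"
      using orbit_eq_iff ab by metis
    have x': "x' = x \<otimes>\<^bsub>?W\<^esub> G.proj n" and y': "y' = y \<otimes>\<^bsub>?W\<^esub> G.proj m" using nm ab proj_mult by auto
    have "G.proj m \<in> generate ?W J" using J(2) nm by simp
    then have m1: "G.proj m = \<one>\<^bsub>?W\<^esub>" using W.min_rep_unique[OF J(1) D(2)] D(4) y' by simp
    then have "m \<in> B \<inter> N" using G.proj_eq_one_iff nm unfolding Weyl_def by simp
    then have "n \<otimes> e = m \<otimes> e" "m \<in> B \<inter> N" using nm by simp_all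
    then have "G.proj n \<in> generate ?W K" using W_stabilizer_iff nm(1) unfolding K(2) by blast
    then have n1: "G.proj n = \<one>\<^bsub>?W\<^esub>" using W.min_rep_unique[OF K(1) D(1)] D(3) x' by simp
    show "x = x' \<and> y = y'" using x' y' n1 m1 D by simp
  qed
  have image: "f ` Q.pairs = ?O"
  proof
    show "f ` Q.pairs \<subseteq> ?O"
    proof
      fix \<tau> assume "\<tau> \<in> f ` Q.pairs"
      then obtain x y where "x \<in> Q.DK" "y \<in> Q.DJ"
        "\<tau> = x \<otimes>\<^bsub>renner_monoid M B N S\<^esub> ?E \<otimes>\<^bsub>renner_monoid M B N S\<^esub> inv\<^bsub>?W\<^esub> y"
        unfolding f_def Q.pairs_def by auto
      then show "\<tau> \<in> ?O" unfolding orbit_def using W.inv_closed W.min_reps_closed by blast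
    qed
    show "?O \<subseteq> f ` Q.pairs"
    proof
      fix \<tau> assume "\<tau> \<in> ?O"
      then obtain x y where xy: "x \<in> carrier ?W" "y \<in> carrier ?W"
        "\<tau> = x \<otimes>\<^bsub>renner_monoid M B N S\<^esub> ?E \<otimes>\<^bsub>renner_monoid M B N S\<^esub> y" unfolding orbit_def by blast
      obtain y0 h where y0: "y0 \<in> Q.DJ" "h \<in> generate ?W J" "inv\<^bsub>?W\<^esub> y = y0 \<otimes>\<^bsub>?W\<^esub> h"
        using W.min_rep_exists[OF J(1)] xy by blast
      have hc: "h \<in> carrier ?W" "y0 \<in> carrier ?W" using y0 W.parabolic_closed[OF J(1)] by auto
      obtain x0 k where x0: "x0 \<in> Q.DK" "k \<in> generate ?W K" "x \<otimes>\<^bsub>?W\<^esub> inv\<^bsub>?W\<^esub> h = x0 \<otimes>\<^bsub>?W\<^esub> k"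
        using W.min_rep_exists[OF K(1), of "x \<otimes>\<^bsub>?W\<^esub> inv\<^bsub>?W\<^esub> h"] xy hc by auto
      have kc: "k \<in> carrier ?W" "x0 \<in> carrier ?W" using x0 W.parabolic_closed[OF K(1)] by auto
      obtain a b c d q where rep: "a \<in> N" "x = G.proj a" "b \<in> N" "y0 = G.proj b" "c \<in> N" "h = G.proj c"
        "d \<in> N" "k = G.proj d" "q \<in> N" "x0 = G.proj q"
        using Weyl_rep xy hc kc by metis
      have "y = inv\<^bsub>?W\<^esub> (y0 \<otimes>\<^bsub>?W\<^esub> h)" unfolding y0(3)[symmetric] using xy by simp
      then have y: "y = G.proj (inv c \<otimes> inv b)" using rep hc proj_mult proj_inv by (simp add: W.inv_mult_group)
      have ce: "c \<otimes> e = e \<otimes> c" using J(2) y0 rep by simp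
      obtain t where t: "t \<in> B \<inter> N" "d \<otimes> e = t \<otimes> e" using W_stabilizer_iff x0 rep K(2) by auto
      have "G.proj a = G.proj (q \<otimes> d \<otimes> c)"
      proof -
        have "x = x \<otimes>\<^bsub>?W\<^esub> inv\<^bsub>?W\<^esub> h \<otimes>\<^bsub>?W\<^esub> h" using xy hc by (simp add: W.m_assoc)
        then show ?thesis unfolding x0(3) using rep proj_mult by simp
      qed
      then obtain r where r: "r \<in> B \<inter> N" "a = r \<otimes> (q \<otimes> d \<otimes> c)"
        using G.proj_eq_iff[of a "q \<otimes> d \<otimes> c"] rep by (auto simp: units_simps)
      have "\<tau> = cls (a \<otimes> e \<otimes> (inv c \<otimes> inv b))"
        unfolding xy(3) rep(2) y using orbit_mult rep by simp
      also have "a \<otimes> e \<otimes> (inv c \<otimes> inv b) = r \<otimes> q \<otimes> d \<otimes> (c \<otimes> e) \<otimes> inv c \<otimes> inv b"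
        unfolding r(2) using r(1) rep by (simp add: m_assoc)
      also have "\<dots> = r \<otimes> q \<otimes> (d \<otimes> e) \<otimes> inv b"
        unfolding ce using r(1) rep by (simp add: m_assoc)
      also have "\<dots> = r \<otimes> (q \<otimes> t) \<otimes> (e \<otimes> inv b)"
        unfolding t(2) using t(1) r(1) rep by (simp add: m_assoc)
      also have "\<dots> = (r \<otimes> (q \<otimes> t \<otimes> inv q)) \<otimes> (q \<otimes> e \<otimes> inv b)"
        using t(1) r(1) rep by (simp add: m_assoc)
      also have "cls \<dots> = cls (q \<otimes> e \<otimes> inv b)"
      proof -
        have "r \<otimes> (q \<otimes> t \<otimes> inv q) \<in> B \<inter> N" using T_mult[OF r(1) T_conj[OF rep(9) t(1)]] .
        then show ?thesis using cls_eq_iff rep t(1) r(1) by auto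
      qed
      also have "\<dots> = f (x0, y0)" using f_proj rep by simp
      finally show "\<tau> \<in> f ` Q.pairs" using x0 y0 by (auto simp: Q.pairs_def)
    qed
  qed
  have bij: "bij_betw f Q.pairs ?O" using inj image by (simp add: bij_betw_def)
  have unique: "standard_form M B N S e (f z) x y \<longleftrightarrow> z = (x, y)" if "z \<in> Q.pairs" for z x y
    using that inj form by (auto simp: inj_on_def)
  have rk: "?rk (f z) = Q.pair_rank z + idem_length M B N S e" if z: "z \<in> Q.pairs" for z
  proof -
    obtain x y where xy: "z = (x, y)" by fastforce
    show ?thesis
      unfolding orbit_length_def unique[OF z] unfolding xy Q.pair_rank_def
      by (rule the_equality) auto
  qed
  have le: "?le (f z) (f z') \<longleftrightarrow> Q.pair_le z z'" if z: "z \<in> Q.pairs" "z' \<in> Q.pairs" for z z'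
  proof -
    obtain u v x y where eq: "z = (u, v)" "z' = (x, y)" by (metis surj_pair)
    show ?thesis
      unfolding orbit_le_def unique[OF z(1)] unique[OF z(2)] Z Q.pair_le_def unfolding eq by auto
  qed
  have fin: "finite (carrier ?W)" unfolding Weyl_def by (rule G.Wl_finite)
  let ?act = "\<lambda>i \<tau>. f (Q.act i (inv_into Q.pairs f \<tau>))"
  have poset: "involution_poset ?O ?le ?rk (UNIV \<times> S) ?act"
    by (rule involution_poset_transport[where leq = Q.pair_le and rk = Q.pair_rank and c = "idem_length M B N S e",
          OF Q.involution_poset_pairs[OF fin] bij])
      (assumption | erule (1) le | erule rk)+
  have desc: "\<exists>i\<in>UNIV \<times> S. ?rk (?act i \<tau>) < ?rk \<tau>"
    if \<rho>\<tau>: "\<rho> \<in> ?O" "\<tau> \<in> ?O" "?le \<rho> \<tau>" "\<rho> \<noteq> \<tau>" for \<rho> \<tau>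
  proof -
    obtain z where z: "z \<in> Q.pairs" "\<rho> = f z" using \<rho>\<tau>(1) unfolding image[symmetric] by (rule imageE)
    obtain z' where z': "z' \<in> Q.pairs" "\<tau> = f z'" using \<rho>\<tau>(2) unfolding image[symmetric] by (rule imageE)
    have "Q.pair_le z z'" "z \<noteq> z'" using \<rho>\<tau>(3,4) le[OF z(1) z'(1)] unfolding z(2) z'(2) by auto
    then obtain i where i: "i \<in> UNIV \<times> S" "Q.pair_rank (Q.act i z') < Q.pair_rank z'"
      using Q.pair_descent_act[OF z(1) z'(1)] by blast
    have "inv_into Q.pairs f \<tau> = z'" unfolding z'(2) by (rule inv_into_f_f[OF inj z'(1)])
    moreover have "Q.act i z' \<in> Q.pairs"
      by (rule involution_poset.act_closed[OF Q.involution_poset_pairs[OF fin] i(1) z'(1)])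
    ultimately have "?rk (?act i \<tau>) < ?rk \<tau>" using i(2) rk[of "Q.act i z'"] rk[OF z'(1)] unfolding z'(2) by simp
    then show ?thesis using i(1) by (rule bexI)
  qed
  show ?thesis
  proof (intro exI[of _ ?act] conjI ballI impI poset)
    fix \<rho> \<tau> assume "\<rho> \<in> ?O" "\<tau> \<in> ?O" "?le \<rho> \<tau> \<and> \<rho> \<noteq> \<tau>"
    then show "\<exists>i\<in>UNIV \<times> S. ?rk (?act i \<tau>) < ?rk \<tau>" using desc by simp
  qed
qed

end

theorem theorem5p8:
  fixes M :: "('a, 'b) monoid_scheme" and p :: nat
    and B N :: "'a set" and S :: "'a set set" and e :: 'a and \<theta> \<sigma> :: "'a set"
  assumes "finite_monoid_of_Lie_type M p B N S"
    and "e \<in> cross_section_lattice M B N S"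
    and "standard_parabolic (Weyl M B N) S (W_stabilizer M B N S e)"
    and "\<theta> \<in> orbit M B N S e" and "\<sigma> \<in> orbit M B N S e"
    and "orbit_le M B N S e \<theta> \<sigma>"
  shows "mobius (orbit M B N S e) (orbit_le M B N S e) \<theta> \<sigma> =
    (if \<forall>\<alpha>\<in>orbit M B N S e. \<forall>\<beta>\<in>orbit M B N S e.
          orbit_le M B N S e \<alpha> \<beta> \<and>
          orbit_length M B N S e \<beta> - orbit_length M B N S e \<alpha> = 2 \<and>
          orbit_interval M B N S e \<alpha> \<beta> \<subseteq> orbit_interval M B N S e \<theta> \<sigma> \<longrightarrow>
          card (orbit_interval M B N S e \<alpha> \<beta>) = 4
     then (-1) ^ nat (orbit_length M B N S e \<sigma> - orbit_length M B N S e \<theta>)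
     else 0)"
proof -
  have "renner_orbit M p B N S e"
    using assms(1,2) by (rule renner_orbit.intro[OF _ renner_orbit_axioms.intro])
  then obtain act where poset: "involution_poset (orbit M B N S e) (orbit_le M B N S e)
      (orbit_length M B N S e) ((UNIV :: bool set) \<times> S) act"
    and desc: "\<forall>\<rho>\<in>orbit M B N S e. \<forall>\<tau>\<in>orbit M B N S e. orbit_le M B N S e \<rho> \<tau> \<and> \<rho> \<noteq> \<tau> \<longrightarrow>
      (\<exists>i\<in>UNIV \<times> S. orbit_length M B N S e (act i \<tau>) < orbit_length M B N S e \<tau>)"
    using renner_orbit.orbit_involution_poset[OF _ assms(3)] by metis
  show ?thesis
    unfolding orbit_interval_def
    by (rule involution_poset.mobius_eq[OF poset _ assms(4-6)]) (use desc in simp)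
qed

end
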